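(* Let $d\in\mathbb{N}$. Define the critical wave number as $$k_c=\frac{1}{\tau}\sqrt{\frac{\pi}{2}},$$ and consider the initial condition $$f_0(x,v)=2A\cos(k_0\cdot x)\,\phi(v)$$ for some amplitude $A>0$ and some frequency $k_0\in\mathbb{Z}^d$. There exist two separate scaling regimes for the linear density-dependent BGK equation in frequency space, $$\frac{\partial\hat f_k}{\partial t}+\mathrm{i}(k\cdot v)\hat f_k=-\frac1\tau\big(\hat f_k-\hat\rho_k\,\phi(v)\big),\qquad k\in\mathbb{Z}^d:$$ 1. Let $|k_0|<k_c$, with $k_0$ independent of $\tau$. The dissipation rate of the mass density evaluated along the solution with initial condition $f_0$ follows the Chapman--Enskog scaling in the limit of vanishing Knudsen number: $$\Delta[\hat\rho](k_0,t,\tau)\sim\tau|k_0|^2,\qquad\tau\to0,\quad t>0.$$ 2. Let $|k_0|\ge k_c$, where $k_0$ depends on $\tau$ in such a way that $\beta=\tau|k_0|$ is of order one in $\tau$. The dissipation rate of the mass density evaluated along the solution with initial condition $f_0$ violates the Chapman--Enskog scaling in the limit of vanishing Knudsen number and becomes divergent: $$\Delta[\hat\rho](k_0,t,\tau)\sim\frac{Z'(\hat\zeta_\beta)}{\tau},\qquad\tau\to0,\quad t>0,$$ where $Z$ is the plasma dispersion function (extended to the lower half-plane by its entire branch $Z^+$) and $Z(\hat\zeta_\beta)=\mathrm{i}\beta$ with $\beta=\tau|k_0|$. In particular, for every Knudsen number $\tau$, there exists a solution to the linear density-dependent BGK equation $$\partial_t f+v\cdot\nabla_x f=-\frac1\tau\big(f-\rho[f]\,\phi(v)\big)$$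 whose dissipation rate of the mass density is of order $\tau^{-1}$.
   Context: $\mathbb{T}^d$ is the $d$-dimensional torus with period $2\pi$ in each coordinate. The unknown of the BGK equation is the distribution function $f:\mathbb{T}^d\times\mathbb{R}^d\times[0,\infty)\to\mathbb{R}$, $f=f(x,v,t)$. The parameter $\tau>0$ is the global relaxation time and plays the role of the Knudsen number. The normalized global Maxwellian is $\phi(v)=(2\pi)^{-d/2}e^{-|v|^2/2}$, $v\in\mathbb{R}^d$. The macroscopic mass density is $\rho[f](x,t)=\int_{\mathbb{R}^d}f(x,v,t)\,dv$. Fourier series: $f(x,v,t)=\sum_{k\in\mathbb{Z}^d}\hat f_k(v,t)e^{\mathrm{i}k\cdot x}$ with $\hat f_k(v,t)=(2\pi)^{-d}\int_{\mathbb{T}^d}f(x,v,t)e^{-\mathrm{i}k\cdot x}\,dx$, and $\hat\rho_k(t)=\int_{\mathbb{R}^d}\hat f_k(v,t)\,dv$. The dissipation rate of the macroscopic density in frequency space is $$\Delta[\hat\rho](k,t,\tau)=-\frac{1}{\hat\rho_k(t)}\frac{\partial\hat\rho_k}{\partial t}(t).$$ The Chapman--Enskog scaling is the dissipation rate $\tau|k|^2$ of the first-order Chapman--Enskog approximation, i.e. of the heat equation $\partial_t\rho=\tau\Delta_x\rho$, where $\Delta_x$ is the Laplacian in $x$. Plasma dispersion function: $Z(\zeta)=\frac{1}{\sqrt{2\pi}}\int_{\mathbb{R}}\frac{e^{-v^2/2}}{v-\zeta}\,dv$ for $\operatorname{Im}\zeta\ne0$. Its restriction to the upper half-plane extends to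 the entire function $$Z^+(\zeta)=\mathrm{i}\sqrt{\tfrac{\pi}{2}}\,e^{-\zeta^2/2}\Big[1-\operatorname{erf}\Big(\tfrac{-\mathrm{i}\zeta}{\sqrt2}\Big)\Big],\qquad\zeta\in\mathbb{C},$$ where $\operatorname{erf}(z)=\frac{2}{\sqrt\pi}\int_0^z e^{-u^2}\,du$. In part 2, $Z$ and its complex derivative $Z'$ are understood as $Z^+$ and $(Z^+)'$, and $\hat\zeta_\beta$ is the purely imaginary solution of $Z^+(\hat\zeta_\beta)=\mathrm{i}\beta$, lying in the closed lower half-plane for $\beta\ge\sqrt{\pi/2}$.
   Formalization: In part 2 the sign is corrected: the dissipation rate is asymptotic to -Z'(ζ̂_β)/τ, since with the given definitions Z'(ζ̂_β) ≤ -1 while the rate is positive (for β = √(π/2), ζ̂_β = 0 and Z'(0) = -1). *)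

theory Defs
  imports "HOL-Complex_Analysis.Complex_Analysis" "HOL-Library.Landau_Symbols"
begin

text \<open>The dimension d is CARD('d). Functions on the torus are functions on real ^ 'd
  with period 2 pi in each coordinate; frequencies are integer vectors.\<close>

definition wavevec :: "int ^ 'd \<Rightarrow> real ^ 'd" where
  "wavevec k = (\<chi> i. real_of_int (k $ i))"

definition maxwellian :: "real ^ 'd \<Rightarrow> real" where
  "maxwellian v = (2 * pi) powr (- real CARD('d) / 2) * exp (- (norm v)\<^sup>2 / 2)"

text \<open>Used both for the density of f at a fixed point x and for the density of a fixed
  Fourier coefficient; hence the polymorphic codomain.\<close>

definition mass_density ::
  "(real ^ 'd \<Rightarrow> real \<Rightarrow> 'b::{banach, second_countable_topology}) \<Rightarrow> real \<Rightarrow> 'b" where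
  "mass_density g t = (LINT v|lborel. g v t)"

definition fourier_coeff :: "(real ^ 'd \<Rightarrow> real) \<Rightarrow> int ^ 'd \<Rightarrow> complex" where
  "fourier_coeff g k =
     (LINT x:cbox 0 (vec (2 * pi))|lborel.
        complex_of_real (g x) * exp (- \<i> * complex_of_real (wavevec k \<bullet> x)))
     / (2 * pi) ^ CARD('d)"

definition dissipation_rate :: "(int ^ 'd \<Rightarrow> real \<Rightarrow> complex) \<Rightarrow> int ^ 'd \<Rightarrow> real \<Rightarrow> complex" where
  "dissipation_rate \<rho> k t = - (1 / \<rho> k t) * vector_derivative (\<rho> k) (at t)"

definition critical_wave_number :: "real \<Rightarrow> real" where
  "critical_wave_number \<tau> = 1 / \<tau> * sqrt (pi / 2)"

definition cosine_data :: "real \<Rightarrow> int ^ 'd \<Rightarrow> real ^ 'd \<Rightarrow> real ^ 'd \<Rightarrow> real" where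
  "cosine_data A k\<^sub>0 x v = 2 * A * cos (wavevec k\<^sub>0 \<bullet> x) * maxwellian v"

text \<open>Classical solutions on the time interval [0, oo). The equations hold for every v;
  the densities exist and are differentiable in time, so that the dissipation rate is
  meaningful. At t = 0 the time derivatives are one-sided.\<close>

definition bgk_fourier_solution ::
  "real \<Rightarrow> (real ^ 'd \<Rightarrow> real ^ 'd \<Rightarrow> real) \<Rightarrow> (int ^ 'd \<Rightarrow> real ^ 'd \<Rightarrow> real \<Rightarrow> complex) \<Rightarrow> bool" where
  "bgk_fourier_solution \<tau> g fh \<longleftrightarrow>
     (\<forall>k v. fh k v 0 = fourier_coeff (\<lambda>x. g x v) k) \<and>
     (\<forall>k. \<forall>t\<ge>0. integrable lborel (\<lambda>v. fh k v t)) \<and>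
     (\<forall>k. \<forall>t\<ge>0. mass_density (fh k) differentiable (at t within {0..})) \<and>
     (\<forall>k v. \<forall>t\<ge>0.
        (fh k v has_vector_derivative
           - \<i> * complex_of_real (wavevec k \<bullet> v) * fh k v t
           - 1 / complex_of_real \<tau> *
               (fh k v t - mass_density (fh k) t * complex_of_real (maxwellian v)))
        (at t within {0..}))"

definition bgk_solution ::
  "real \<Rightarrow> (real ^ 'd \<Rightarrow> real ^ 'd \<Rightarrow> real \<Rightarrow> real) \<Rightarrow> bool" where
  "bgk_solution \<tau> f \<longleftrightarrow>
     (\<forall>x v. \<forall>t\<ge>0. \<forall>i. f (x + axis i (2 * pi)) v t = f x v t) \<and>
     (\<forall>x. \<forall>t\<ge>0. integrable lborel (\<lambda>v. f x v t)) \<and>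
     (\<forall>x. \<forall>t\<ge>0. mass_density (f x) differentiable (at t within {0..})) \<and>
     (\<forall>x v. \<forall>t\<ge>0. \<exists>ft grad.
        (f x v has_real_derivative ft) (at t within {0..}) \<and>
        GDERIV (\<lambda>y. f y v t) x :> grad \<and>
        ft + v \<bullet> grad = - 1 / \<tau> * (f x v t - mass_density (f x) t * maxwellian v))"

definition cerf :: "complex \<Rightarrow> complex" where
  "cerf z = 2 / complex_of_real (sqrt pi) * contour_integral (linepath 0 z) (\<lambda>u. exp (- u\<^sup>2))"

text \<open>The entire continuation of the plasma dispersion function
  (2 pi)^(-1/2) * (integral of exp (- v^2 / 2) / (v - zeta) over real v)
  from the upper half-plane.\<close>

definition plasma_Z :: "complex \<Rightarrow> complex" where
  "plasma_Z \<zeta> = \<i> * complex_of_real (sqrt (pi / 2)) * exp (- \<zeta>\<^sup>2 / 2)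
     * (1 - cerf (- \<i> * \<zeta> / complex_of_real (sqrt 2)))"

text \<open>On the imaginary axis plasma_Z (i y) / i is real and strictly decreasing from infinity
  to 0, so for b > 0 the description below is proper. From Z' = - 1 - zeta Z one gets
  Z' (i y) = b y - 1 at the solution zeta = i y; this is a real number, and at most - 1 for
  b >= sqrt (pi / 2), where y <= 0. The decay rate of the corresponding mode, measured in
  units of 1 / tau, is the positive number 1 - b y = - Z'.\<close>

definition zeta_hat :: "real \<Rightarrow> complex" where
  "zeta_hat b = (THE \<zeta>. Re \<zeta> = 0 \<and> plasma_Z \<zeta> = \<i> * complex_of_real b)"

end

theory Submission
  imports Defs "HOL-Probability.Probability" "HOL-Real_Asymp.Real_Asymp"
begin

text \<open>
  The time evolution of one Fourier coefficient of the density obeys a scalar equation.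
  Duhamel's formula expresses the Fourier coefficient of \<open>f\<close> at velocity \<open>v\<close> through the density,
  and the Gaussian average of \<open>exp (- i (k \<bullet> v) s)\<close> is \<open>exp (- |k|\<^sup>2 s\<^sup>2 / 2)\<close>. Averaging over \<open>v\<close>
  therefore gives \<open>\<rho>\<^sub>k(t) = C r(t / \<tau>)\<close> with a constant \<open>C\<close>, where \<open>r\<close> solves the Volterra equation
  \<open>r = K + K * r\<close> with the convolution on \<open>[0, s]\<close>, \<open>K(s) = exp (- s - b\<^sup>2 s\<^sup>2 / 2)\<close> and
  \<open>b = \<tau> |k|\<close>. For fixed \<open>t > 0\<close> and \<open>\<tau> \<longrightarrow> 0\<close> the argument \<open>s = t / \<tau>\<close> tends to infinity, so
  the theorem is about the limit of \<open>r' / r\<close>, uniformly for \<open>b\<close> in bounded sets.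

  The exponential rate of \<open>r\<close> comes from a change of weight. Let \<open>y\<close> be the point at which the
  Mills ratio \<open>M(y)\<close>, the integral of \<open>exp (- y s - s\<^sup>2 / 2)\<close> over \<open>s > 0\<close>, has the value \<open>b\<close>. Then
  \<open>p(s) = exp ((1 - b y) s) K(s)\<close> is a probability density, and \<open>h(s) = exp ((1 - b y) s) r(s)\<close>
  solves the renewal equation \<open>h = p + p * h\<close>. As \<open>Z(i y) = i M(y)\<close> and \<open>Z' = - 1 - \<zeta> Z\<close>, the rate
  \<open>1 - b y\<close> is \<open>- Z'\<close> at the solution \<open>i y\<close> of \<open>Z = i b\<close>.

  The renewal equation is solved quantitatively with the tail \<open>Q\<close> of \<open>p\<close>, the integral of \<open>p\<close> from
  \<open>s\<close> to infinity. Conservation of mass reads \<open>Q + Q * h = 1\<close>; subtracting this from the renewal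
  equation gives \<open>h = 1 + D + D * h\<close> with \<open>D = p - Q\<close>. Because \<open>p\<close> is log-concave with \<open>p(0) = 1\<close>,
  its hazard rate \<open>p / Q\<close> is at least 1, so \<open>D\<close> is non-negative; and the mass of \<open>D\<close> is strictly less
  than 1 even after multiplication by \<open>exp (s / 2)\<close>, with a gap that depends only on an upper bound
  of \<open>b\<close>. Such a defective renewal equation is a contraction. It gives \<open>h \<ge> 1\<close> and
  \<open>|h'| \<le> B exp (- s / 2)\<close> (\<open>relaxation_rate\<close>), and the dissipation rate is
  \<open>(1 - b y + e) / \<tau>\<close> with \<open>|e| \<le> B exp (- t / (2 \<tau>))\<close>.

  It remains to know the size of \<open>1 - b y = b\<^sup>2 m\<close>, where \<open>m\<close> is the mean of \<open>p\<close>. The bounds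
  \<open>1 - 3 b\<^sup>2 \<le> m \<le> 1\<close> give the Chapman--Enskog scaling for fixed \<open>k\<close>: then \<open>b \<longrightarrow> 0\<close>, and the
  exponential error is negligible against \<open>b\<^sup>2\<close>. In the other regime \<open>b \<ge> sqrt (\<pi> / 2) = M(0)\<close> forces \<open>y \<le> 0\<close>, so
  the rate \<open>1 - b y\<close> is at least 1, the error is negligible against it, and the dissipation rate
  diverges like \<open>1 / \<tau>\<close>; the strict bound \<open>m \<le> 1 - 1/192\<close> separates it from \<open>\<tau> |k|\<^sup>2 = b\<^sup>2 / \<tau>\<close>.
  Finally, the real part of a plane wave whose integer wave number lies just above the critical one
  is a solution in physical space with dissipation of order \<open>1 / \<tau>\<close>.
\<close>

section \<open>Volterra convolution equations on the half-line\<close>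

definition volterra_conv :: "(real \<Rightarrow> real) \<Rightarrow> (real \<Rightarrow> real) \<Rightarrow> real \<Rightarrow> real" where
  "volterra_conv f g s = integral {0..s} (\<lambda>u. f (s - u) * g u)"

lemma volterra_conv_0 [simp]: "volterra_conv f g 0 = 0"
  by (simp add: volterra_conv_def)

lemma integrable_conv_integrand:
  fixes f g :: "real \<Rightarrow> real"
  assumes "continuous_on UNIV f" "continuous_on UNIV g"
  shows "(\<lambda>u. f (s - u) * g u) integrable_on {a..b}"
  by (intro integrable_continuous_real continuous_on_mult
      continuous_on_compose2[OF assms(1)] continuous_on_subset[OF assms(2)] continuous_intros) auto

lemma integral_reflect_0:
  fixes f :: "real \<Rightarrow> real"
  shows "integral {0..s} (\<lambda>u. f (s - u)) = integral {0..s} f"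
proof -
  have "integral {0..s} (\<lambda>u. f (s - u)) = integral {- s..- 0} (\<lambda>u. f (s + u))"
    using Henstock_Kurzweil_Integration.integral_reflect_real[of "- 0" "- s" "\<lambda>u. f (s + u)"] by simp
  also have "\<dots> = integral {0..s} f"
    using integral_shift_real_ivl[where a = 0 and c = s and b = s and f = f] by (simp add: add.commute)
  finally show ?thesis .
qed

lemma has_real_derivative_integral_upper:
  fixes g :: "real \<Rightarrow> real"
  assumes "continuous_on UNIV g" "0 \<le> s" "s \<le> S"
  shows "((\<lambda>x. integral {0..x} g) has_real_derivative g s) (at s within {0..S})"
  using integral_has_real_derivative[of 0 S g s] assms continuous_on_subset[OF assms(1)]
  by auto

lemma at_within_Icc_Ici:
  fixes s :: real assumes "0 \<le> s"
  shows "at s within {0..s+1} = at s within {0..}"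
  by (rule at_within_nhd[of _ "{..<s+1}"]) auto

text \<open>Leibniz' rule for a variable upper limit. Only \<open>f\<close> is differentiated, so a merely continuous
  solution of a Volterra equation with a smooth kernel is automatically differentiable. The proof
  moves to the fixed interval \<open>[0, s + 1]\<close>: the continuously differentiable function \<open>F\<close> replaces
  \<open>f\<close> on the negative axis by its tangent at 0, and the part of the integral beyond the upper limit
  then only involves the primitives of \<open>g\<close> and of \<open>u g(u)\<close>.\<close>

lemma volterra_conv_has_derivative:
  fixes f f' g :: "real \<Rightarrow> real"
  assumes f: "\<And>x. (f has_real_derivative f' x) (at x)" and f': "continuous_on UNIV f'"
    and g: "continuous_on UNIV g" and s: "0 \<le> s"
  shows "(volterra_conv f g has_real_derivative f 0 * g s + volterra_conv f' g s)
    (at s within {0..})"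
proof -
  define S where "S = s + 1"
  define F where "F y = (if y \<in> {0..} then f y else f 0 + f' 0 * y)" for y
  define F' where "F' y = f' (max 0 y)" for y
  define G where "G x = integral {0..x} g" for x
  define G1 where "G1 x = integral {0..x} (\<lambda>u. u * g u)" for x
  have cf: "continuous_on UNIV f"
    using f DERIV_isCont continuous_at_imp_continuous_on by blast
  have cG1: "continuous_on UNIV (\<lambda>u. u * g u)" by (intro continuous_intros g)
  have F_deriv: "(F has_real_derivative F' y) (at y)" for y
  proof -
    have lin: "((\<lambda>y. f 0 + f' 0 * y) has_real_derivative f' 0) (at y)"
      by (auto intro!: derivative_eq_intros)
    have 1: "((\<lambda>y. if y \<in> {0..} then f y else f 0 + f' 0 * y) has_vector_derivative
      (if y \<in> {0..} then f' y else f' 0)) (at y within {0..} \<union> {..<0})"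
      by (rule has_vector_derivative_If_within_closures)
         (auto simp: has_real_derivative_iff_has_vector_derivative[symmetric]
            intro: has_field_derivative_at_within[OF f] has_field_derivative_at_within[OF lin])
    have U: "{0..} \<union> {..<0} = (UNIV :: real set)" by auto
    have e: "(if y \<in> {0..} then f' y else f' 0) = F' y" by (auto simp: F'_def max_def)
    have "F = (\<lambda>y. if y \<in> {0..} then f y else f 0 + f' 0 * y)" by (auto simp: F_def)
    then show ?thesis using 1 unfolding U e has_real_derivative_iff_has_vector_derivative by simp
  qed
  have cF: "continuous_on UNIV F"
    using F_deriv DERIV_isCont continuous_at_imp_continuous_on by blast
  have cF': "continuous_on UNIV F'"
    unfolding F'_def by (intro continuous_on_compose2[OF f'] continuous_intros) auto
  have split_int: "integral {0..S} (\<lambda>u. H (x - u) * g u)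
      = integral {0..x} (\<lambda>u. H (x - u) * g u) + integral {x..S} (\<lambda>u. H (x - u) * g u)"
    if "continuous_on UNIV H" "0 \<le> x" "x \<le> S" for H x
    using Henstock_Kurzweil_Integration.integral_combine[of 0 x S "\<lambda>u. H (x - u) * g u"]
       that integrable_conv_integrand[OF that(1) g] by simp
  have tail: "integral {x..S} (\<lambda>u. c * g u) = c * (G S - G x)" if "0 \<le> x" "x \<le> S" for x c
    using Henstock_Kurzweil_Integration.integral_combine[of 0 x S g] that
      integrable_continuous_real[OF continuous_on_subset[OF g]] by (simp add: G_def)
  have tail1: "integral {x..S} (\<lambda>u. u * g u) = G1 S - G1 x" if "0 \<le> x" "x \<le> S" for x
    using Henstock_Kurzweil_Integration.integral_combine[of 0 x S "\<lambda>u. u * g u"] that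
      integrable_continuous_real[OF continuous_on_subset[OF cG1]] by (simp add: G1_def)
  have rep: "volterra_conv f g x = integral {0..S} (\<lambda>u. F (x - u) * g u)
      - (f 0 + f' 0 * x) * (G S - G x) + f' 0 * (G1 S - G1 x)" if x: "0 \<le> x" "x \<le> S" for x
  proof -
    have "integral {0..x} (\<lambda>u. F (x - u) * g u) = volterra_conv f g x"
      unfolding volterra_conv_def by (rule integral_cong) (auto simp: F_def)
    moreover have "integral {x..S} (\<lambda>u. F (x - u) * g u)
      = integral {x..S} (\<lambda>u. (f 0 + f' 0 * x) * g u - f' 0 * (u * g u))"
      by (rule integral_cong) (auto simp: F_def algebra_simps)
    moreover have "\<dots> = integral {x..S} (\<lambda>u. (f 0 + f' 0 * x) * g u) - integral {x..S} (\<lambda>u. f' 0 * (u * g u))"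
      by (rule integral_diff; intro integrable_continuous_real continuous_intros continuous_on_subset[OF g]) auto
    ultimately show ?thesis
      using split_int[OF cF x] tail[OF x] tail1[OF x] by simp
  qed
  have rep': "integral {0..S} (\<lambda>u. F' (s - u) * g u) = volterra_conv f' g s + f' 0 * (G S - G s)"
  proof -
    have "integral {0..s} (\<lambda>u. F' (s - u) * g u) = volterra_conv f' g s"
      unfolding volterra_conv_def by (rule integral_cong) (auto simp: F'_def)
    moreover have "integral {s..S} (\<lambda>u. F' (s - u) * g u) = integral {s..S} (\<lambda>u. f' 0 * g u)"
      by (rule integral_cong) (auto simp: F'_def)
    ultimately show ?thesis using split_int[OF cF', of s] tail[of s "f' 0"] s by (simp add: S_def)
  qed
  have main: "((\<lambda>x. integral {0..S} (\<lambda>u. F (x - u) * g u)) has_real_derivative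
      integral {0..S} (\<lambda>u. F' (s - u) * g u)) (at s within {0..S})"
  proof -
    have "((\<lambda>x. integral (cbox 0 S) (\<lambda>u. F (x - u) * g u)) has_vector_derivative
        integral (cbox 0 S) (\<lambda>u. F' (s - u) * g u)) (at s within {0..S})"
    proof (rule leibniz_rule_vector_derivative)
      fix x t
      show "((\<lambda>x. F (x - t) * g t) has_vector_derivative F' (x - t) * g t) (at x within {0..S})"
        unfolding has_real_derivative_iff_has_vector_derivative[symmetric]
        by (auto intro!: derivative_eq_intros DERIV_chain'[OF _ F_deriv])
    next
      show "(\<lambda>u. F (x - u) * g u) integrable_on cbox 0 S" for x
        using integrable_conv_integrand[OF cF g] by simp
      show "continuous_on ({0..S} \<times> cbox 0 S) (\<lambda>(x, t). F' (x - t) * g t)"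
        unfolding case_prod_beta
        by (intro continuous_intros continuous_on_compose2[OF cF'] continuous_on_compose2[OF g]) auto
    qed (use s in \<open>auto simp: S_def\<close>)
    then show ?thesis by (simp add: has_real_derivative_iff_has_vector_derivative)
  qed
  have dG: "(G has_real_derivative g s) (at s within {0..S})"
    unfolding G_def by (rule has_real_derivative_integral_upper[OF g s]) (simp add: S_def)
  have dG1: "(G1 has_real_derivative s * g s) (at s within {0..S})"
    unfolding G1_def by (rule has_real_derivative_integral_upper[OF cG1 s]) (simp add: S_def)
  have "((\<lambda>x. integral {0..S} (\<lambda>u. F (x - u) * g u)
      - (f 0 + f' 0 * x) * (G S - G x) + f' 0 * (G1 S - G1 x)) has_real_derivative
      f 0 * g s + volterra_conv f' g s) (at s within {0..S})"
    by (rule derivative_eq_intros main dG dG1 | simp)+ (use rep' in \<open>simp add: algebra_simps\<close>)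
  then have "(volterra_conv f g has_real_derivative f 0 * g s + volterra_conv f' g s)
      (at s within {0..S})"
    by (rule has_field_derivative_transform_within[where d = 1]) (use s rep in \<open>auto simp: S_def\<close>)
  then show ?thesis using at_within_Icc_Ici[OF s] by (simp add: S_def)
qed

text \<open>Comparison principle: at a point where \<open>x\<close> attains a negative minimum over \<open>[0, s]\<close>, the
  convolution with a kernel of mass below 1 is strictly larger than \<open>x\<close>.\<close>

lemma nonneg_of_ge_volterra_conv:
  fixes D x :: "real \<Rightarrow> real"
  assumes D: "continuous_on UNIV D" "\<And>s. 0 \<le> s \<Longrightarrow> 0 \<le> D s"
    and mass: "\<And>s. 0 \<le> s \<Longrightarrow> integral {0..s} D \<le> \<theta>" "\<theta> < 1"
    and x: "continuous_on UNIV x" "\<And>s. 0 \<le> s \<Longrightarrow> volterra_conv D x s \<le> x s" and s: "0 \<le> s"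
  shows "0 \<le> x s"
proof (rule ccontr)
  assume neg: "\<not> 0 \<le> x s"
  obtain s0 where s0: "s0 \<in> {0..s}" "\<forall>u\<in>{0..s}. x s0 \<le> x u"
    using continuous_attains_inf[of "{0..s}" x] s continuous_on_subset[OF x(1)] by auto
  have n: "x s0 < 0" using neg bspec[OF s0(2), of s] s by auto
  have "x s0 * \<theta> \<le> x s0 * integral {0..s0} D"
    using mass(1)[of s0] s0(1) n by (intro mult_left_mono_neg) auto
  also have "\<dots> = integral {0..s0} (\<lambda>u. D (s0 - u) * x s0)"
    using integral_reflect_0[of s0 D] by simp
  also have "\<dots> \<le> volterra_conv D x s0" unfolding volterra_conv_def
    by (intro integral_le integrable_conv_integrand D x mult_left_mono continuous_intros) (use s0 in auto)
  also have "\<dots> \<le> x s0" using x(2)[of s0] s0(1) by simp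
  finally have "0 \<le> x s0 * (1 - \<theta>)" by (simp add: algebra_simps)
  with n mass(2) show False by (simp add: zero_le_mult_iff)
qed

lemma volterra_conv_linear:
  assumes "continuous_on UNIV D" "continuous_on UNIV x" "continuous_on UNIV y"
  shows "volterra_conv D (\<lambda>u. a * x u + b * y u) s = a * volterra_conv D x s + b * volterra_conv D y s"
proof -
  have "volterra_conv D (\<lambda>u. a * x u + b * y u) s
      = integral {0..s} (\<lambda>u. a * (D (s - u) * x u) + b * (D (s - u) * y u))"
    unfolding volterra_conv_def by (simp add: algebra_simps)
  also have "\<dots> = integral {0..s} (\<lambda>u. a * (D (s - u) * x u)) + integral {0..s} (\<lambda>u. b * (D (s - u) * y u))"
    by (intro integral_add integrable_on_mult_right integrable_conv_integrand assms)
  finally show ?thesis by (simp add: volterra_conv_def)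
qed

lemma volterra_conv_diff_left:
  assumes "continuous_on UNIV f" "continuous_on UNIV g" "continuous_on UNIV x"
  shows "volterra_conv (\<lambda>u. f u - g u) x s = volterra_conv f x s - volterra_conv g x s"
proof -
  have "volterra_conv (\<lambda>u. f u - g u) x s
      = integral {0..s} (\<lambda>u. f (s - u) * x u - g (s - u) * x u)"
    unfolding volterra_conv_def by (simp add: algebra_simps)
  also have "\<dots> = volterra_conv f x s - volterra_conv g x s"
    unfolding volterra_conv_def by (intro integral_diff integrable_conv_integrand assms)
  finally show ?thesis .
qed

text \<open>Exponential weights are multiplicative along \<open>s = (s - u) + u\<close>, so they pass through convolutions.
  Tilting kernels in this way shifts the exponential rate of solutions.\<close>

lemma volterra_conv_exp_weight:
  "volterra_conv (\<lambda>u. exp (a * u) * f u) (\<lambda>u. exp (a * u) * g u) s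
    = exp (a * s) * volterra_conv f g s"
proof -
  have "exp (a * (s - u)) * f (s - u) * (exp (a * u) * g u) = exp (a * s) * (f (s - u) * g u)" for u
    by (simp add: algebra_simps flip: exp_add)
  then show ?thesis unfolding volterra_conv_def by (simp only: integral_mult_right)
qed

lemma volterra_conv_const: "volterra_conv D (\<lambda>_. c) s = c * integral {0..s} D"
  unfolding volterra_conv_def using integral_reflect_0[of s D] by simp

text \<open>The comparison principle applied to \<open>c / (1 - \<theta>) \<plusminus> x\<close>. With \<open>c = 0\<close> this is uniqueness.\<close>

lemma volterra_abs_bound:
  fixes D x :: "real \<Rightarrow> real"
  assumes D: "continuous_on UNIV D" "\<And>s. 0 \<le> s \<Longrightarrow> 0 \<le> D s"
    and mass: "\<And>s. 0 \<le> s \<Longrightarrow> integral {0..s} D \<le> \<theta>" "\<theta> < 1"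
    and x: "continuous_on UNIV x" "\<And>s. 0 \<le> s \<Longrightarrow> \<bar>x s - volterra_conv D x s\<bar> \<le> c" and s: "0 \<le> s"
  shows "\<bar>x s\<bar> \<le> c / (1 - \<theta>)"
proof -
  have c0: "0 \<le> c" using x(2)[of 0] by simp
  have aux: "0 \<le> c / (1 - \<theta>) * 1 + \<sigma> * x s" if \<sigma>: "\<sigma> = 1 \<or> \<sigma> = -1" for \<sigma>
  proof (rule nonneg_of_ge_volterra_conv[OF D mass, where x = "\<lambda>u. c / (1 - \<theta>) * 1 + \<sigma> * x u"])
    show "continuous_on UNIV (\<lambda>u. c / (1 - \<theta>) * 1 + \<sigma> * x u)" by (intro continuous_intros x)
    fix u :: real assume u: "0 \<le> u"
    have "volterra_conv D (\<lambda>u. c / (1 - \<theta>) * 1 + \<sigma> * x u) u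
        = c / (1 - \<theta>) * integral {0..u} D + \<sigma> * volterra_conv D x u"
      using volterra_conv_linear[OF D(1) _ x(1), of "\<lambda>_. 1" "c / (1 - \<theta>)" \<sigma> u]
      by (simp add: volterra_conv_const)
    also have "\<dots> \<le> c / (1 - \<theta>) * \<theta> + \<sigma> * volterra_conv D x u"
      using mass c0 u by (intro add_right_mono mult_left_mono) auto
    also have "\<dots> = c / (1 - \<theta>) - c + \<sigma> * volterra_conv D x u"
      using mass(2) by (simp add: field_simps)
    also have "\<dots> \<le> c / (1 - \<theta>) * 1 + \<sigma> * x u"
      using x(2)[OF u] \<sigma> by auto
    finally show "volterra_conv D (\<lambda>u. c / (1 - \<theta>) * 1 + \<sigma> * x u) u \<le> c / (1 - \<theta>) * 1 + \<sigma> * x u" .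
  qed (use s in auto)
  show ?thesis using aux[of 1] aux[of "-1"] by (simp add: abs_le_iff)
qed

lemma continuous_on_volterra_conv_max:
  fixes f f' g :: "real \<Rightarrow> real"
  assumes f: "\<And>x. (f has_real_derivative f' x) (at x)" and f': "continuous_on UNIV f'"
    and g: "continuous_on UNIV g"
  shows "continuous_on UNIV (\<lambda>s. volterra_conv f g (max 0 s))"
proof -
  have "continuous_on {0..} (volterra_conv f g)"
    using volterra_conv_has_derivative[OF f f' g]
    unfolding continuous_on_eq_continuous_within by (auto intro: DERIV_continuous)
  moreover have "continuous_on UNIV (\<lambda>s::real. max 0 s)" by (intro continuous_intros)
  ultimately show ?thesis
    using continuous_on_compose2[of "{0..}" "volterra_conv f g" UNIV "max 0"]
    by (auto simp: image_subset_iff)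
qed

text \<open>Existence by Banach's fixed point theorem on the bounded continuous functions. The functions live
  on the whole line, where the arguments of the integral operator are clamped at 0.\<close>

lemma volterra_solution_exists:
  fixes k k' :: "real \<Rightarrow> real"
  assumes k: "\<And>x. (k has_real_derivative k' x) (at x)" "continuous_on UNIV k'"
    and k0: "\<And>s. 0 \<le> s \<Longrightarrow> 0 \<le> k s" "\<And>s. 0 \<le> s \<Longrightarrow> k s \<le> B"
    and mass: "\<And>s. 0 \<le> s \<Longrightarrow> integral {0..s} k \<le> 1/2"
  shows "\<exists>x. continuous_on UNIV x \<and> (\<forall>s\<ge>0. x s = k s + volterra_conv k x s)"
proof -
  have ck: "continuous_on UNIV k"
    using k(1) DERIV_isCont continuous_at_imp_continuous_on by blast
  define \<Phi> where "\<Phi> x s = k (max 0 s) + volterra_conv k x (max 0 s)" for x s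
  have cont: "continuous_on UNIV (\<Phi> x)" if "continuous_on UNIV x" for x
  proof -
    have m: "continuous_on UNIV (\<lambda>s::real. max 0 s)" by (intro continuous_intros)
    have "continuous_on UNIV (\<lambda>s. volterra_conv k x (max 0 s))"
      by (rule continuous_on_volterra_conv_max[OF k that])
    moreover have "continuous_on UNIV (\<lambda>s. k (max 0 s))"
      using continuous_on_compose2[OF ck m] by auto
    ultimately show ?thesis unfolding \<Phi>_def by (rule continuous_on_add[rotated])
  qed
  have bd: "\<bar>volterra_conv k x s\<bar> \<le> b / 2" if "continuous_on UNIV x" "\<And>u. \<bar>x u\<bar> \<le> b" "0 \<le> s" for x s b
  proof -
    have b0: "0 \<le> b" using that(2)[of 0] by simp
    have "norm (integral {0..s} (\<lambda>u. k (s - u) * x u)) \<le> integral {0..s} (\<lambda>u. k (s - u) * b)"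
      by (rule integral_norm_bound_integral)
         (use that k0 in \<open>auto intro!: integrable_conv_integrand ck mult_left_mono simp: abs_mult\<close>)
    also have "\<dots> = b * integral {0..s} k" using volterra_conv_const[of k b s] by (simp add: volterra_conv_def)
    also have "\<dots> \<le> b * (1/2)" using mass[OF that(3)] b0 by (intro mult_left_mono) auto
    finally show ?thesis by (simp add: volterra_conv_def)
  qed
  define \<Psi> where "\<Psi> = (\<lambda>x :: real \<Rightarrow>\<^sub>C real. Bcontfun (\<Phi> (apply_bcontfun x)))"
  have app: "apply_bcontfun (\<Psi> x) = \<Phi> (apply_bcontfun x)" for x
  proof -
    have "\<Phi> (apply_bcontfun x) \<in> bcontfun"
    proof (rule bcontfun_normI[OF cont])
      fix s
      have "\<bar>volterra_conv k (apply_bcontfun x) (max 0 s)\<bar> \<le> norm x / 2"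
        using norm_bounded[of x] by (intro bd) auto
      then show "norm (\<Phi> (apply_bcontfun x) s) \<le> B + norm x / 2"
        using k0(1)[of "max 0 s"] k0(2)[of "max 0 s"] by (simp add: \<Phi>_def)
    qed auto
    then show ?thesis unfolding \<Psi>_def by (simp add: Bcontfun_inverse)
  qed
  have "dist (\<Psi> x) (\<Psi> y) \<le> 1/2 * dist x y" for x y
  proof (rule dist_bound)
    fix s
    have "\<Phi> (apply_bcontfun x) s - \<Phi> (apply_bcontfun y) s
        = volterra_conv k (\<lambda>u. 1 * apply_bcontfun x u + (-1) * apply_bcontfun y u) (max 0 s)"
      by (subst volterra_conv_linear[OF ck]) (auto simp: \<Phi>_def)
    also have "\<bar>\<dots>\<bar> \<le> dist x y / 2"
      using dist_bounded[of x _ y]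
      by (intro bd) (auto intro!: continuous_intros simp: dist_real_def)
    finally show "dist (apply_bcontfun (\<Psi> x) s) (apply_bcontfun (\<Psi> y) s) \<le> 1/2 * dist x y"
      by (simp add: app dist_real_def)
  qed
  then obtain x where "\<Psi> x = x" using banach_fix_type[of "1/2" \<Psi>] by auto
  then have "apply_bcontfun x s = \<Phi> (apply_bcontfun x) s" for s using app[of x] by simp
  then have "\<forall>s\<ge>0. apply_bcontfun x s = k s + volterra_conv k (apply_bcontfun x) s"
    by (auto simp: \<Phi>_def)
  then show ?thesis using continuous_on_apply_bcontfun by blast
qed

text \<open>Integration by parts: both sides are the derivative of the convolution of \<open>f\<close> and \<open>g\<close>, with the
  derivative falling on \<open>f\<close> on the left and on \<open>g\<close> on the right.\<close>

lemma volterra_conv_deriv_transfer: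
  fixes f f' g g' :: "real \<Rightarrow> real"
  assumes f: "\<And>x. (f has_real_derivative f' x) (at x)" and f': "continuous_on UNIV f'"
    and g: "\<And>s. 0 \<le> s \<Longrightarrow> (g has_real_derivative g' s) (at s within {0..})"
    and cg: "continuous_on UNIV g" and g': "continuous_on UNIV g'" and s: "0 \<le> s"
  shows "f 0 * g s + volterra_conv f' g s = f s * g 0 + volterra_conv f g' s"
proof -
  have cf: "continuous_on UNIV f"
    using f DERIV_isCont continuous_at_imp_continuous_on by blast
  have "((\<lambda>u. f (s - u) * g' u - f' (s - u) * g u) has_integral f (s - s) * g s - f (s - 0) * g 0) {0..s}"
  proof (rule fundamental_theorem_of_calculus[OF s])
    fix u assume u: "u \<in> {0..s}"
    have "((\<lambda>u. f (s - u) * g u) has_real_derivative f (s - u) * g' u - f' (s - u) * g u) (at u within {0..s})"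
      using u by (auto intro!: derivative_eq_intros DERIV_chain'[OF _ f] has_field_derivative_subset[OF g])
    then show "((\<lambda>u. f (s - u) * g u) has_vector_derivative f (s - u) * g' u - f' (s - u) * g u) (at u within {0..s})"
      by (simp add: has_real_derivative_iff_has_vector_derivative)
  qed
  moreover have "((\<lambda>u. f (s - u) * g' u - f' (s - u) * g u) has_integral
     volterra_conv f g' s - volterra_conv f' g s) {0..s}"
    unfolding volterra_conv_def
    by (intro has_integral_diff integrable_integral integrable_conv_integrand cf f' g' cg)
  ultimately show ?thesis by (auto dest: has_integral_unique)
qed

section \<open>The Mills ratio and the plasma dispersion function on the imaginary axis\<close>

lemma antimono_ge_limit:
  fixes f :: "real \<Rightarrow> real"
  assumes "\<And>x. a \<le> x \<Longrightarrow> (f has_real_derivative f' x) (at x)" "\<And>x. a \<le> x \<Longrightarrow> f' x \<le> 0"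
    and "(f \<longlongrightarrow> L) at_top" and "a \<le> x"
  shows "L \<le> f x"
proof (rule tendsto_upperbound[OF assms(3)])
  have "f y \<le> f x" if "x \<le> y" for y
    by (rule DERIV_nonpos_imp_nonincreasing[OF that]) (use assms(1,2,4) order_trans in blast)
  then show "\<forall>\<^sub>F y in at_top. f y \<le> f x" by (rule eventually_mono[OF eventually_ge_at_top[of x]])
qed simp

lemma strict_antimono_gt_limit:
  fixes f :: "real \<Rightarrow> real"
  assumes "\<And>x. a \<le> x \<Longrightarrow> (f has_real_derivative f' x) (at x)" "\<And>x. a \<le> x \<Longrightarrow> f' x < 0"
    and "(f \<longlongrightarrow> L) at_top" and "a \<le> x"
  shows "L < f x"
proof -
  have "f (x + 1) < f x"
    by (rule DERIV_neg_imp_decreasing[of x "x + 1" f]) (use assms(1,2,4) order_trans in \<open>simp, blast\<close>)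
  moreover have "L \<le> f (x + 1)"
    using antimono_ge_limit[OF assms(1) _ assms(3), of "x + 1"] assms(2,4) by (simp add: less_imp_le)
  ultimately show ?thesis by simp
qed

lemma cerf_has_derivative:
  "(cerf has_field_derivative 2 / complex_of_real (sqrt pi) * exp (- z\<^sup>2)) (at z)"
proof -
  have hol: "(\<lambda>z::complex. exp (- z\<^sup>2)) holomorphic_on UNIV" by (intro holomorphic_intros)
  obtain g where g: "\<And>z::complex. (g has_field_derivative exp (- z\<^sup>2)) (at z)"
  proof (rule holomorphic_convex_primitive'[OF convex_UNIV open_UNIV hol])
    fix g assume "\<And>z::complex. z \<in> UNIV \<Longrightarrow> (g has_field_derivative exp (- z\<^sup>2)) (at z)"
    then show ?thesis using that by blast
  qed
  have "contour_integral (linepath 0 z) (\<lambda>u. exp (- u\<^sup>2)) = g z - g 0" for z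
    using contour_integral_primitive[of UNIV g "\<lambda>u. exp (- u\<^sup>2)" "linepath 0 z"] g
    by (auto intro!: contour_integral_unique)
  then have eq: "cerf = (\<lambda>z. 2 / complex_of_real (sqrt pi) * (g z - g 0))"
    by (auto simp: cerf_def)
  from DERIV_cmult[OF DERIV_diff[OF g DERIV_const], of "2 / complex_of_real (sqrt pi)"]
  show ?thesis by (simp only: eq diff_0_right)
qed

lemma cerf_0 [simp]: "cerf 0 = 0"
  by (simp add: cerf_def)

lemma cerf_of_real_has_derivative:
  "((\<lambda>x. cerf (complex_of_real x)) has_vector_derivative
     complex_of_real (2 / sqrt pi * exp (- x\<^sup>2))) (at x within S)"
proof -
  have "((\<lambda>x. cerf (complex_of_real x)) has_vector_derivative
     2 / complex_of_real (sqrt pi) * exp (- (complex_of_real x)\<^sup>2)) (at x within S)"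
    by (intro has_vector_derivative_real_field cerf_has_derivative)
  also have "2 / complex_of_real (sqrt pi) * exp (- (complex_of_real x)\<^sup>2)
      = complex_of_real (2 / sqrt pi * exp (- x\<^sup>2))"
    by (simp flip: exp_of_real)
  finally show ?thesis .
qed

lemma Re_cerf_has_derivative:
  "((\<lambda>x. Re (cerf (complex_of_real x))) has_real_derivative 2 / sqrt pi * exp (- x\<^sup>2)) (at x)"
  using bounded_linear.has_vector_derivative[OF bounded_linear_Re cerf_of_real_has_derivative[of x UNIV]]
  by (simp add: has_real_derivative_iff_has_vector_derivative)

lemma cerf_of_real: "cerf (complex_of_real x) = complex_of_real (Re (cerf (complex_of_real x)))"
proof -
  have "((\<lambda>x. Im (cerf (complex_of_real x))) has_real_derivative 0) (at x)" for x
    using bounded_linear.has_vector_derivative[OF bounded_linear_Im cerf_of_real_has_derivative[of x UNIV]]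
    by (simp add: has_real_derivative_iff_has_vector_derivative)
  then have "Im (cerf (complex_of_real x)) = Im (cerf (complex_of_real 0))"
    by (intro DERIV_isconst_all) auto
  then show ?thesis by (simp add: complex_eq_iff)
qed

text \<open>The value of the Gaussian integral over the half-line, which normalises the error function.\<close>

lemma Re_cerf_tendsto_1: "((\<lambda>x. Re (cerf (complex_of_real x))) \<longlongrightarrow> 1) at_top"
proof -
  let ?f = "\<lambda>x::real. indicator {0..} x *\<^sub>R exp (- x\<^sup>2)"
  have int: "integrable lborel ?f" and val: "integral\<^sup>L lborel ?f = sqrt pi / 2"
    using gaussian_moment_0 by (auto simp: has_bochner_integral_iff)
  have lim: "((\<lambda>y. \<integral>x. indicator {..y} x *\<^sub>R ?f x \<partial>lborel) \<longlongrightarrow> sqrt pi / 2) at_top"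
    using tendsto_integral_at_top[OF sets_lborel int] unfolding val .
  have eq: "(\<integral>x. indicator {..y} x *\<^sub>R ?f x \<partial>lborel) = sqrt pi / 2 * Re (cerf (complex_of_real y))"
    if "0 \<le> y" for y
  proof -
    have "(\<integral>x. indicator {..y} x *\<^sub>R ?f x \<partial>lborel) = (\<integral>x. indicator {0..y} x *\<^sub>R exp (- x\<^sup>2) \<partial>lborel)"
      by (rule Bochner_Integration.integral_cong) (auto split: split_indicator)
    also have "\<dots> = (\<integral>x. exp (- x\<^sup>2) * indicator {0..y} x \<partial>lborel)" by (simp add: mult.commute)
    also have "\<dots> = sqrt pi / 2 * Re (cerf (complex_of_real y)) - sqrt pi / 2 * Re (cerf (complex_of_real 0))"
    proof (rule integral_FTC_Icc_real[OF that])
      show "((\<lambda>y. sqrt pi / 2 * Re (cerf (complex_of_real y))) has_real_derivative exp (- x\<^sup>2)) (at x)" for x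
        using DERIV_cmult[OF Re_cerf_has_derivative, of "sqrt pi / 2" x] by simp
    qed (auto intro!: continuous_intros)
    finally show ?thesis by simp
  qed
  have "((\<lambda>y. sqrt pi / 2 * Re (cerf (complex_of_real y))) \<longlongrightarrow> sqrt pi / 2) at_top"
    by (rule Lim_transform_eventually[OF lim]) (rule eventually_mono[OF eventually_ge_at_top[of 0] eq])
  then have "((\<lambda>y. 2 / sqrt pi * (sqrt pi / 2 * Re (cerf (complex_of_real y)))) \<longlongrightarrow> 2 / sqrt pi * (sqrt pi / 2)) at_top"
    by (intro tendsto_intros)
  then show ?thesis by simp
qed

text \<open>The integral of \<open>exp (- w\<^sup>2 / 2)\<close> over \<open>w > y\<close>, expressed through the error function in order to
  match the closed form of \<^const>\<open>plasma_Z\<close>.\<close>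

definition gauss_tail :: "real \<Rightarrow> real" where
  "gauss_tail y = sqrt (pi / 2) * (1 - Re (cerf (complex_of_real (y / sqrt 2))))"

lemma gauss_tail_has_derivative:
  "(gauss_tail has_real_derivative - exp (- y\<^sup>2 / 2)) (at y)"
proof -
  have "((\<lambda>y. sqrt (pi / 2) * (1 - Re (cerf (complex_of_real (y / sqrt 2))))) has_real_derivative
     sqrt (pi / 2) * (0 - 2 / sqrt pi * exp (- (y / sqrt 2)\<^sup>2) * (1 / sqrt 2))) (at y)"
    by (intro DERIV_cmult DERIV_diff DERIV_const DERIV_chain2[OF Re_cerf_has_derivative] DERIV_cdivide DERIV_ident)
  also have "sqrt (pi / 2) * (0 - 2 / sqrt pi * exp (- (y / sqrt 2)\<^sup>2) * (1 / sqrt 2)) = - exp (- y\<^sup>2 / 2)"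
    by (simp add: real_sqrt_divide power_divide field_simps)
  finally show ?thesis by (simp add: gauss_tail_def[abs_def])
qed

lemma gauss_tail_tendsto_0: "(gauss_tail \<longlongrightarrow> 0) at_top"
proof -
  have "filterlim (\<lambda>y::real. y / sqrt 2) at_top at_top"
    by real_asymp
  from filterlim_compose[OF Re_cerf_tendsto_1 this]
  have "((\<lambda>y. sqrt (pi / 2) * (1 - Re (cerf (complex_of_real (y / sqrt 2))))) \<longlongrightarrow> sqrt (pi / 2) * (1 - 1)) at_top"
    by (intro tendsto_intros) simp
  then show ?thesis by (simp add: gauss_tail_def[abs_def])
qed

lemma gauss_tail_pos: "0 < gauss_tail y"
  by (rule strict_antimono_gt_limit[OF gauss_tail_has_derivative _ gauss_tail_tendsto_0, of y]) auto

lemma gauss_tail_0: "gauss_tail 0 = sqrt (pi / 2)"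
  by (simp add: gauss_tail_def)

definition mills_ratio :: "real \<Rightarrow> real" where
  "mills_ratio y = exp (y\<^sup>2 / 2) * gauss_tail y"

lemma mills_ratio_has_derivative:
  "(mills_ratio has_real_derivative y * mills_ratio y - 1) (at y)"
  unfolding mills_ratio_def[abs_def]
  by (rule derivative_eq_intros gauss_tail_has_derivative refl | simp)+
     (simp add: algebra_simps power2_eq_square flip: exp_add)

lemma mills_ratio_pos: "0 < mills_ratio y"
  by (simp add: mills_ratio_def gauss_tail_pos)

text \<open>Integrating by parts, \<open>exp (- y\<^sup>2 / 2) / y\<close> exceeds the Gaussian tail for \<open>y > 0\<close>. Formally, the
  difference of the two is strictly decreasing with limit 0. Through \<open>M' = y M - 1\<close> this bound says
  that the Mills ratio decreases.\<close>

lemma mills_ratio_lt_inverse: "y * mills_ratio y < 1"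
proof (cases "0 < y")
  case True
  define g where "g x = exp (- x\<^sup>2 / 2) / x - gauss_tail x" for x
  have "(g has_real_derivative - exp (- x\<^sup>2 / 2) / x\<^sup>2) (at x)" if "y \<le> x" for x
    unfolding g_def[abs_def] using that True
    by (auto intro!: derivative_eq_intros gauss_tail_has_derivative simp: field_simps power2_eq_square)
  moreover have "- exp (- x\<^sup>2 / 2) / x\<^sup>2 < 0" if "y \<le> x" for x using that True by simp
  moreover have "(g \<longlongrightarrow> 0) at_top"
  proof -
    have "((\<lambda>x::real. exp (- x\<^sup>2 / 2) / x) \<longlongrightarrow> 0) at_top" by real_asymp
    from tendsto_diff[OF this gauss_tail_tendsto_0] show ?thesis by (simp add: g_def[abs_def])
  qed
  ultimately have "0 < g y" by (intro strict_antimono_gt_limit[where a = y and f = g]) auto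
  then have "y * gauss_tail y < exp (- y\<^sup>2 / 2)" using True by (simp add: g_def field_simps)
  then have "exp (y\<^sup>2 / 2) * (y * gauss_tail y) < exp (y\<^sup>2 / 2) * exp (- y\<^sup>2 / 2)" by simp
  also have "\<dots> = 1" by (simp flip: exp_add)
  finally show ?thesis by (simp add: mills_ratio_def mult_ac)
next
  case False
  then have "y * mills_ratio y \<le> 0" using mills_ratio_pos[of y] by (simp add: mult_nonpos_nonneg)
  then show ?thesis by simp
qed

lemma mills_ratio_strict_antimono: "x < y \<Longrightarrow> mills_ratio y < mills_ratio x"
  by (rule DERIV_neg_imp_decreasing)
     (use mills_ratio_has_derivative mills_ratio_lt_inverse in \<open>force simp: less_diff_eq\<close>)+

lemma mills_ratio_0: "mills_ratio 0 = sqrt (pi / 2)"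
  by (simp add: mills_ratio_def gauss_tail_0)

text \<open>The Mills ratio is below \<open>b\<close> at \<open>1 / b\<close> by the preceding bound, and above \<open>b\<close> at \<open>- 2 b\<close>, since the
  Gaussian tail is at least 1 on the negative axis and \<open>exp (2 b\<^sup>2) \<ge> 1 + 2 b\<^sup>2 \<ge> b\<close>.\<close>

lemma mills_ratio_surj:
  assumes "0 < b" shows "\<exists>y. mills_ratio y = b"
proof -
  have "mills_ratio (1 / b) \<le> b" using mills_ratio_lt_inverse[of "1 / b"] assms by (simp add: field_simps)
  moreover have "b \<le> mills_ratio (- 2 * b)"
  proof -
    have "gauss_tail 0 \<le> gauss_tail (- 2 * b)"
      by (rule DERIV_nonpos_imp_nonincreasing) (use assms gauss_tail_has_derivative in force)+
    moreover have "1 \<le> gauss_tail 0" using pi_ge_two by (simp add: gauss_tail_0)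
    ultimately have 1: "1 \<le> gauss_tail (- 2 * b)" by (rule order_trans[rotated])
    have "b \<le> 1 + 2 * b\<^sup>2" using zero_le_power2[of "b - 1/2"] assms
      by (simp add: power2_eq_square algebra_simps)
    also have "\<dots> \<le> exp ((- 2 * b)\<^sup>2 / 2)"
      using exp_ge_add_one_self[of "(- 2 * b)\<^sup>2 / 2"] by (simp add: power_mult_distrib)
    also have "\<dots> = exp ((- 2 * b)\<^sup>2 / 2) * 1" by simp
    also have "\<dots> \<le> mills_ratio (- 2 * b)" unfolding mills_ratio_def
      by (intro mult_left_mono 1) auto
    finally show ?thesis .
  qed
  moreover have "- 2 * b \<le> 1 / b" using assms by (smt (verit) zero_less_divide_1_iff)
  moreover have "\<And>x. isCont mills_ratio x" using mills_ratio_has_derivative DERIV_isCont by blast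
  ultimately show ?thesis using IVT2[of mills_ratio "1 / b" b "- 2 * b"] by blast
qed

lemma plasma_Z_imaginary: "plasma_Z (\<i> * complex_of_real y) = \<i> * complex_of_real (mills_ratio y)"
proof -
  have a: "- \<i> * (\<i> * complex_of_real y) / complex_of_real (sqrt 2) = complex_of_real (y / sqrt 2)"
    by simp
  have "- (\<i> * complex_of_real y)\<^sup>2 / 2 = complex_of_real (y\<^sup>2 / 2)" by (simp add: power_mult_distrib)
  then have b: "exp (- (\<i> * complex_of_real y)\<^sup>2 / 2) = complex_of_real (exp (y\<^sup>2 / 2))"
    by (simp only: exp_of_real)
  show ?thesis unfolding plasma_Z_def a b
    by (subst cerf_of_real) (simp add: mills_ratio_def gauss_tail_def mult_ac)
qed

lemma deriv_plasma_Z: "deriv plasma_Z z = - 1 - z * plasma_Z z"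
proof -
  define c where "c = \<i> * complex_of_real (sqrt (pi / 2))"
  define d where "d = complex_of_real (sqrt 2)"
  define E where "E = complex_of_real (sqrt pi)"
  have d: "d\<^sup>2 = 2" "d \<noteq> 0" and E: "E \<noteq> 0" by (simp_all add: d_def E_def flip: of_real_power)
  have c: "c = \<i> * E / d" by (simp add: c_def E_def d_def real_sqrt_divide)
  have Z: "plasma_Z = (\<lambda>z. c * exp (- z\<^sup>2 / 2) * (1 - cerf (- \<i> * z / d)))"
    by (simp add: plasma_Z_def[abs_def] c_def d_def)
  have "((\<lambda>z. c * exp (- z\<^sup>2 / 2) * (1 - cerf (- \<i> * z / d))) has_field_derivative
     c * exp (- z\<^sup>2 / 2) * (0 - 2 / E * exp (- (- \<i> * z / d)\<^sup>2) * (- \<i> / d))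
      + c * (exp (- z\<^sup>2 / 2) * (- z)) * (1 - cerf (- \<i> * z / d))) (at z)"
  proof -
    have "((\<lambda>z. - \<i> * z / d) has_field_derivative - \<i> / d) (at z)"
      by (auto intro!: derivative_eq_intros simp: d)
    from DERIV_diff[OF DERIV_const DERIV_chain2[OF cerf_has_derivative this]]
    have 1: "((\<lambda>z. 1 - cerf (- \<i> * z / d)) has_field_derivative
        0 - 2 / E * exp (- (- \<i> * z / d)\<^sup>2) * (- \<i> / d)) (at z)"
      by (simp add: E_def)
    have 2: "((\<lambda>z. c * exp (- z\<^sup>2 / 2)) has_field_derivative c * (exp (- z\<^sup>2 / 2) * (- z))) (at z)"
      by (auto intro!: derivative_eq_intros)
    show ?thesis using DERIV_mult[OF 2 1] by (simp add: add.commute mult_ac)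
  qed
  also have "- (- \<i> * z / d)\<^sup>2 = z\<^sup>2 / 2" by (simp add: power_mult_distrib power_divide d)
  also have "c * exp (- z\<^sup>2 / 2) * (0 - 2 / E * exp (z\<^sup>2 / 2) * (- \<i> / d))
     = (c * 2 * \<i> / (E * d)) * (exp (- z\<^sup>2 / 2) * exp (z\<^sup>2 / 2))" by simp
  also have "exp (- z\<^sup>2 / 2) * exp (z\<^sup>2 / 2) = 1" by (simp flip: exp_add)
  also have "c * 2 * \<i> / (E * d) = - 1" using d E by (simp add: c field_simps power2_eq_square)
  finally have "(plasma_Z has_field_derivative - 1 - z * plasma_Z z) (at z)"
    unfolding Z by (simp add: mult_ac)
  then show ?thesis by (rule DERIV_imp_deriv)
qed

lemma zeta_hat_eq:
  assumes "mills_ratio y = b" shows "zeta_hat b = \<i> * complex_of_real y"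
  unfolding zeta_hat_def
proof (rule the_equality)
  show "Re (\<i> * complex_of_real y) = 0 \<and> plasma_Z (\<i> * complex_of_real y) = \<i> * complex_of_real b"
    using assms by (simp add: plasma_Z_imaginary)
next
  fix z assume z: "Re z = 0 \<and> plasma_Z z = \<i> * complex_of_real b"
  then have "z = \<i> * complex_of_real (Im z)" by (simp add: complex_eq_iff)
  with z have "mills_ratio (Im z) = b" using plasma_Z_imaginary[of "Im z"] by simp
  with assms have "Im z = y" using mills_ratio_strict_antimono[of y "Im z"] mills_ratio_strict_antimono[of "Im z" y]
    by (metis linorder_neqE_linordered_idom order_less_irrefl)
  with \<open>z = _\<close> show "z = \<i> * complex_of_real y" by simp
qed

lemma deriv_plasma_Z_zeta_hat:
  assumes "mills_ratio y = b" shows "- deriv plasma_Z (zeta_hat b) = complex_of_real (1 - b * y)"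
  using assms by (simp add: zeta_hat_eq[OF assms] deriv_plasma_Z plasma_Z_imaginary algebra_simps)

section \<open>The renewal equation of the macroscopic density\<close>

text \<open>The density left at rescaled time \<open>s\<close> by particles that have not yet collided: \<open>exp (- s)\<close> is the
  probability of no collision, and the Gaussian factor is due to phase mixing by free transport.\<close>

definition relaxation_kernel :: "real \<Rightarrow> real \<Rightarrow> real" where
  "relaxation_kernel b s = exp (- s - b\<^sup>2 * s\<^sup>2 / 2)"

lemma relaxation_kernel_0 [simp]: "relaxation_kernel b 0 = 1"
  by (simp add: relaxation_kernel_def)

lemma continuous_on_relaxation_kernel [continuous_intros]:
  "continuous_on S f \<Longrightarrow> continuous_on S (\<lambda>s. relaxation_kernel b (f s))"
  unfolding relaxation_kernel_def by (intro continuous_intros) auto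

text \<open>For \<open>b = 0\<close> the relaxation kernel has mass 1. The additional weight brings the mass down to at
  most 1/2 for every \<open>b\<close>, so that the existence and uniqueness results for Volterra equations apply.\<close>

definition damped_kernel :: "real \<Rightarrow> real \<Rightarrow> real" where
  "damped_kernel b s = exp (- 1 * s) * relaxation_kernel b s"

lemma damped_kernel_pos: "0 < damped_kernel b s"
  by (simp add: damped_kernel_def relaxation_kernel_def)

lemma damped_kernel_le: "damped_kernel b s \<le> exp (- 2 * s)"
  by (simp add: damped_kernel_def relaxation_kernel_def flip: exp_add)

lemma damped_kernel_has_derivative:
  "(damped_kernel b has_real_derivative (- 2 - b\<^sup>2 * s) * damped_kernel b s) (at s)"
  unfolding damped_kernel_def[abs_def] relaxation_kernel_def
  by (auto intro!: derivative_eq_intros simp: field_simps)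

lemma continuous_on_damped_kernel [continuous_intros]:
  "continuous_on S f \<Longrightarrow> continuous_on S (\<lambda>s. damped_kernel b (f s))"
  unfolding damped_kernel_def by (intro continuous_intros)

lemma integral_damped_kernel:
  assumes "0 \<le> s" shows "integral {0..s} (damped_kernel b) \<le> 1/2"
proof -
  have i: "((\<lambda>u. exp (- 2 * u)) has_integral (- exp (- 2 * s) / 2 - (- exp (- 2 * 0) / 2))) {0..s}"
    by (rule fundamental_theorem_of_calculus[OF assms])
       (auto intro!: derivative_eq_intros simp flip: has_real_derivative_iff_has_vector_derivative)
  have "integral {0..s} (damped_kernel b) \<le> integral {0..s} (\<lambda>u. exp (- 2 * u))"
    using damped_kernel_le
    by (intro integral_le integrable_continuous_real continuous_intros) auto
  also have "\<dots> \<le> 1/2" using integral_unique[OF i] by simp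
  finally show ?thesis .
qed

lemma relaxation_solution_exists:
  "\<exists>r. continuous_on UNIV r \<and>
     (\<forall>s\<ge>0. r s = relaxation_kernel b s + volterra_conv (relaxation_kernel b) r s)"
proof -
  have "\<exists>x. continuous_on UNIV x \<and> (\<forall>s\<ge>0. x s = damped_kernel b s + volterra_conv (damped_kernel b) x s)"
  proof (rule volterra_solution_exists[OF damped_kernel_has_derivative])
    show "continuous_on UNIV (\<lambda>s. (- 2 - b\<^sup>2 * s) * damped_kernel b s)" by (intro continuous_intros)
    show "damped_kernel b s \<le> 1" if "0 \<le> s" for s
      using order_trans[OF damped_kernel_le[of b s], of 1] that by simp
  qed (rule less_imp_le[OF damped_kernel_pos] integral_damped_kernel | assumption)+
  then obtain x where x: "continuous_on UNIV x"
    and eq: "\<And>s. 0 \<le> s \<Longrightarrow> x s = damped_kernel b s + volterra_conv (damped_kernel b) x s" by blast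
  have "exp s * x s = relaxation_kernel b s + volterra_conv (relaxation_kernel b) (\<lambda>s. exp s * x s) s"
    if "0 \<le> s" for s
  proof -
    have k: "relaxation_kernel b = (\<lambda>u. exp (1 * u) * damped_kernel b u)"
      by (simp add: damped_kernel_def fun_eq_iff flip: exp_add)
    have "volterra_conv (relaxation_kernel b) (\<lambda>s. exp s * x s) s
        = exp (1 * s) * volterra_conv (damped_kernel b) x s"
      unfolding k using volterra_conv_exp_weight[of 1 "damped_kernel b" x s] by simp
    then show ?thesis using eq[OF that] by (simp add: k algebra_simps)
  qed
  then show ?thesis by (intro exI[of _ "\<lambda>s. exp s * x s"]) (auto intro!: continuous_intros x)
qed

lemma relaxation_homogeneous_zero:
  assumes u: "continuous_on UNIV u" "\<And>s. 0 \<le> s \<Longrightarrow> u s = volterra_conv (relaxation_kernel b) u s"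
    and s: "0 \<le> s"
  shows "u s = 0"
proof -
  have "\<bar>exp (- 1 * s) * u s\<bar> \<le> 0 / (1 - 1/2)"
  proof (rule volterra_abs_bound[where D = "damped_kernel b" and x = "\<lambda>s. exp (- 1 * s) * u s"])
    fix s :: real assume "0 \<le> s"
    have "volterra_conv (damped_kernel b) (\<lambda>s. exp (- 1 * s) * u s) s
       = exp (- 1 * s) * volterra_conv (relaxation_kernel b) u s"
      unfolding damped_kernel_def[abs_def] by (rule volterra_conv_exp_weight)
    then show "\<bar>exp (- 1 * s) * u s - volterra_conv (damped_kernel b) (\<lambda>s. exp (- 1 * s) * u s) s\<bar> \<le> 0"
      using u(2)[OF \<open>0 \<le> s\<close>] by simp
  qed (rule less_imp_le[OF damped_kernel_pos] integral_damped_kernel continuous_intros u s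
        | assumption | simp)+
  then show ?thesis by simp
qed

text \<open>The tilted quantities of the renewal argument. The density \<open>p\<close> is \<open>exp ((1 - b y) s)\<close> times the
  relaxation kernel; \<open>Q\<close> is its tail in closed form, so that \<open>M(y) = b\<close> becomes the normalisation
  \<open>Q 0 = 1\<close>; and \<open>D\<close> is the kernel of the defective renewal equation. The number \<open>m\<close> is the mean of
  \<open>p\<close>: integrating \<open>p' = - (b y + b\<^sup>2 s) p\<close> over the half-line gives \<open>- 1 = - (b y + b\<^sup>2 m)\<close>.\<close>

locale diffusion_mode =
  fixes b y :: real
  assumes b: "0 < b" and y: "mills_ratio y = b"
begin

definition m :: real where "m = (1 - b * y) / b\<^sup>2"

definition p :: "real \<Rightarrow> real" where "p s = exp (- b * y * s - b\<^sup>2 * s\<^sup>2 / 2)"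

definition Q :: "real \<Rightarrow> real" where "Q s = exp (y\<^sup>2 / 2) * gauss_tail (b * s + y) / b"

definition D :: "real \<Rightarrow> real" where "D s = p s - Q s"

lemma b2m: "b\<^sup>2 * m = 1 - b * y"
  using b by (simp add: m_def)

lemma m_pos: "0 < m"
  using mills_ratio_lt_inverse[of y] b by (simp add: m_def y mult.commute)

lemma p_pos: "0 < p s"
  by (simp add: p_def)

lemma p_0 [simp]: "p 0 = 1"
  by (simp add: p_def)

text \<open>The density \<open>p\<close> relative to the exponential distribution. All estimates of \<open>p\<close> and \<open>m\<close> start from
  this form.\<close>

lemma p_eq: "p s = exp (- s) * exp (b\<^sup>2 * (m * s - s\<^sup>2 / 2))"
proof -
  have "b\<^sup>2 * (m * s - s\<^sup>2 / 2) = (b\<^sup>2 * m) * s - b\<^sup>2 * s\<^sup>2 / 2" by (simp add: algebra_simps)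
  moreover have "(b\<^sup>2 * m) * s = s - b * y * s" unfolding b2m by (simp add: algebra_simps)
  ultimately show ?thesis by (simp add: p_def flip: exp_add)
qed

lemma p_has_derivative: "(p has_real_derivative - (b * y + b\<^sup>2 * s) * p s) (at s)"
  unfolding p_def[abs_def] by (auto intro!: derivative_eq_intros simp: field_simps)

lemma continuous_on_p [continuous_intros]: "continuous_on S f \<Longrightarrow> continuous_on S (\<lambda>s. p (f s))"
  unfolding p_def by (intro continuous_intros) auto

lemma Q_has_derivative: "(Q has_real_derivative - p s) (at s)"
proof -
  have lin: "((\<lambda>s. b * s + y) has_real_derivative b) (at s)" by (auto intro!: derivative_eq_intros)
  have "((\<lambda>s. exp (y\<^sup>2 / 2) * gauss_tail (b * s + y) / b) has_real_derivative
      exp (y\<^sup>2 / 2) * (- exp (- (b * s + y)\<^sup>2 / 2) * b) / b) (at s)"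
    by (intro DERIV_cdivide DERIV_cmult DERIV_chain2[OF gauss_tail_has_derivative lin])
  also have "exp (y\<^sup>2 / 2) * (- exp (- (b * s + y)\<^sup>2 / 2) * b) / b = - p s"
    using b by (simp add: p_def power2_eq_square field_simps flip: exp_add)
  finally show ?thesis by (simp add: Q_def[abs_def])
qed

lemma Q_0 [simp]: "Q 0 = 1"
  using y b by (simp add: Q_def mills_ratio_def)

lemma Q_pos: "0 < Q s"
  using b by (simp add: Q_def gauss_tail_pos)

lemma continuous_on_Q [continuous_intros]: "continuous_on S f \<Longrightarrow> continuous_on S (\<lambda>s. Q (f s))"
proof -
  have "continuous_on UNIV Q" using Q_has_derivative DERIV_isCont continuous_at_imp_continuous_on by blast
  then show "continuous_on S f \<Longrightarrow> continuous_on S (\<lambda>s. Q (f s))"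
    by (rule continuous_on_compose2) auto
qed

lemma Q_tendsto_0: "(Q \<longlongrightarrow> 0) at_top"
proof -
  have "filterlim (\<lambda>s. b * s + y) at_top at_top" using b by real_asymp
  from filterlim_compose[OF gauss_tail_tendsto_0 this]
  have "((\<lambda>s. exp (y\<^sup>2 / 2) * gauss_tail (b * s + y) / b) \<longlongrightarrow> exp (y\<^sup>2 / 2) * 0 / b) at_top"
    using b by (intro tendsto_intros) auto
  then show ?thesis by (simp add: Q_def[abs_def])
qed

lemma p_le: "p s \<le> exp (b\<^sup>2 * m\<^sup>2 / 2) * exp (- s)"
proof -
  have "m * s - s\<^sup>2 / 2 \<le> m\<^sup>2 / 2" using zero_le_power2[of "m - s"]
    by (simp add: power2_eq_square algebra_simps)
  then have "b\<^sup>2 * (m * s - s\<^sup>2 / 2) \<le> b\<^sup>2 * m\<^sup>2 / 2"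
    using mult_left_mono[of "m * s - s\<^sup>2 / 2" "m\<^sup>2 / 2" "b\<^sup>2"] by simp
  then show ?thesis by (simp add: p_eq)
qed

lemma p_tendsto_0: "(p \<longlongrightarrow> 0) at_top"
proof (rule tendsto_sandwich[OF always_eventually always_eventually tendsto_const])
  have "((\<lambda>s::real. exp (- s)) \<longlongrightarrow> 0) at_top" by real_asymp
  then show "((\<lambda>s. exp (b\<^sup>2 * m\<^sup>2 / 2) * exp (- s)) \<longlongrightarrow> 0) at_top"
    by (rule tendsto_mult_right_zero)
qed (auto simp: p_le less_imp_le[OF p_pos])

lemma D_has_derivative: "(D has_real_derivative b\<^sup>2 * (m - s) * p s) (at s)"
proof -
  have "(D has_real_derivative - (b * y + b\<^sup>2 * s) * p s - - p s) (at s)"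
    unfolding D_def[abs_def] by (intro DERIV_diff p_has_derivative Q_has_derivative)
  also have "- (b * y + b\<^sup>2 * s) * p s - - p s = b\<^sup>2 * (m - s) * p s"
    using arg_cong[OF b2m, of "\<lambda>c. c * p s"] by (simp add: algebra_simps)
  finally show ?thesis .
qed

lemma D_0 [simp]: "D 0 = 0"
  by (simp add: D_def)

lemma continuous_on_D [continuous_intros]: "continuous_on S f \<Longrightarrow> continuous_on S (\<lambda>s. D (f s))"
  unfolding D_def by (intro continuous_intros)

text \<open>\<open>D\<close> starts at 0, increases up to \<open>m\<close>, and decreases to the limit 0 afterwards.\<close>

lemma D_nonneg:
  assumes "0 \<le> s" shows "0 \<le> D s"
proof (cases "s \<le> m")
  case True
  have "D 0 \<le> D s"
  proof (rule DERIV_nonneg_imp_nondecreasing[OF assms])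
    fix x assume "0 \<le> x" "x \<le> s"
    then show "\<exists>d. (D has_real_derivative d) (at x) \<and> 0 \<le> d"
      using True p_pos[of x]
      by (intro exI[of _ "b\<^sup>2 * (m - x) * p x"] conjI D_has_derivative mult_nonneg_nonneg) auto
  qed
  then show ?thesis by simp
next
  case False
  have lim: "(D \<longlongrightarrow> 0) at_top"
    using tendsto_diff[OF p_tendsto_0 Q_tendsto_0] by (simp add: D_def[abs_def])
  show ?thesis
  proof (rule antimono_ge_limit[OF D_has_derivative _ lim, of m s])
    fix x assume "m \<le> x"
    then show "b\<^sup>2 * (m - x) * p x \<le> 0"
      using p_pos[of x] by (intro mult_nonpos_nonneg mult_nonneg_nonpos) auto
  qed (use False in simp)
qed

text \<open>Up to a constant, \<open>W\<close> is the integral from 0 to \<open>s\<close> of \<open>exp (- u) (exp x - 1 - x)\<close> with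
  \<open>x = b\<^sup>2 (m u - u\<^sup>2 / 2)\<close>. Since \<open>p\<close> has mass 1 and \<open>x\<close> has mean \<open>b\<^sup>2 (m - 1)\<close> under the exponential
  distribution, its total increase is \<open>b\<^sup>2 (1 - m)\<close>. Convexity of the exponential function thus
  gives \<open>m \<le> 1\<close>, and any strictly positive lower bound of the integrand gives a gap.\<close>

definition W :: "real \<Rightarrow> real" where
  "W s = - Q s + exp (- s) * (1 + b\<^sup>2 * m * (s + 1) - b\<^sup>2 * (s\<^sup>2 / 2 + s + 1))"

lemma W_has_derivative:
  "(W has_real_derivative exp (- s) * (exp (b\<^sup>2 * (m * s - s\<^sup>2 / 2)) - 1 - b\<^sup>2 * (m * s - s\<^sup>2 / 2))) (at s)"
proof -
  have "((\<lambda>s. exp (- s) * (1 + b\<^sup>2 * m * (s + 1) - b\<^sup>2 * (s\<^sup>2 / 2 + s + 1))) has_real_derivative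
     - exp (- s) * (1 + b\<^sup>2 * (m * s - s\<^sup>2 / 2))) (at s)"
    by (auto intro!: derivative_eq_intros simp: field_simps power2_eq_square)
  from DERIV_add[OF DERIV_minus[OF Q_has_derivative] this] show ?thesis
    unfolding W_def[abs_def] by (simp add: p_eq algebra_simps)
qed

lemma W_mono:
  assumes "s \<le> t" shows "W s \<le> W t"
proof (rule DERIV_nonneg_imp_nondecreasing[OF assms])
  fix u
  have "0 \<le> exp (- u) * (exp (b\<^sup>2 * (m * u - u\<^sup>2 / 2)) - 1 - b\<^sup>2 * (m * u - u\<^sup>2 / 2))"
  proof (rule mult_nonneg_nonneg)
    show "0 \<le> exp x - 1 - x" for x :: real using exp_ge_add_one_self[of x] by linarith
  qed simp
  then show "\<exists>d. (W has_real_derivative d) (at u) \<and> 0 \<le> d"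
    using W_has_derivative[of u] by blast
qed

lemma exp_poly_tendsto_0:
  "((\<lambda>s::real. exp (- s) * (c0 + c1 * s + c2 * s\<^sup>2 + c3 * s ^ 3)) \<longlongrightarrow> 0) at_top"
proof -
  have "((\<lambda>s::real. exp (- s)) \<longlongrightarrow> 0) at_top" "((\<lambda>s::real. s * exp (- s)) \<longlongrightarrow> 0) at_top"
    "((\<lambda>s::real. s\<^sup>2 * exp (- s)) \<longlongrightarrow> 0) at_top" "((\<lambda>s::real. s ^ 3 * exp (- s)) \<longlongrightarrow> 0) at_top"
    by real_asymp+
  then have "((\<lambda>s::real. c0 * exp (- s) + c1 * (s * exp (- s)) + c2 * (s\<^sup>2 * exp (- s))
      + c3 * (s ^ 3 * exp (- s))) \<longlongrightarrow> c0 * 0 + c1 * 0 + c2 * 0 + c3 * 0) at_top"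
    by (intro tendsto_intros)
  then show ?thesis by (simp add: algebra_simps)
qed

lemma W_nonpos: "W s \<le> 0"
proof (rule tendsto_lowerbound)
  have "((\<lambda>s. - Q s + exp (- s) * ((1 + b\<^sup>2 * m - b\<^sup>2) + (b\<^sup>2 * m - b\<^sup>2) * s + (- b\<^sup>2 / 2) * s\<^sup>2 + 0 * s ^ 3))
      \<longlongrightarrow> - 0 + 0) at_top"
    by (intro tendsto_add tendsto_minus Q_tendsto_0 exp_poly_tendsto_0)
  then show "(W \<longlongrightarrow> 0) at_top" by (simp add: W_def[abs_def] algebra_simps)
  show "\<forall>\<^sub>F t in at_top. W s \<le> W t"
    by (rule eventually_mono[OF eventually_ge_at_top[of s] W_mono])
qed simp

lemma W_0: "W 0 = - b\<^sup>2 * (1 - m)"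
  by (simp add: W_def algebra_simps)

lemma m_le_1: "m \<le> 1"
  using W_nonpos[of 0] b by (simp add: W_0 zero_le_mult_iff)

text \<open>If \<open>m \<ge> 3/4\<close>, then \<open>x \<ge> b\<^sup>2 / 4\<close> on \<open>[1/2, 1]\<close>, where the integrand behind \<open>W\<close> is therefore at
  least \<open>exp (- 1) x\<^sup>2 / 2 \<ge> b\<^sup>4 / 96\<close>.\<close>

lemma m_gap:
  assumes "1 \<le> b\<^sup>2" shows "m \<le> 1 - 1/192"
proof (cases "3/4 \<le> m")
  case True
  have "\<exists>z>1/2. z < 1 \<and> W 1 - W (1/2) = (1 - 1/2) *
      (exp (- z) * (exp (b\<^sup>2 * (m * z - z\<^sup>2 / 2)) - 1 - b\<^sup>2 * (m * z - z\<^sup>2 / 2)))"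
    by (rule MVT2) (use W_has_derivative in auto)
  then obtain z where z: "1/2 < z" "z < 1" and W: "W 1 - W (1/2) = 1/2 *
      (exp (- z) * (exp (b\<^sup>2 * (m * z - z\<^sup>2 / 2)) - 1 - b\<^sup>2 * (m * z - z\<^sup>2 / 2)))" by auto
  define x where "x = b\<^sup>2 * (m * z - z\<^sup>2 / 2)"
  have "3/4 * z \<le> m * z" using True z by (intro mult_right_mono) auto
  moreover have "0 \<le> (z - 1/2) * (1 - z)" using z by simp
  moreover have "(z - 1/2) * (1 - z) = 3/2 * z - z\<^sup>2 - 1/2"
    by (simp add: power2_eq_square field_simps)
  ultimately have "1/4 \<le> m * z - z\<^sup>2 / 2" by linarith
  then have "b\<^sup>2 * (1/4) \<le> x" unfolding x_def by (intro mult_left_mono) auto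
  then have x0: "b\<^sup>2 / 4 \<le> x" by simp
  then have "(b\<^sup>2 / 4)\<^sup>2 \<le> x\<^sup>2" by (intro power_mono) auto
  then have "(b\<^sup>2)\<^sup>2 / 32 \<le> x\<^sup>2 / 2" by (simp add: power_divide)
  moreover have "0 \<le> x" using x0 by (smt (verit) zero_le_power2 divide_nonneg_nonneg)
  ultimately have e: "(b\<^sup>2)\<^sup>2 / 32 \<le> exp x - 1 - x" using exp_lower_Taylor_quadratic[of x] by simp
  have "exp z \<le> 3" using exp_le z exp_le_cancel_iff[of z 1] by linarith
  then have "1/3 \<le> exp (- z)" by (simp add: exp_minus field_simps)
  then have "1/3 * ((b\<^sup>2)\<^sup>2 / 32) \<le> exp (- z) * (exp x - 1 - x)"
    by (intro mult_mono e) auto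
  then have "(b\<^sup>2)\<^sup>2 / 192 \<le> W 1 - W (1/2)" unfolding W x_def by simp
  also have "\<dots> \<le> - W 0" using W_nonpos[of 1] W_mono[of 0 "1/2"] by simp
  finally have "b\<^sup>2 * (b\<^sup>2 / 192) \<le> b\<^sup>2 * (1 - m)" by (simp add: W_0 power2_eq_square[of "b\<^sup>2"])
  then have "b\<^sup>2 / 192 \<le> 1 - m" using b by (simp only: mult_le_cancel_left_pos zero_less_power)
  then show ?thesis using assms by simp
qed auto

text \<open>Up to a constant, \<open>U\<close> is the integral from 0 to \<open>s\<close> of \<open>u (p(u) - exp (- u) (1 - b\<^sup>2 u\<^sup>2 / 2))\<close>. The
  two terms integrate to \<open>m\<close> and to \<open>1 - 3 b\<^sup>2\<close> over the half-line.\<close>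

definition U :: "real \<Rightarrow> real" where
  "U s = - (p s - b * y * Q s) / b\<^sup>2 + exp (- s) * ((s + 1) - b\<^sup>2 / 2 * (s ^ 3 + 3 * s\<^sup>2 + 6 * s + 6))"

lemma U_has_derivative:
  "(U has_real_derivative s * p s - s * exp (- s) * (1 - b\<^sup>2 * s\<^sup>2 / 2)) (at s)"
proof -
  have 1: "((\<lambda>s. exp (- s) * ((s + 1) - b\<^sup>2 / 2 * (s ^ 3 + 3 * s\<^sup>2 + 6 * s + 6))) has_real_derivative
     - s * exp (- s) * (1 - b\<^sup>2 * s\<^sup>2 / 2)) (at s)"
    by (auto intro!: derivative_eq_intros simp: field_simps power2_eq_square power3_eq_cube)
  have "((\<lambda>s. - (p s - b * y * Q s) / b\<^sup>2) has_real_derivative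
     - (- (b * y + b\<^sup>2 * s) * p s - b * y * (- p s)) / b\<^sup>2) (at s)"
    by (intro DERIV_cdivide DERIV_minus DERIV_diff DERIV_cmult p_has_derivative Q_has_derivative)
  also have "- (- (b * y + b\<^sup>2 * s) * p s - b * y * (- p s)) / b\<^sup>2 = s * p s"
    using b by (simp add: field_simps)
  finally show ?thesis using DERIV_add[OF _ 1] unfolding U_def[abs_def] by fastforce
qed

lemma m_ge: "1 - 3 * b\<^sup>2 \<le> m"
proof -
  have nonneg: "0 \<le> s * p s - s * exp (- s) * (1 - b\<^sup>2 * s\<^sup>2 / 2)" if "0 \<le> s" for s
  proof -
    have "1 + (- (b\<^sup>2 * s\<^sup>2 / 2)) \<le> exp (- (b\<^sup>2 * s\<^sup>2 / 2))" by (rule exp_ge_add_one_self)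
    also have "\<dots> \<le> exp (b\<^sup>2 * (m * s - s\<^sup>2 / 2))"
      using that m_pos by (simp add: algebra_simps)
    finally have "exp (- s) * (1 - b\<^sup>2 * s\<^sup>2 / 2) \<le> p s" by (simp add: p_eq)
    then have "s * (exp (- s) * (1 - b\<^sup>2 * s\<^sup>2 / 2)) \<le> s * p s" using that by (intro mult_left_mono)
    then show ?thesis by (simp add: mult.assoc)
  qed
  have "U 0 \<le> 0"
  proof (rule tendsto_lowerbound)
    have "((\<lambda>s. - (p s - b * y * Q s) / b\<^sup>2 + exp (- s) *
        ((1 - 3 * b\<^sup>2) + (1 - 3 * b\<^sup>2) * s + (- 3 * b\<^sup>2 / 2) * s\<^sup>2 + (- b\<^sup>2 / 2) * s ^ 3))
       \<longlongrightarrow> - (0 - b * y * 0) / b\<^sup>2 + 0) at_top"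
      using b by (intro tendsto_add tendsto_divide tendsto_minus tendsto_diff tendsto_mult tendsto_const
         p_tendsto_0 Q_tendsto_0 exp_poly_tendsto_0) auto
    then show "(U \<longlongrightarrow> 0) at_top" by (simp add: U_def[abs_def] algebra_simps)
    have "U 0 \<le> U t" if "0 \<le> t" for t
      by (rule DERIV_nonneg_imp_nondecreasing[OF that]) (use U_has_derivative nonneg in blast)
    then show "\<forall>\<^sub>F t in at_top. U 0 \<le> U t"
      by (rule eventually_mono[OF eventually_ge_at_top[of 0]])
  qed simp
  moreover have "U 0 = - m + (1 - 3 * b\<^sup>2)" by (simp add: U_def m_def diff_divide_distrib)
  ultimately show ?thesis by simp
qed

text \<open>A lower bound for \<open>Q 1\<close> is what keeps the mass of \<open>D\<close> away from 1.\<close>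

lemma Q_1_ge: "exp (- 2 - 2 * b\<^sup>2) \<le> Q 1"
proof -
  have "\<exists>z>1. z < 2 \<and> Q 2 - Q 1 = (2 - 1) * (- p z)"
    by (rule MVT2) (use Q_has_derivative in auto)
  then obtain z where z: "1 < z" "z < 2" "Q 2 - Q 1 = - p z" by auto
  have "z\<^sup>2 \<le> 2\<^sup>2" using z by (intro power_mono) auto
  then have "b\<^sup>2 * z\<^sup>2 \<le> b\<^sup>2 * 4" by (intro mult_left_mono) auto
  moreover have "0 \<le> b\<^sup>2 * (m * z)" using z m_pos by (intro mult_nonneg_nonneg) auto
  ultimately have "- 2 - 2 * b\<^sup>2 \<le> - z + b\<^sup>2 * (m * z - z\<^sup>2 / 2)"
    using z(2) unfolding right_diff_distrib times_divide_eq_right by linarith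
  then have "exp (- 2 - 2 * b\<^sup>2) \<le> p z" by (simp add: p_eq flip: exp_add)
  also have "\<dots> \<le> Q 1" using z(3) Q_pos[of 2] by simp
  finally show ?thesis .
qed

text \<open>As \<open>D = - Q' - Q\<close>, the weighted function \<open>exp (s / 2) D\<close> is the derivative of \<open>- exp (s / 2) Q\<close>
  minus half of \<open>exp (s / 2) Q\<close>. The first part contributes at most 1, and the second at
  least \<open>Q 1 / 2\<close> as soon as the interval contains \<open>[0, 1]\<close>. Any weight
  \<open>exp (c s)\<close> with \<open>0 < c < 1\<close> leaves a gap in this way, and \<open>c = 1\<close> does not.\<close>

lemma weighted_mass:
  assumes "0 \<le> S"
  shows "integral {0..S} (\<lambda>s. exp (1/2 * s) * D s) \<le> 1 - exp (- 2 - 2 * b\<^sup>2) / 2"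
proof -
  have long: "integral {0..S} (\<lambda>s. exp (1/2 * s) * D s) \<le> 1 - exp (- 2 - 2 * b\<^sup>2) / 2" if S: "1 \<le> S" for S
  proof -
    have "((\<lambda>s. exp (1/2 * s) * D s + 1/2 * (exp (1/2 * s) * Q s)) has_integral
        - (exp (1/2 * S) * Q S) - - (exp (1/2 * 0) * Q 0)) {0..S}"
    proof (rule fundamental_theorem_of_calculus)
      fix s
      have "((\<lambda>s. - (exp (1/2 * s) * Q s)) has_real_derivative
          exp (1/2 * s) * D s + 1/2 * (exp (1/2 * s) * Q s)) (at s)"
        by (auto intro!: derivative_eq_intros Q_has_derivative simp: D_def algebra_simps)
      then show "((\<lambda>s. - (exp (1/2 * s) * Q s)) has_vector_derivative
          exp (1/2 * s) * D s + 1/2 * (exp (1/2 * s) * Q s)) (at s within {0..S})"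
        by (simp add: has_real_derivative_iff_has_vector_derivative has_vector_derivative_at_within)
    qed (use S in simp)
    from integral_unique[OF this]
    have "integral {0..S} (\<lambda>s. exp (1/2 * s) * D s + 1/2 * (exp (1/2 * s) * Q s)) \<le> 1"
      using Q_pos[of S] by simp
    also have "integral {0..S} (\<lambda>s. exp (1/2 * s) * D s + 1/2 * (exp (1/2 * s) * Q s))
        = integral {0..S} (\<lambda>s. exp (1/2 * s) * D s) + integral {0..S} (\<lambda>s. 1/2 * (exp (1/2 * s) * Q s))"
      by (intro integral_add integrable_continuous_real continuous_intros)
    finally have 1: "integral {0..S} (\<lambda>s. exp (1/2 * s) * D s)
        \<le> 1 - integral {0..S} (\<lambda>s. 1/2 * (exp (1/2 * s) * Q s))" by simp
    have "exp (- 2 - 2 * b\<^sup>2) / 2 = integral {0..1::real} (\<lambda>s. exp (- 2 - 2 * b\<^sup>2) / 2)" by simp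
    also have "\<dots> \<le> integral {0..1} (\<lambda>s. 1/2 * (exp (1/2 * s) * Q s))"
    proof (intro integral_le integrable_continuous_real continuous_intros)
      fix s :: real assume s: "s \<in> {0..1}"
      have "Q 1 \<le> Q s"
      proof (rule DERIV_nonpos_imp_nonincreasing[of s 1 Q])
        show "\<exists>d. (Q has_real_derivative d) (at u) \<and> d \<le> 0" for u
          using p_pos[of u] by (intro exI[of _ "- p u"] conjI Q_has_derivative) auto
      qed (use s in simp)
      also have "\<dots> \<le> exp (1/2 * s) * Q s" using s Q_pos[of s] by (simp add: less_imp_le)
      finally show "exp (- 2 - 2 * b\<^sup>2) / 2 \<le> 1/2 * (exp (1/2 * s) * Q s)" using Q_1_ge by simp
    qed
    also have "\<dots> \<le> integral {0..S} (\<lambda>s. 1/2 * (exp (1/2 * s) * Q s))"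
      by (intro integral_subset_le integrable_continuous_real continuous_intros)
         (use S in \<open>auto simp: less_imp_le[OF Q_pos]\<close>)
    finally show ?thesis using 1 by simp
  qed
  show ?thesis
  proof (cases "1 \<le> S")
    case False
    have "integral {0..S} (\<lambda>s. exp (1/2 * s) * D s) \<le> integral {0..1} (\<lambda>s. exp (1/2 * s) * D s)"
      by (intro integral_subset_le integrable_continuous_real continuous_intros)
         (use False assms D_nonneg in auto)
    with long[of 1] show ?thesis by simp
  qed (rule long)
qed

end

text \<open>The bound of the source term in the equation for \<open>h'\<close> (last factor) divided by the gap
  \<open>exp (- 2 - 2 b\<^sup>2) / 2\<close> between 1 and the weighted mass of \<open>D\<close>.\<close>

definition decay_const :: "real \<Rightarrow> real" where
  "decay_const b = 2 * exp (2 + 2 * b\<^sup>2) * (exp (b\<^sup>2 / 2) * (1 + 3 * b\<^sup>2))"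

context diffusion_mode
begin

text \<open>The inhomogeneity in the equation for \<open>h'\<close>, in the weighted norm: \<open>D\<close> lies between 0 and \<open>p\<close>, and
  \<open>p\<close> is at most \<open>exp (b\<^sup>2 / 2 - s)\<close> because \<open>m \<le> 1\<close>.\<close>

lemma source_bound:
  assumes s: "0 \<le> s"
  shows "exp (1/2 * s) * \<bar>b\<^sup>2 * (m - s) * p s + D s\<bar> \<le> exp (b\<^sup>2 / 2) * (1 + 3 * b\<^sup>2)"
proof -
  have "\<bar>m - s\<bar> \<le> 1 + s" using m_pos m_le_1 s by linarith
  then have "\<bar>b\<^sup>2 * (m - s) * p s\<bar> \<le> b\<^sup>2 * (1 + s) * p s"
    using p_pos[of s] unfolding abs_mult by (auto intro!: mult_right_mono mult_left_mono)
  moreover have "\<bar>D s\<bar> \<le> p s" using D_nonneg[OF s] Q_pos[of s] by (simp add: D_def)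
  ultimately have "\<bar>b\<^sup>2 * (m - s) * p s + D s\<bar> \<le> (1 + b\<^sup>2 * (1 + s)) * p s" by (simp add: algebra_simps)
  also have "p s \<le> exp (b\<^sup>2 / 2) * exp (- s)"
  proof -
    have "m\<^sup>2 \<le> 1" using m_pos m_le_1 by (simp add: power_le_one)
    then have "b\<^sup>2 * m\<^sup>2 \<le> b\<^sup>2 * 1" by (intro mult_left_mono) auto
    then have "exp (b\<^sup>2 * m\<^sup>2 / 2) * exp (- s) \<le> exp (b\<^sup>2 / 2) * exp (- s)" by simp
    with p_le[of s] show ?thesis by linarith
  qed
  finally have "\<bar>b\<^sup>2 * (m - s) * p s + D s\<bar> \<le> (1 + b\<^sup>2 * (1 + s)) * (exp (b\<^sup>2 / 2) * exp (- s))"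
    using s by (simp add: mult_left_mono)
  then have "exp (1/2 * s) * \<bar>b\<^sup>2 * (m - s) * p s + D s\<bar>
      \<le> exp (1/2 * s) * ((1 + b\<^sup>2 * (1 + s)) * (exp (b\<^sup>2 / 2) * exp (- s)))"
    by (intro mult_left_mono) auto
  also have "\<dots> = exp (b\<^sup>2 / 2) * ((1 + b\<^sup>2) * exp (- (s / 2)) + b\<^sup>2 * (s * exp (- (s / 2))))"
    using exp_add[of "1/2 * s" "- s"] by (simp add: algebra_simps)
  also have "\<dots> \<le> exp (b\<^sup>2 / 2) * ((1 + b\<^sup>2) * 1 + b\<^sup>2 * 2)"
  proof (intro mult_left_mono add_mono)
    have "s / 2 \<le> exp (s / 2)" using exp_ge_add_one_self[of "s / 2"] by linarith
    then show "s * exp (- (s / 2)) \<le> 2" by (simp add: exp_minus field_simps)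
  qed (use s in auto)
  finally show ?thesis by (simp add: algebra_simps)
qed

text \<open>Exponential relaxation of the density to its slowest mode. The gap \<open>1/2\<close> in the exponent and
  the constant are uniform for \<open>b\<close> in bounded sets, which is essential in both regimes.\<close>

lemma relaxation_rate:
  assumes r: "continuous_on UNIV r"
    and eq: "\<And>s. 0 \<le> s \<Longrightarrow> r s = relaxation_kernel b s + volterra_conv (relaxation_kernel b) r s"
    and s: "0 \<le> s"
  shows "\<exists>d. (r has_real_derivative d) (at s within {0..}) \<and> 0 < r s \<and>
    \<bar>d / r s + b\<^sup>2 * m\<bar> \<le> decay_const b * exp (- s / 2)"
proof -
  define h where "h s = exp (b\<^sup>2 * m * s) * r s" for s
  define D' where "D' s = b\<^sup>2 * (m - s) * p s" for s
  define h' where "h' s = D' (max 0 s) + volterra_conv D' h (max 0 s)" for s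
  have p: "p = (\<lambda>s. exp (b\<^sup>2 * m * s) * relaxation_kernel b s)"
    by (simp add: fun_eq_iff p_eq relaxation_kernel_def algebra_simps flip: exp_add)
  have ch: "continuous_on UNIV h" unfolding h_def by (intro continuous_intros r)
  have cp: "continuous_on UNIV p" and cQ: "continuous_on UNIV Q" and cD: "continuous_on UNIV D"
    by (intro continuous_intros)+
  have cD': "continuous_on UNIV D'" unfolding D'_def by (intro continuous_intros)
  have renewal: "h s = p s + volterra_conv p h s" if "0 \<le> s" for s
  proof -
    have "volterra_conv p h s = exp (b\<^sup>2 * m * s) * volterra_conv (relaxation_kernel b) r s"
      unfolding p h_def[abs_def] by (rule volterra_conv_exp_weight)
    then show ?thesis using eq[OF that] by (simp add: h_def p algebra_simps)
  qed
  \<comment> \<open>The derivative of the left side is \<open>- p + h - p * h\<close>, which vanishes by the renewal equation.\<close>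
  have total: "Q s + volterra_conv Q h s = 1" if "0 \<le> s" for s
  proof -
    have "((\<lambda>s. Q s + volterra_conv Q h s) has_real_derivative 0) (at s within {0..})" if "0 \<le> s" for s
    proof -
      have c: "continuous_on UNIV (\<lambda>s. - p s)" by (intro continuous_intros)
      have "volterra_conv (\<lambda>s. - p s) h s = - volterra_conv p h s"
        by (simp add: volterra_conv_def)
      then show ?thesis
        using DERIV_add[OF has_field_derivative_at_within[OF Q_has_derivative]
          volterra_conv_has_derivative[OF Q_has_derivative c ch that]] renewal[OF that] by simp
    qed
    then obtain c where c: "\<And>s. 0 \<le> s \<Longrightarrow> Q s + volterra_conv Q h s = c"
      using has_field_derivative_zero_constant[of "{0..}" "\<lambda>s. Q s + volterra_conv Q h s"] by auto
    from c[of 0] c[OF that] show ?thesis by simp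
  qed
  have defective: "h s = 1 + D s + volterra_conv D h s" if "0 \<le> s" for s
    using renewal[OF that] total[OF that] volterra_conv_diff_left[OF cp cQ ch, of s]
    by (simp add: D_def[abs_def])
  have h0: "h 0 = 1" using defective[of 0] by simp
  have mass: "integral {0..s} D \<le> 1 - exp (- 2 - 2 * b\<^sup>2) / 2" if "0 \<le> s" for s
  proof -
    have "integral {0..s} D \<le> integral {0..s} (\<lambda>s. exp (1/2 * s) * D s)"
    proof (intro integral_le integrable_continuous_real continuous_intros)
      fix u :: real assume u: "u \<in> {0..s}"
      have "1 * D u \<le> exp (1/2 * u) * D u" using u D_nonneg[of u] by (intro mult_right_mono) auto
      then show "D u \<le> exp (1/2 * u) * D u" by simp
    qed
    also have "\<dots> \<le> 1 - exp (- 2 - 2 * b\<^sup>2) / 2" by (rule weighted_mass[OF that])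
    finally show ?thesis .
  qed
  have h_nonneg: "0 \<le> h s" if "0 \<le> s" for s
    by (rule nonneg_of_ge_volterra_conv[OF cD D_nonneg mass _ ch _ that])
       (use defective D_nonneg in auto)
  have h_ge: "1 \<le> h s" if "0 \<le> s" for s
  proof -
    have "0 \<le> volterra_conv D h s" unfolding volterra_conv_def
      by (intro Henstock_Kurzweil_Integration.integral_nonneg integrable_conv_integrand cD ch)
         (use D_nonneg h_nonneg in auto)
    then show ?thesis using defective[OF that] D_nonneg[OF that] by simp
  qed
  have D_deriv: "(D has_real_derivative D' s) (at s)" for s
    unfolding D'_def by (rule D_has_derivative)
  have ch': "continuous_on UNIV h'"
  proof -
    have "(D' has_real_derivative b\<^sup>2 * (- p s + (m - s) * (- (b * y + b\<^sup>2 * s) * p s))) (at s)" for s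
      unfolding D'_def[abs_def]
      by (auto intro!: derivative_eq_intros p_has_derivative simp: algebra_simps)
    moreover have "continuous_on UNIV (\<lambda>s. b\<^sup>2 * (- p s + (m - s) * (- (b * y + b\<^sup>2 * s) * p s)))"
      by (intro continuous_intros)
    ultimately have "continuous_on UNIV (\<lambda>s. volterra_conv D' h (max 0 s))"
      by (rule continuous_on_volterra_conv_max[OF _ _ ch])
    moreover have "continuous_on UNIV (\<lambda>s. D' (max 0 s))"
      unfolding D'_def by (intro continuous_intros)
    ultimately show ?thesis unfolding h'_def by (rule continuous_on_add[rotated])
  qed
  have h_deriv: "(h has_real_derivative h' s) (at s within {0..})" if "0 \<le> s" for s
  proof -
    have "((\<lambda>s. 1 + D s + volterra_conv D h s) has_real_derivative
        0 + D' s + (D 0 * h s + volterra_conv D' h s)) (at s within {0..})"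
      by (intro DERIV_add DERIV_const has_field_derivative_at_within[OF D_deriv]
          volterra_conv_has_derivative[OF D_deriv cD' ch that])
    then have "(h has_real_derivative 0 + D' s + (D 0 * h s + volterra_conv D' h s)) (at s within {0..})"
      by (rule has_field_derivative_transform_within[where d = 1]) (use that defective in auto)
    then show ?thesis using that by (simp add: h'_def)
  qed
  \<comment> \<open>The derivative is moved from \<open>D\<close> to \<open>h\<close>, which produces the boundary term \<open>D s * h 0\<close>.\<close>
  have h'_eq: "h' s = (D' s + D s) + volterra_conv D h' s" if "0 \<le> s" for s
    using volterra_conv_deriv_transfer[OF D_deriv cD' h_deriv ch ch' that] that h0 by (simp add: h'_def)
  have "\<bar>exp (1/2 * s) * h' s\<bar> \<le> exp (b\<^sup>2 / 2) * (1 + 3 * b\<^sup>2) / (1 - (1 - exp (- 2 - 2 * b\<^sup>2) / 2))"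
  proof (rule volterra_abs_bound[where D = "\<lambda>s. exp (1/2 * s) * D s" and x = "\<lambda>s. exp (1/2 * s) * h' s"])
    fix s :: real assume s: "0 \<le> s"
    have "exp (1/2 * s) * h' s - volterra_conv (\<lambda>s. exp (1/2 * s) * D s) (\<lambda>s. exp (1/2 * s) * h' s) s
        = exp (1/2 * s) * (D' s + D s)"
      unfolding volterra_conv_exp_weight by (subst h'_eq[OF s]) (simp add: algebra_simps)
    then show "\<bar>exp (1/2 * s) * h' s
        - volterra_conv (\<lambda>s. exp (1/2 * s) * D s) (\<lambda>s. exp (1/2 * s) * h' s) s\<bar>
       \<le> exp (b\<^sup>2 / 2) * (1 + 3 * b\<^sup>2)"
      using source_bound[OF s] by (simp add: D'_def abs_mult)
    show "0 \<le> exp (1/2 * s) * D s" using D_nonneg[OF s] by simp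
    show "integral {0..s} (\<lambda>s. exp (1/2 * s) * D s) \<le> 1 - exp (- 2 - 2 * b\<^sup>2) / 2"
      by (rule weighted_mass[OF s])
  next
    show "continuous_on UNIV (\<lambda>s. exp (1/2 * s) * D s)" by (intro continuous_intros)
    show "continuous_on UNIV (\<lambda>s. exp (1/2 * s) * h' s)" by (intro continuous_intros ch')
  qed (use s in simp_all)
  also have "\<dots> = decay_const b"
    by (simp add: decay_const_def exp_diff exp_minus exp_add field_simps)
  finally have bound: "\<bar>h' s\<bar> \<le> decay_const b * exp (- s / 2)"
    by (simp add: abs_mult exp_minus field_simps)
  have r_eq: "r = (\<lambda>s. exp (- (b\<^sup>2 * m) * s) * h s)"
    by (simp add: h_def fun_eq_iff flip: exp_add mult.assoc)
  define d where "d = exp (- (b\<^sup>2 * m) * s) * (- (b\<^sup>2 * m) * h s + h' s)"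
  have "((\<lambda>s. exp (- (b\<^sup>2 * m) * s) * h s) has_real_derivative d) (at s within {0..})"
    unfolding d_def by (auto intro!: derivative_eq_intros h_deriv[OF s] simp: algebra_simps)
  then have "(r has_real_derivative d) (at s within {0..})" by (simp only: r_eq)
  moreover have "0 < r s" using h_ge[OF s] by (simp add: r_eq)
  moreover have "d / r s + b\<^sup>2 * m = h' s / h s"
    using h_ge[OF s] by (simp add: d_def r_eq field_simps)
  moreover have "\<bar>h' s / h s\<bar> \<le> \<bar>h' s\<bar>"
    using h_ge[OF s] by (simp add: divide_le_eq mult_le_cancel_left1)
  ultimately show ?thesis using bound by (intro exI[of _ d]) auto
qed

end

section \<open>Velocity averages of Duhamel's formula\<close>

text \<open>Integrals of product functions factorise over the coordinates. This reduces Gaussian integrals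
  to the characteristic function of the one-dimensional standard normal distribution.\<close>

lemma lborel_product_integral:
  fixes g :: "'a::euclidean_space \<Rightarrow> real \<Rightarrow> complex"
  assumes g: "\<And>b. b \<in> Basis \<Longrightarrow> integrable lborel (g b)"
  shows "integrable lborel (\<lambda>x::'a. \<Prod>b\<in>Basis. g b (x \<bullet> b))"
    and "(LINT x|lborel. (\<Prod>b\<in>Basis. g b (x \<bullet> b))) = (\<Prod>b\<in>Basis. LINT x|lborel. g b x)"
proof -
  interpret product_sigma_finite "\<lambda>_::'a. lborel :: real measure" ..
  have gm: "g b \<in> borel_measurable borel" if "b \<in> Basis" for b
    using borel_measurable_integrable[OF g[OF that]] by simp
  have m: "(\<lambda>f. \<Sum>b\<in>Basis. f b *\<^sub>R b) \<in> measurable (\<Pi>\<^sub>M b\<in>(Basis::'a set). lborel) borel"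
    by measurable
  have pm: "(\<lambda>x::'a. \<Prod>b\<in>Basis. g b (x \<bullet> b)) \<in> borel_measurable borel"
    by (intro borel_measurable_prod measurable_compose[OF _ gm]) auto
  have c: "(\<Prod>b\<in>Basis. g b ((\<Sum>b\<in>Basis. f b *\<^sub>R b) \<bullet> b)) = (\<Prod>b\<in>(Basis::'a set). g b (f b))" for f
    by (intro prod.cong refl) simp
  have "integrable (\<Pi>\<^sub>M b\<in>(Basis::'a set). lborel) (\<lambda>f. \<Prod>b\<in>Basis. g b (f b))"
    using g by (intro product_integrable_prod) auto
  then show "integrable lborel (\<lambda>x::'a. \<Prod>b\<in>Basis. g b (x \<bullet> b))"
    by (subst lborel_eq) (simp add: integrable_distr_eq[OF m pm] c)
  have "(LINT x|lborel. (\<Prod>b\<in>(Basis::'a set). g b (x \<bullet> b)))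
     = (LINT f|(\<Pi>\<^sub>M b\<in>(Basis::'a set). lborel). (\<Prod>b\<in>Basis. g b (f b)))"
    by (subst lborel_eq) (simp add: integral_distr[OF m pm] c)
  also have "\<dots> = (\<Prod>b\<in>Basis. LINT x|lborel. g b x)"
    using g by (intro product_integral_prod) auto
  finally show "(LINT x|lborel. (\<Prod>b\<in>Basis. g b (x \<bullet> b))) = (\<Prod>b\<in>(Basis::'a set). LINT x|lborel. g b x)" .
qed

lemma maxwellian_eq_prod:
  fixes v :: "real ^ 'd"
  shows "maxwellian v = (\<Prod>b\<in>Basis. std_normal_density (v \<bullet> b))"
proof -
  have "(\<Prod>b\<in>(Basis::(real ^ 'd) set). std_normal_density (v \<bullet> b))
     = (\<Prod>b\<in>(Basis::(real ^ 'd) set). 1 / sqrt (2 * pi)) * (\<Prod>b\<in>Basis. exp (- (v \<bullet> b)\<^sup>2 / 2))"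
    by (simp only: std_normal_density_def prod.distrib)
  also have "(\<Prod>b\<in>(Basis::(real ^ 'd) set). exp (- (v \<bullet> b)\<^sup>2 / 2)) = exp (- (norm v)\<^sup>2 / 2)"
    by (simp add: exp_sum[symmetric] sum_negf sum_divide_distrib[symmetric] power2_norm_eq_inner
        euclidean_inner[of v v] power2_eq_square[symmetric])
  also have "(\<Prod>b\<in>(Basis::(real ^ 'd) set). 1 / sqrt (2 * pi)) = (2 * pi) powr (- real CARD('d) / 2)"
  proof -
    have "1 / sqrt (2 * pi) = (2 * pi) powr (- 1/2)"
      by (simp add: powr_minus powr_half_sqrt field_simps)
    then show ?thesis by (simp add: powr_power)
  qed
  finally show ?thesis by (simp add: maxwellian_def)
qed

lemma gaussian_fourier:
  shows "integrable lborel (\<lambda>x. complex_of_real (std_normal_density x) * exp (\<i> * complex_of_real (w * x)))"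
    and "(LINT x|lborel. complex_of_real (std_normal_density x) * exp (\<i> * complex_of_real (w * x)))
       = complex_of_real (exp (- w\<^sup>2 / 2))"
proof -
  have "integrable lborel (\<lambda>x. complex_of_real (std_normal_density x))"
    by (intro integrable_of_real integrable_normal_density) simp
  then show "integrable lborel (\<lambda>x. complex_of_real (std_normal_density x) * exp (\<i> * complex_of_real (w * x)))"
    by (rule Bochner_Integration.integrable_bound) (auto simp: norm_mult)
  have "char std_normal_distribution w
      = (LINT x|lborel. std_normal_density x *\<^sub>R exp (\<i> * complex_of_real (w * x)))"
    unfolding char_def by (subst integral_density) auto
  then show "(LINT x|lborel. complex_of_real (std_normal_density x) * exp (\<i> * complex_of_real (w * x)))
       = complex_of_real (exp (- w\<^sup>2 / 2))"
    by (simp add: char_std_normal_distribution scaleR_conv_of_real)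
qed

lemma maxwellian_fourier:
  fixes w :: "real ^ 'd"
  shows "(LINT v|lborel. complex_of_real (maxwellian v) * exp (\<i> * complex_of_real (w \<bullet> v)))
      = complex_of_real (exp (- (norm w)\<^sup>2 / 2))"
proof -
  have "complex_of_real (maxwellian v) * exp (\<i> * complex_of_real (w \<bullet> v))
      = (\<Prod>b\<in>Basis. complex_of_real (std_normal_density (v \<bullet> b)) * exp (\<i> * complex_of_real ((w \<bullet> b) * (v \<bullet> b))))"
    for v :: "real ^ 'd"
    by (simp add: maxwellian_eq_prod prod.distrib euclidean_inner[of w v] exp_sum sum_distrib_left)
  then have "(LINT v|lborel. complex_of_real (maxwellian v) * exp (\<i> * complex_of_real (w \<bullet> v)))
      = (\<Prod>b\<in>Basis. complex_of_real (exp (- (w \<bullet> b)\<^sup>2 / 2)))"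
    by (simp only: lborel_product_integral(2)[OF gaussian_fourier(1)] gaussian_fourier(2))
  also have "\<dots> = complex_of_real (exp (- (norm w)\<^sup>2 / 2))"
    by (simp add: exp_sum[symmetric] sum_negf sum_divide_distrib[symmetric] power2_norm_eq_inner
        euclidean_inner[of w w] power2_eq_square[symmetric] flip: of_real_prod)
  finally show ?thesis .
qed

lemma maxwellian_pos: "0 < maxwellian v"
  by (simp add: maxwellian_def)

lemma integrable_maxwellian: "integrable lborel (maxwellian :: real ^ 'd \<Rightarrow> real)"
proof -
  have "integrable lborel (\<lambda>v::real ^ 'd. \<Prod>b\<in>Basis. complex_of_real (std_normal_density (v \<bullet> b)))"
    using gaussian_fourier(1)[of 0] by (intro lborel_product_integral(1)) simp
  then have "integrable lborel (\<lambda>v::real ^ 'd. Re (complex_of_real (maxwellian v)))"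
    by (intro integrable_Re) (simp add: maxwellian_eq_prod)
  then show ?thesis by simp
qed

lemma borel_measurable_maxwellian [measurable]: "maxwellian \<in> borel_measurable borel"
  using borel_measurable_integrable[OF integrable_maxwellian] by simp

lemma duhamel_formula:
  fixes f g :: "real \<Rightarrow> complex"
  assumes f: "\<And>t. 0 \<le> t \<Longrightarrow> (f has_vector_derivative - a * f t + g t) (at t within {0..})" and t: "0 \<le> t"
  shows "f t = exp (- a * t) * f 0 + integral {0..t} (\<lambda>u. exp (- a * (t - u)) * g u)"
proof -
  have "((\<lambda>u. exp (a * u) * g u) has_integral exp (a * t) * f t - exp (a * (0::real)) * f 0) {0..t}"
  proof (rule fundamental_theorem_of_calculus[OF t])
    fix u assume u: "u \<in> {0..t}"
    have e: "((\<lambda>u. exp (a * complex_of_real u)) has_vector_derivative exp (a * u) * a) (at u within {0..t})"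
      by (rule has_vector_derivative_real_field) (auto intro!: derivative_eq_intros)
    have "(f has_vector_derivative - a * f u + g u) (at u within {0..t})"
      by (rule has_vector_derivative_within_subset[OF f]) (use u in auto)
    from has_vector_derivative_mult[OF e this]
    show "((\<lambda>u. exp (a * complex_of_real u) * f u) has_vector_derivative exp (a * u) * g u) (at u within {0..t})"
      by (simp add: algebra_simps)
  qed
  from has_integral_mult_right[OF this, of "exp (- a * t)"]
  have "integral {0..t} (\<lambda>u. exp (- a * t) * (exp (a * u) * g u)) = exp (- a * t) * (exp (a * t) * f t - f 0)"
    by (intro integral_unique) simp
  also have "(\<lambda>u. exp (- a * t) * (exp (a * u) * g u)) = (\<lambda>u. exp (- a * (t - u)) * g u)"
    by (simp add: fun_eq_iff algebra_simps flip: exp_add mult.assoc)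
  also have "exp (- a * t) * (exp (a * t) * f t - f 0) = f t - exp (- a * t) * f 0"
    by (simp add: algebra_simps flip: exp_add mult.assoc)
  finally show ?thesis by simp
qed

lemma duhamel_solves:
  fixes g :: "real \<Rightarrow> complex" and a c :: complex
  assumes g: "continuous_on {0..} g" and t: "0 \<le> t"
  defines "f \<equiv> \<lambda>t. exp (- a * complex_of_real t) * c + integral {0..t} (\<lambda>u. exp (- a * (t - u)) * g u)"
  shows "(f has_vector_derivative - a * f t + g t) (at t within {0..})"
proof -
  define G where "G t = integral {0..t} (\<lambda>u. exp (a * u) * g u)" for t
  have f_eq: "f t = exp (- a * complex_of_real t) * (c + G t)" for t
  proof -
    have "(\<lambda>u. exp (- a * (t - u)) * g u) = (\<lambda>u. exp (- a * complex_of_real t) * (exp (a * u) * g u))"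
      by (simp add: fun_eq_iff algebra_simps flip: exp_add mult.assoc)
    then show ?thesis by (simp add: f_def G_def distrib_left)
  qed
  have "continuous_on {0..t+1} (\<lambda>u. exp (a * complex_of_real u) * g u)"
    by (intro continuous_intros continuous_on_subset[OF g]) auto
  then have "(G has_vector_derivative exp (a * t) * g t) (at t within {0..t+1})"
    unfolding G_def by (rule integral_has_vector_derivative) (use t in auto)
  moreover have w: "at t within {0..t+1} = at t within {0..}"
    by (rule at_within_nhd[of _ "{..<t+1}"]) (use t in auto)
  ultimately have "(G has_vector_derivative exp (a * t) * g t) (at t within {0..})" by simp
  then have "((\<lambda>t. c + G t) has_vector_derivative 0 + exp (a * t) * g t) (at t within {0..})"
    by (intro has_vector_derivative_add has_vector_derivative_const)
  moreover have e: "((\<lambda>u. exp (- a * complex_of_real u)) has_vector_derivative exp (- a * t) * (- a)) (at t within {0..})"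
    by (rule has_vector_derivative_real_field) (auto intro!: derivative_eq_intros)
  ultimately have "((\<lambda>t. exp (- a * complex_of_real t) * (c + G t)) has_vector_derivative
      exp (- a * t) * (0 + exp (a * t) * g t) + exp (- a * t) * (- a) * (c + G t)) (at t within {0..})"
    by (intro has_vector_derivative_mult)
  moreover have "exp (- a * t) * (0 + exp (a * t) * g t) + exp (- a * t) * (- a) * (c + G t) = - a * f t + g t"
  proof -
    have "E1 * (0 + E2 * x) + E1 * (- a) * y = - a * (E1 * y) + E1 * E2 * x" for E1 E2 x y :: complex
      by (simp add: algebra_simps)
    moreover have "exp (- a * t) * exp (a * t) = 1" by (simp flip: exp_add)
    ultimately show ?thesis by (simp only: f_eq mult_1)
  qed
  ultimately show ?thesis by (simp only: f_eq[abs_def])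
qed

text \<open>Phase mixing: free transport with velocity \<open>v\<close> multiplies a Fourier coefficient by a phase
  that is linear in \<open>v\<close>, and averaging these phases over the Maxwellian gives Gaussian decay.\<close>

lemma maxwellian_free_transport:
  fixes k :: "real ^ 'd"
  shows "(LINT v|lborel. complex_of_real (maxwellian v) * exp (- (c + \<i> * complex_of_real (k \<bullet> v)) * complex_of_real s))
      = exp (- c * complex_of_real s) * complex_of_real (exp (- (norm k)\<^sup>2 * s\<^sup>2 / 2))"
proof -
  have eq: "complex_of_real (maxwellian v) * exp (- (c + \<i> * complex_of_real (k \<bullet> v)) * complex_of_real s)
     = exp (- c * complex_of_real s) * (complex_of_real (maxwellian v) * exp (\<i> * complex_of_real (((- s) *\<^sub>R k) \<bullet> v)))" for v
  proof -
    have "- (c + \<i> * complex_of_real (k \<bullet> v)) * complex_of_real s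
      = - c * complex_of_real s + \<i> * complex_of_real (((- s) *\<^sub>R k) \<bullet> v)" by (simp add: algebra_simps)
    then show ?thesis by (simp only: exp_add mult_ac)
  qed
  show ?thesis unfolding eq integral_mult_right_zero maxwellian_fourier
    by (simp add: power_mult_distrib mult.commute)
qed

lemma integrable_maxwellian_bounded:
  fixes g :: "real ^ 'd \<Rightarrow> complex"
  assumes "g \<in> borel_measurable borel" "\<And>v. norm (g v) \<le> B"
  shows "integrable lborel (\<lambda>v. complex_of_real (maxwellian v) * g v)"
proof (rule Bochner_Integration.integrable_bound)
  show "integrable lborel (\<lambda>v::real ^ 'd. maxwellian v * B)"
    by (intro integrable_mult_left integrable_maxwellian)
  show "AE v in lborel. norm (complex_of_real (maxwellian v) * g v) \<le> norm (maxwellian v * B)"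
    using assms(2) maxwellian_pos
    by (intro AE_I2) (simp add: norm_mult abs_mult order_trans[OF norm_ge_zero assms(2)] less_imp_le mult_left_mono)
  show "(\<lambda>v. complex_of_real (maxwellian v) * g v) \<in> borel_measurable lborel"
    using assms(1) by measurable
qed

lemma free_transport_norm:
  assumes "0 \<le> Re c" "0 \<le> s"
  shows "norm (exp (- (c + \<i> * complex_of_real x) * complex_of_real s)) \<le> 1"
  using assms by (simp add: mult_nonneg_nonneg)

text \<open>Fubini's theorem for the velocity average of the collision term. The phases have modulus at most
  1, so the integrand is dominated by the Maxwellian times \<open>|\<rho>|\<close> on \<open>[0, t]\<close>.\<close>

lemma maxwellian_duhamel_mass:
  fixes k :: "real ^ 'd" and \<rho> :: "real \<Rightarrow> complex"
  assumes \<rho>: "continuous_on UNIV \<rho>" and c: "0 \<le> Re c"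
  shows "integrable lborel (\<lambda>v. complex_of_real (maxwellian v) *
           integral {0..t} (\<lambda>u. exp (- (c + \<i> * complex_of_real (k \<bullet> v)) * complex_of_real (t - u)) * \<rho> u))"
    and "(LINT v|lborel. complex_of_real (maxwellian v) *
           integral {0..t} (\<lambda>u. exp (- (c + \<i> * complex_of_real (k \<bullet> v)) * complex_of_real (t - u)) * \<rho> u))
       = integral {0..t} (\<lambda>u. exp (- c * complex_of_real (t - u))
            * complex_of_real (exp (- (norm k)\<^sup>2 * (t - u)\<^sup>2 / 2)) * \<rho> u)"
proof -
  define E where "E v u = exp (- (c + \<i> * complex_of_real (k \<bullet> v)) * complex_of_real (t - u))" for v u
  define H where "H v u = indicator {0..t} u *\<^sub>R (complex_of_real (maxwellian v) * E v u * \<rho> u)" for v u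
  have [measurable]: "\<rho> \<in> borel_measurable borel" using \<rho> by (rule borel_measurable_continuous_onI)
  have [measurable]: "case_prod E \<in> borel_measurable (borel \<Otimes>\<^sub>M borel)"
    unfolding E_def borel_prod by (intro borel_measurable_continuous_onI) (auto intro!: continuous_intros simp: case_prod_beta)
  have Hm [measurable]: "case_prod H \<in> borel_measurable (lborel \<Otimes>\<^sub>M lborel)"
    unfolding H_def by measurable
  have cE: "continuous_on S (E v)" for S v unfolding E_def by (intro continuous_intros)
  have slice: "set_integrable lborel {0..t} (\<lambda>u. complex_of_real (maxwellian v) * E v u * \<rho> u)" for v
    by (intro borel_integrable_atLeastAtMost' continuous_intros cE continuous_on_subset[OF \<rho>]) auto
  have slice_val: "(LINT u|lborel. H v u) = complex_of_real (maxwellian v) * integral {0..t} (\<lambda>u. E v u * \<rho> u)" for v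
  proof -
    have "set_integrable lborel {0..t} (\<lambda>u. E v u * \<rho> u)"
      by (intro borel_integrable_atLeastAtMost' continuous_intros cE continuous_on_subset[OF \<rho>]) auto
    from set_borel_integral_eq_integral(2)[OF this]
    have "(LINT u|lborel. indicator {0..t} u *\<^sub>R (E v u * \<rho> u)) = integral {0..t} (\<lambda>u. E v u * \<rho> u)"
      by (simp only: set_lebesgue_integral_def)
    moreover have "H v u = complex_of_real (maxwellian v) * (indicator {0..t} u *\<^sub>R (E v u * \<rho> u))" for u
      by (simp add: H_def)
    ultimately show ?thesis by (simp only: integral_mult_right_zero)
  qed
  have "integrable lborel (\<lambda>v. LINT u|lborel. norm (H v u))"
  proof (rule Bochner_Integration.integrable_bound)
    show "integrable lborel (\<lambda>v::real ^ 'd. maxwellian v * (LINT u:{0..t}|lborel. norm (\<rho> u)))"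
      by (intro integrable_mult_left integrable_maxwellian)
    show "AE v in lborel. norm (LINT u|lborel. norm (H v u))
        \<le> norm (maxwellian v * (LINT u:{0..t}|lborel. norm (\<rho> u)))"
    proof (rule AE_I2)
      fix v
      have "(LINT u|lborel. norm (H v u)) \<le> (LINT u|lborel. maxwellian v * (indicator {0..t} u *\<^sub>R norm (\<rho> u)))"
      proof (rule integral_mono)
        show "integrable lborel (\<lambda>u. norm (H v u))"
          using slice[of v] unfolding set_integrable_def H_def by (rule integrable_norm)
        have "set_integrable lborel {0..t} (\<lambda>u. norm (\<rho> u))"
          by (intro borel_integrable_atLeastAtMost' continuous_intros continuous_on_subset[OF \<rho>]) auto
        then show "integrable lborel (\<lambda>u. maxwellian v * (indicator {0..t} u *\<^sub>R norm (\<rho> u)))"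
          unfolding set_integrable_def by (rule integrable_mult_right)
        fix u
        show "norm (H v u) \<le> maxwellian v * (indicator {0..t} u *\<^sub>R norm (\<rho> u))"
        proof (cases "u \<in> {0..t}")
          case True
          then have "norm (E v u) \<le> 1" unfolding E_def by (intro free_transport_norm c) auto
          then have "norm (E v u) * norm (\<rho> u) \<le> 1 * norm (\<rho> u)" by (intro mult_right_mono) auto
          then show ?thesis using True maxwellian_pos[of v]
            by (simp add: H_def norm_mult mult.assoc)
        qed (simp add: H_def)
      qed
      then show "norm (LINT u|lborel. norm (H v u)) \<le> norm (maxwellian v * (LINT u:{0..t}|lborel. norm (\<rho> u)))"
        by (simp add: set_lebesgue_integral_def abs_of_nonneg Bochner_Integration.integral_nonneg)
    qed
  qed measurable
  then have int: "integrable (lborel \<Otimes>\<^sub>M lborel) (case_prod H)"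
    using slice unfolding set_integrable_def
    by (intro lborel_pair.Fubini_integrable Hm) (auto simp: H_def)
  show "integrable lborel (\<lambda>v. complex_of_real (maxwellian v) *
           integral {0..t} (\<lambda>u. exp (- (c + \<i> * complex_of_real (k \<bullet> v)) * complex_of_real (t - u)) * \<rho> u))"
    using lborel_pair.integrable_fst'[OF int] by (simp add: slice_val E_def)
  have "(LINT v|lborel. complex_of_real (maxwellian v) * integral {0..t} (\<lambda>u. E v u * \<rho> u))
      = (LINT v|lborel. LINT u|lborel. H v u)" by (simp add: slice_val)
  also have "\<dots> = (LINT u|lborel. LINT v|lborel. H v u)"
    using lborel_pair.Fubini_integral[OF int] by simp
  also have "\<dots> = (LINT u:{0..t}|lborel. exp (- c * complex_of_real (t - u))
      * complex_of_real (exp (- (norm k)\<^sup>2 * (t - u)\<^sup>2 / 2)) * \<rho> u)"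
    unfolding set_lebesgue_integral_def
  proof (rule Bochner_Integration.integral_cong[OF refl])
    fix u
    have "(LINT v|lborel. H v u) = indicator {0..t} u *\<^sub>R ((LINT v|lborel. complex_of_real (maxwellian v) * E v u) * \<rho> u)"
      unfolding H_def by simp
    then show "(LINT v|lborel. H v u) = indicator {0..t} u *\<^sub>R (exp (- c * complex_of_real (t - u))
      * complex_of_real (exp (- (norm k)\<^sup>2 * (t - u)\<^sup>2 / 2)) * \<rho> u)"
      unfolding E_def maxwellian_free_transport .
  qed
  also have "\<dots> = integral {0..t} (\<lambda>u. exp (- c * complex_of_real (t - u))
            * complex_of_real (exp (- (norm k)\<^sup>2 * (t - u)\<^sup>2 / 2)) * \<rho> u)"
    by (intro set_borel_integral_eq_integral(2) borel_integrable_atLeastAtMost' continuous_intros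
        continuous_on_subset[OF \<rho>]) auto
  finally show "(LINT v|lborel. complex_of_real (maxwellian v) *
           integral {0..t} (\<lambda>u. exp (- (c + \<i> * complex_of_real (k \<bullet> v)) * complex_of_real (t - u)) * \<rho> u))
       = integral {0..t} (\<lambda>u. exp (- c * complex_of_real (t - u))
            * complex_of_real (exp (- (norm k)\<^sup>2 * (t - u)\<^sup>2 / 2)) * \<rho> u)"
    by (simp add: E_def)
qed

section \<open>Solutions in frequency space\<close>

text \<open>The point \<open>y\<close> with \<open>M(y) = b\<close>. It is unique, since the Mills ratio is strictly decreasing.\<close>

definition decay_root :: "real \<Rightarrow> real" where
  "decay_root b = (SOME y. mills_ratio y = b)"

text \<open>The limiting dissipation rate in units of \<open>1 / \<tau>\<close>.\<close>

definition decay_rate :: "real \<Rightarrow> real" where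
  "decay_rate b = 1 - b * decay_root b"

lemma mills_ratio_decay_root: "0 < b \<Longrightarrow> mills_ratio (decay_root b) = b"
  unfolding decay_root_def by (rule someI_ex[OF mills_ratio_surj])

lemma diffusion_mode_decay_root: "0 < b \<Longrightarrow> diffusion_mode b (decay_root b)"
  by (simp add: diffusion_mode_def mills_ratio_decay_root)

lemma decay_rate_eq: "0 < b \<Longrightarrow> decay_rate b = b\<^sup>2 * diffusion_mode.m b (decay_root b)"
  using diffusion_mode.b2m[OF diffusion_mode_decay_root[of b]] by (simp add: decay_rate_def)

lemma decay_rate_bounds:
  assumes "0 < b"
  shows "decay_rate b \<le> b\<^sup>2" "b\<^sup>2 * (1 - 3 * b\<^sup>2) \<le> decay_rate b"
proof -
  note m = diffusion_mode_decay_root[OF assms]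
  have "b\<^sup>2 * diffusion_mode.m b (decay_root b) \<le> b\<^sup>2 * 1"
    by (intro mult_left_mono diffusion_mode.m_le_1[OF m]) auto
  then show "decay_rate b \<le> b\<^sup>2" by (simp add: decay_rate_eq[OF assms])
  show "b\<^sup>2 * (1 - 3 * b\<^sup>2) \<le> decay_rate b"
    unfolding decay_rate_eq[OF assms] by (intro mult_left_mono diffusion_mode.m_ge[OF m]) auto
qed

lemma decay_rate_gap:
  assumes "0 < b" "1 \<le> b\<^sup>2"
  shows "decay_rate b \<le> b\<^sup>2 * (1 - 1/192)"
  unfolding decay_rate_eq[OF assms(1)]
  by (intro mult_left_mono diffusion_mode.m_gap[OF diffusion_mode_decay_root[OF assms(1)] assms(2)]) auto

lemma decay_rate_ge_1:
  assumes "sqrt (pi / 2) \<le> b" shows "1 \<le> decay_rate b"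
proof -
  have b: "0 < b" using assms by (smt (verit) pi_gt_zero real_sqrt_gt_zero divide_pos_pos)
  have "\<not> 0 < decay_root b"
    using mills_ratio_strict_antimono[of 0 "decay_root b"] assms
    by (auto simp: mills_ratio_0 mills_ratio_decay_root[OF b])
  then show ?thesis using b by (simp add: decay_rate_def mult_nonneg_nonpos)
qed

lemma deriv_plasma_Z_decay_rate:
  "0 < b \<Longrightarrow> - deriv plasma_Z (zeta_hat b) = complex_of_real (decay_rate b)"
  unfolding decay_rate_def by (rule deriv_plasma_Z_zeta_hat[OF mills_ratio_decay_root])

text \<open>The density as a function of the rescaled time \<open>t / \<tau>\<close>, for data of unit density.\<close>

definition relaxation_profile :: "real \<Rightarrow> (real \<Rightarrow> real) \<Rightarrow> bool" where
  "relaxation_profile b r \<longleftrightarrow> continuous_on UNIV r \<and>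
     (\<forall>s\<ge>0. r s = relaxation_kernel b s + volterra_conv (relaxation_kernel b) r s)"

lemma relaxation_profile_rate:
  assumes "relaxation_profile b r" "0 < b" "0 \<le> s"
  shows "\<exists>d. (r has_real_derivative d) (at s within {0..}) \<and> 0 < r s \<and>
    \<bar>d / r s + decay_rate b\<bar> \<le> decay_const b * exp (- s / 2)"
  unfolding decay_rate_eq[OF assms(2)]
  by (rule diffusion_mode.relaxation_rate[OF diffusion_mode_decay_root[OF assms(2)]])
     (use assms in \<open>auto simp: relaxation_profile_def\<close>)

text \<open>Spatially homogeneous data: the density is conserved.\<close>

lemma relaxation_profile_0: "relaxation_profile 0 (\<lambda>_. 1)"
proof -
  have "((\<lambda>u. exp (- u)) has_integral - exp (- s) - - exp (- 0)) {0..s}" if "0 \<le> s" for s :: real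
    by (rule fundamental_theorem_of_calculus[OF that])
       (auto intro!: derivative_eq_intros simp flip: has_real_derivative_iff_has_vector_derivative)
  from integral_unique[OF this] show ?thesis
    by (simp add: relaxation_profile_def volterra_conv_const relaxation_kernel_def[abs_def])
qed

lemma relaxation_profile_differentiable:
  assumes "relaxation_profile b r" "0 \<le> s"
  shows "\<exists>d. (r has_real_derivative d) (at s within {0..})"
proof -
  let ?K' = "\<lambda>s. (- 1 - b\<^sup>2 * s) * relaxation_kernel b s"
  have K: "(relaxation_kernel b has_real_derivative ?K' s) (at s)" for s
    unfolding relaxation_kernel_def[abs_def] by (auto intro!: derivative_eq_intros simp: field_simps)
  have K': "continuous_on UNIV ?K'" by (intro continuous_intros)
  have r: "continuous_on UNIV r" using assms(1) by (simp add: relaxation_profile_def)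
  note DERIV_add[OF has_field_derivative_at_within[OF K] volterra_conv_has_derivative[OF K K' r assms(2)]]
  then have "(r has_real_derivative ?K' s + (relaxation_kernel b 0 * r s + volterra_conv ?K' r s)) (at s within {0..})"
    by (rule has_field_derivative_transform_within[where d = 1])
       (use assms in \<open>auto simp: relaxation_profile_def\<close>)
  then show ?thesis by blast
qed

lemma relaxation_profile_scaled_differentiable:
  assumes "relaxation_profile b r" "0 < \<tau>" "0 \<le> t"
  shows "\<exists>d. ((\<lambda>t. r (t / \<tau>)) has_real_derivative d) (at t within {0..})"
proof -
  obtain d where d: "(r has_real_derivative d) (at (t / \<tau>) within {0..})"
    using relaxation_profile_differentiable[OF assms(1)] assms(2,3) by (meson divide_nonneg_pos)
  have "(r has_real_derivative d) (at (t / \<tau>) within (\<lambda>t. t / \<tau>) ` {0..})"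
    by (rule has_field_derivative_subset[OF d]) (use assms in auto)
  moreover have "((\<lambda>t. t / \<tau>) has_real_derivative 1 / \<tau>) (at t within {0..})"
    using assms(2) by (auto intro!: derivative_eq_intros)
  ultimately have "(r \<circ> (\<lambda>t. t / \<tau>) has_real_derivative d * (1 / \<tau>)) (at t within {0..})"
    by (rule DERIV_image_chain)
  then show ?thesis by (auto simp: o_def)
qed

lemma volterra_rescale:
  assumes "0 < \<tau>"
  shows "integral {0..t} (\<lambda>u. f ((t - u) / \<tau>) * x (u / \<tau>)) = \<tau> * volterra_conv f x (t / \<tau>)"
proof -
  have img: "(\<lambda>x. x / (1 / \<tau>)) ` {0..t / \<tau>} = {0..t}"
  proof (intro set_eqI iffI)
    fix u assume "u \<in> {0..t}"
    then have "u = (u / \<tau>) / (1 / \<tau>)" "u / \<tau> \<in> {0..t / \<tau>}" using assms by (auto simp: divide_right_mono)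
    then show "u \<in> (\<lambda>x. x / (1 / \<tau>)) ` {0..t / \<tau>}" by (rule image_eqI)
  qed (use assms in \<open>auto simp: field_simps\<close>)
  have "integral {0..t} (\<lambda>u. f (t / \<tau> - 1 / \<tau> * u) * x (1 / \<tau> * u)) = \<tau> * volterra_conv f x (t / \<tau>)"
    using integral_stretch_real[of "1 / \<tau>" 0 "t / \<tau>" "\<lambda>u. f (t / \<tau> - u) * x u"] assms
    unfolding img by (simp add: volterra_conv_def)
  then show ?thesis by (simp add: diff_divide_distrib)
qed

lemma kernel_rescale:
  assumes "0 < \<tau>"
  shows "exp (- complex_of_real (1 / \<tau>) * complex_of_real s)
      * complex_of_real (exp (- (norm (k :: real ^ 'd))\<^sup>2 * s\<^sup>2 / 2))
    = complex_of_real (relaxation_kernel (\<tau> * norm k) (s / \<tau>))"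
proof -
  have "- (1 / \<tau>) * s + - (norm k)\<^sup>2 * s\<^sup>2 / 2 = - (s / \<tau>) - (\<tau> * norm k)\<^sup>2 * (s / \<tau>)\<^sup>2 / 2"
    using assms by (simp add: power_mult_distrib power_divide)
  then have "exp (- (1 / \<tau>) * s) * exp (- (norm k)\<^sup>2 * s\<^sup>2 / 2) = relaxation_kernel (\<tau> * norm k) (s / \<tau>)"
    unfolding relaxation_kernel_def by (simp only: mult_exp_exp)
  moreover have "exp (- complex_of_real (1 / \<tau>) * complex_of_real s) = complex_of_real (exp (- (1 / \<tau>) * s))"
    by (simp flip: exp_of_real)
  ultimately show ?thesis by (simp only: flip: of_real_mult)
qed

text \<open>Duhamel's formula for one Fourier coefficient, with the Maxwellian data \<open>c\<close> and the density
  \<open>c r(t / \<tau>)\<close> inserted in the collision term. That this is also the density of the mode is the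
  content of \<open>kinetic_mode_mass\<close>, and is equivalent to the Volterra equation for \<open>r\<close>.\<close>

definition kinetic_mode ::
  "real \<Rightarrow> real ^ 'd \<Rightarrow> complex \<Rightarrow> (real \<Rightarrow> real) \<Rightarrow> real ^ 'd \<Rightarrow> real \<Rightarrow> complex" where
  "kinetic_mode \<tau> k c r v t =
     exp (- (complex_of_real (1 / \<tau>) + \<i> * complex_of_real (k \<bullet> v)) * complex_of_real t) * (c * complex_of_real (maxwellian v))
     + integral {0..t} (\<lambda>u. exp (- (complex_of_real (1 / \<tau>) + \<i> * complex_of_real (k \<bullet> v)) * complex_of_real (t - u))
         * (c * complex_of_real (r (u / \<tau>)) / complex_of_real \<tau> * complex_of_real (maxwellian v)))"

text \<open>The velocity average of Duhamel's formula for an arbitrary continuous density \<open>P\<close>. It is used in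
  two directions: to show that a mode built from a profile \<open>r\<close> is consistent, and to derive the
  Volterra equation for the density of an arbitrary solution.\<close>

lemma duhamel_mass:
  fixes k :: "real ^ 'd" and P :: "real \<Rightarrow> complex" and c :: complex
  assumes P: "continuous_on UNIV P" and \<tau>: "0 < \<tau>" and t: "0 \<le> t"
  defines "F \<equiv> \<lambda>v::real ^ 'd. exp (- (complex_of_real (1 / \<tau>) + \<i> * complex_of_real (k \<bullet> v)) * complex_of_real t) * (c * complex_of_real (maxwellian v))
     + integral {0..t} (\<lambda>u. exp (- (complex_of_real (1 / \<tau>) + \<i> * complex_of_real (k \<bullet> v)) * complex_of_real (t - u))
         * (P u / complex_of_real \<tau> * complex_of_real (maxwellian v)))"
  shows "integrable lborel F"
    and "(LINT v|lborel. F v) = c * complex_of_real (relaxation_kernel (\<tau> * norm k) (t / \<tau>))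
      + integral {0..t} (\<lambda>u. complex_of_real (relaxation_kernel (\<tau> * norm k) ((t - u) / \<tau>)) * (P u / complex_of_real \<tau>))"
proof -
  define c1 where "c1 = complex_of_real (1 / \<tau>)"
  have c1: "0 \<le> Re c1" using \<tau> by (simp add: c1_def)
  define E where "E v s = exp (- (c1 + \<i> * complex_of_real (k \<bullet> v)) * complex_of_real s)" for v s
  have P': "continuous_on UNIV (\<lambda>u. P u / complex_of_real \<tau>)" by (intro continuous_intros P) (use \<tau> in auto)
  have F_eq: "F = (\<lambda>v. c * (complex_of_real (maxwellian v) * E v t)
     + complex_of_real (maxwellian v) * integral {0..t} (\<lambda>u. E v (t - u) * (P u / complex_of_real \<tau>)))"
  proof
    fix v
    have "integral {0..t} (\<lambda>u. E v (t - u) * (P u / complex_of_real \<tau> * complex_of_real (maxwellian v)))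
       = integral {0..t} (\<lambda>u. complex_of_real (maxwellian v) * (E v (t - u) * (P u / complex_of_real \<tau>)))"
      by (simp only: mult_ac)
    then show "F v = c * (complex_of_real (maxwellian v) * E v t)
     + complex_of_real (maxwellian v) * integral {0..t} (\<lambda>u. E v (t - u) * (P u / complex_of_real \<tau>))"
      by (simp only: F_def flip: c1_def E_def integral_mult_right) (simp only: mult_ac)
  qed
  have i1: "integrable lborel (\<lambda>v. complex_of_real (maxwellian v) * E v t)"
  proof (rule integrable_maxwellian_bounded)
    show "(\<lambda>v. E v t) \<in> borel_measurable borel" unfolding E_def
      by (intro borel_measurable_continuous_onI continuous_intros)
    show "norm (E v t) \<le> 1" for v unfolding E_def by (rule free_transport_norm[OF c1 t])
  qed
  note i2 = maxwellian_duhamel_mass(1)[OF P' c1, of t k, folded E_def]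
  show "integrable lborel F" unfolding F_eq
    by (intro Bochner_Integration.integrable_add integrable_mult_right i1 i2)
  have "(LINT v|lborel. F v) = c * (LINT v|lborel. complex_of_real (maxwellian v) * E v t)
    + (LINT v|lborel. complex_of_real (maxwellian v) * integral {0..t} (\<lambda>u. E v (t - u) * (P u / complex_of_real \<tau>)))"
    unfolding F_eq
    by (simp only: Bochner_Integration.integral_add[OF integrable_mult_right[OF i1] i2] integral_mult_right_zero)
  also have "(LINT v|lborel. complex_of_real (maxwellian v) * E v t)
      = complex_of_real (relaxation_kernel (\<tau> * norm k) (t / \<tau>))"
    unfolding E_def maxwellian_free_transport unfolding c1_def kernel_rescale[OF \<tau>] ..
  also have "(LINT v|lborel. complex_of_real (maxwellian v) * integral {0..t} (\<lambda>u. E v (t - u) * (P u / complex_of_real \<tau>)))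
     = integral {0..t} (\<lambda>u. complex_of_real (relaxation_kernel (\<tau> * norm k) ((t - u) / \<tau>)) * (P u / complex_of_real \<tau>))"
    unfolding E_def maxwellian_duhamel_mass(2)[OF P' c1] unfolding c1_def kernel_rescale[OF \<tau>] ..
  finally show "(LINT v|lborel. F v) = c * complex_of_real (relaxation_kernel (\<tau> * norm k) (t / \<tau>))
      + integral {0..t} (\<lambda>u. complex_of_real (relaxation_kernel (\<tau> * norm k) ((t - u) / \<tau>)) * (P u / complex_of_real \<tau>))" .
qed

lemma kinetic_mode_0: "kinetic_mode \<tau> k c r v 0 = c * complex_of_real (maxwellian v)"
  by (simp add: kinetic_mode_def)

lemma kinetic_mode_mass:
  fixes k :: "real ^ 'd"
  assumes r: "relaxation_profile (\<tau> * norm k) r" and \<tau>: "0 < \<tau>" and t: "0 \<le> t"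
  shows "integrable lborel (\<lambda>v. kinetic_mode \<tau> k c r v t)"
    and "(LINT v|lborel. kinetic_mode \<tau> k c r v t) = c * complex_of_real (r (t / \<tau>))"
proof -
  let ?K = "relaxation_kernel (\<tau> * norm k)"
  have cr: "continuous_on UNIV r" using r by (simp add: relaxation_profile_def)
  have P: "continuous_on UNIV (\<lambda>u. c * complex_of_real (r (u / \<tau>)))"
    by (intro continuous_intros continuous_on_compose2[OF cr]) (use \<tau> in auto)
  show "integrable lborel (\<lambda>v. kinetic_mode \<tau> k c r v t)"
    unfolding kinetic_mode_def by (rule duhamel_mass(1)[OF P \<tau> t])
  have "((\<lambda>u. ?K ((t - u) / \<tau>) * r (u / \<tau>)) has_integral \<tau> * volterra_conv ?K r (t / \<tau>)) {0..t}"
    unfolding volterra_rescale[OF \<tau>, of t ?K r, symmetric]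
    by (intro integrable_integral integrable_continuous_real continuous_intros continuous_on_compose2[OF cr]) (use \<tau> in auto)
  from has_integral_mult_right[OF has_integral_of_real[OF this], of "c / complex_of_real \<tau>"]
  have i: "((\<lambda>u. complex_of_real (?K ((t - u) / \<tau>)) * (c * complex_of_real (r (u / \<tau>)) / complex_of_real \<tau>)) has_integral
      c * complex_of_real (volterra_conv ?K r (t / \<tau>))) {0..t}"
    using \<tau> by (simp add: mult_ac)
  have "(LINT v|lborel. kinetic_mode \<tau> k c r v t)
      = c * complex_of_real (?K (t / \<tau>)) + c * complex_of_real (volterra_conv ?K r (t / \<tau>))"
    unfolding kinetic_mode_def duhamel_mass(2)[OF P \<tau> t] integral_unique[OF i] ..
  also have "\<dots> = c * complex_of_real (r (t / \<tau>))"
    using r \<tau> t by (simp add: relaxation_profile_def distrib_left)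
  finally show "(LINT v|lborel. kinetic_mode \<tau> k c r v t) = c * complex_of_real (r (t / \<tau>))" .
qed

lemma kinetic_mode_has_derivative:
  assumes r: "relaxation_profile b r" and \<tau>: "0 < \<tau>" and t: "0 \<le> t"
  shows "(kinetic_mode \<tau> k c r v has_vector_derivative
     - \<i> * complex_of_real (k \<bullet> v) * kinetic_mode \<tau> k c r v t
     - 1 / complex_of_real \<tau> * (kinetic_mode \<tau> k c r v t
         - c * complex_of_real (r (t / \<tau>)) * complex_of_real (maxwellian v))) (at t within {0..})"
proof -
  have cr: "continuous_on UNIV r" using r by (simp add: relaxation_profile_def)
  have g: "continuous_on {0..} (\<lambda>u. c * complex_of_real (r (u / \<tau>)) / complex_of_real \<tau> * complex_of_real (maxwellian v))"
    by (intro continuous_intros continuous_on_compose2[OF cr]) (use \<tau> in auto)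
  have "(kinetic_mode \<tau> k c r v has_vector_derivative
      - (complex_of_real (1 / \<tau>) + \<i> * complex_of_real (k \<bullet> v)) * kinetic_mode \<tau> k c r v t
      + c * complex_of_real (r (t / \<tau>)) / complex_of_real \<tau> * complex_of_real (maxwellian v)) (at t within {0..})"
    using duhamel_solves[OF g t, of "complex_of_real (1 / \<tau>) + \<i> * complex_of_real (k \<bullet> v)" "c * complex_of_real (maxwellian v)"]
    unfolding kinetic_mode_def[abs_def] .
  moreover have "- (complex_of_real (1 / \<tau>) + x) * z + w / complex_of_real \<tau> * n
     = - x * z - 1 / complex_of_real \<tau> * (z - w * n)" for x z w n
    using \<tau> by (simp add: field_simps)
  ultimately show ?thesis by (simp only: mult_minus_left)
qed

definition cosine_coeff :: "real \<Rightarrow> int ^ 'd \<Rightarrow> int ^ 'd \<Rightarrow> complex" where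
  "cosine_coeff A k\<^sub>0 k = fourier_coeff (\<lambda>x. 2 * A * cos (wavevec k\<^sub>0 \<bullet> x)) k"

lemma fourier_coeff_cosine_data:
  fixes k k\<^sub>0 :: "int ^ 'd"
  shows "fourier_coeff (\<lambda>x. cosine_data A k\<^sub>0 x v) k = cosine_coeff A k\<^sub>0 k * complex_of_real (maxwellian v)"
proof -
  have "indicator S x *\<^sub>R (complex_of_real (2 * A * cos \<theta> * m) * e)
      = (indicator S x *\<^sub>R (complex_of_real (2 * A * cos \<theta>) * e)) * complex_of_real m"
    for S and x :: "real ^ 'd" and \<theta> m e
    by simp
  then show ?thesis
    unfolding fourier_coeff_def cosine_coeff_def cosine_data_def set_lebesgue_integral_def
    by (simp only: integral_mult_left_zero times_divide_eq_left)
qed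

lemma set_integrable_torus:
  fixes f :: "real ^ 'd \<Rightarrow> complex"
  assumes "continuous_on UNIV f"
  shows "set_integrable lborel (cbox 0 (vec (2 * pi))) f"
  unfolding set_integrable_def
  by (rule borel_integrable_compact) (auto intro: continuous_on_subset[OF assms])

text \<open>The real part of the coefficient at \<open>k\<close> itself is a positive multiple of the integral of
  \<open>cos\<^sup>2 (k \<bullet> x)\<close>, which is positive by continuity for every \<open>k\<close>, including 0.\<close>

lemma cosine_coeff_nonzero:
  assumes "A > 0" shows "cosine_coeff A k k \<noteq> 0"
proof
  assume z: "cosine_coeff A k k = 0"
  let ?B = "cbox 0 (vec (2 * pi)) :: (real ^ 'a) set"
  let ?f = "\<lambda>x::real ^ 'a. complex_of_real (2 * A * cos (wavevec k \<bullet> x)) * exp (- \<i> * complex_of_real (wavevec k \<bullet> x))"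
  let ?g = "\<lambda>x::real ^ 'a. 2 * A * (cos (wavevec k \<bullet> x))\<^sup>2"
  have int: "set_integrable lborel ?B ?f" by (intro set_integrable_torus continuous_intros)
  have eq1: "(LINT x:?B|lborel. ?f x) = 0" using z by (simp add: cosine_coeff_def fourier_coeff_def)
  have eq2: "Re (LINT x:?B|lborel. ?f x) = (LINT x:?B|lborel. ?g x)"
    using int unfolding set_integrable_def set_lebesgue_integral_def
    by (subst integral_Re[symmetric]) (auto simp: Re_exp power2_eq_square mult.assoc intro!: Bochner_Integration.integral_cong)
  have cg: "continuous_on S ?g" for S by (intro continuous_intros)
  have intg: "set_integrable lborel ?B ?g"
    unfolding set_integrable_def by (rule borel_integrable_compact) (auto intro: cg)
  have "integral ?B ?g = 0"
    by (simp only: set_borel_integral_eq_integral(2)[OF intg, symmetric] eq2[symmetric] eq1 zero_complex.sel)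
  then have "(?g has_integral 0) ?B"
    using integrable_integral[OF integrable_continuous[OF cg]] by metis
  then have "?g 0 = 0"
  proof (rule has_integral_0_cbox_imp_0[OF cg, rotated])
    show "box 0 (vec (2 * pi)) \<noteq> ({} :: (real ^ 'a) set)"
      by (auto simp: box_ne_empty inner_axis Basis_vec_def)
    show "(0::real ^ 'a) \<in> ?B" by (auto simp: mem_box Basis_vec_def inner_axis)
  qed (use assms in auto)
  with assms show False by simp
qed

lemma bgk_fourier_solution_exists:
  assumes "0 < \<tau>"
  shows "\<exists>fh. bgk_fourier_solution \<tau> (cosine_data A (k\<^sub>0 :: int ^ 'd)) fh"
proof -
  obtain R where R: "\<And>b. relaxation_profile b (R b)"
    using relaxation_solution_exists unfolding relaxation_profile_def by metis
  define fh where "fh k = kinetic_mode \<tau> (wavevec k) (cosine_coeff A k\<^sub>0 k) (R (\<tau> * norm (wavevec k)))" for k :: "int ^ 'd"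
  have mass: "mass_density (fh k) t = cosine_coeff A k\<^sub>0 k * complex_of_real (R (\<tau> * norm (wavevec k)) (t / \<tau>))"
    if "0 \<le> t" for k t
    unfolding mass_density_def fh_def by (rule kinetic_mode_mass(2)[OF R assms that])
  have "mass_density (fh k) differentiable (at t within {0..})" if t: "0 \<le> t" for k t
  proof (rule differentiable_transform_within[where d = 1])
    obtain d where "((\<lambda>t. R (\<tau> * norm (wavevec k)) (t / \<tau>)) has_real_derivative d) (at t within {0..})"
      using relaxation_profile_scaled_differentiable[OF R assms t] by blast
    then show "(\<lambda>t. cosine_coeff A k\<^sub>0 k * complex_of_real (R (\<tau> * norm (wavevec k)) (t / \<tau>)))
        differentiable (at t within {0..})"
      by (intro differentiableI_vector[OF has_vector_derivative_mult_right[OF has_vector_derivative_of_real]])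
         (simp add: has_real_derivative_iff_has_vector_derivative)
  qed (use t mass in auto)
  then have "bgk_fourier_solution \<tau> (cosine_data A k\<^sub>0) fh"
    unfolding bgk_fourier_solution_def fourier_coeff_cosine_data
    using kinetic_mode_mass(1)[OF R assms] kinetic_mode_has_derivative[OF R assms] mass
    by (auto simp: fh_def kinetic_mode_0)
  then show ?thesis by blast
qed

text \<open>Uniqueness of the density. The real and imaginary parts of the rescaled density satisfy the
  Volterra equation with real inhomogeneities, and the difference to the corresponding multiple of
  \<open>r\<close> solves the homogeneous equation.\<close>

lemma bgk_fourier_solution_mass:
  fixes k :: "int ^ 'd"
  assumes sol: "bgk_fourier_solution \<tau> (cosine_data A k\<^sub>0) fh" and \<tau>: "0 < \<tau>"
    and r: "relaxation_profile (\<tau> * norm (wavevec k)) r" and t: "0 \<le> t"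
  shows "mass_density (fh k) t = cosine_coeff A k\<^sub>0 k * complex_of_real (r (t / \<tau>))"
proof -
  define c where "c = cosine_coeff A k\<^sub>0 k"
  define b where "b = \<tau> * norm (wavevec k)"
  define P where "P t = mass_density (fh k) (max 0 t)" for t
  let ?K = "relaxation_kernel b"
  have cr: "continuous_on UNIV r" and r_eq: "\<And>s. 0 \<le> s \<Longrightarrow> r s = ?K s + volterra_conv ?K r s"
    using r by (auto simp: relaxation_profile_def b_def)
  have P: "continuous_on UNIV P"
  proof -
    have "continuous_on {0..} (mass_density (fh k))"
      using sol unfolding bgk_fourier_solution_def continuous_on_eq_continuous_within
      by (auto intro: differentiable_imp_continuous_within)
    moreover have "continuous_on UNIV (\<lambda>s::real. max 0 s)" by (intro continuous_intros)
    ultimately show ?thesis unfolding P_def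
      using continuous_on_compose2[of "{0..}" "mass_density (fh k)" UNIV "max 0"] by (auto simp: image_subset_iff)
  qed
  have P_eq: "P t = c * complex_of_real (?K (t / \<tau>))
      + integral {0..t} (\<lambda>u. complex_of_real (?K ((t - u) / \<tau>)) * (P u / complex_of_real \<tau>))"
    if t: "0 \<le> t" for t
  proof -
    have "fh k v t = exp (- (complex_of_real (1 / \<tau>) + \<i> * complex_of_real (wavevec k \<bullet> v)) * complex_of_real t) * (c * complex_of_real (maxwellian v))
     + integral {0..t} (\<lambda>u. exp (- (complex_of_real (1 / \<tau>) + \<i> * complex_of_real (wavevec k \<bullet> v)) * complex_of_real (t - u))
         * (P u / complex_of_real \<tau> * complex_of_real (maxwellian v)))" for v
    proof -
      have d: "(fh k v has_vector_derivative - (complex_of_real (1 / \<tau>) + \<i> * complex_of_real (wavevec k \<bullet> v)) * fh k v t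
          + P t / complex_of_real \<tau> * complex_of_real (maxwellian v)) (at t within {0..})" if "0 \<le> t" for t
      proof -
        have "- x * z - 1 / complex_of_real \<tau> * (z - w * n) = - (complex_of_real (1 / \<tau>) + x) * z + w / complex_of_real \<tau> * n" for x z w n
          using \<tau> by (simp add: field_simps)
        moreover have "(fh k v has_vector_derivative
           - \<i> * complex_of_real (wavevec k \<bullet> v) * fh k v t
           - 1 / complex_of_real \<tau> * (fh k v t - P t * complex_of_real (maxwellian v))) (at t within {0..})"
          using sol that by (simp add: bgk_fourier_solution_def P_def)
        ultimately show ?thesis by (simp only: mult_minus_left)
      qed
      have "fh k v 0 = c * complex_of_real (maxwellian v)"
        using sol by (simp add: bgk_fourier_solution_def fourier_coeff_cosine_data c_def)
      with duhamel_formula[OF d t] show ?thesis by simp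
    qed
    then have "P t = (LINT v|lborel. exp (- (complex_of_real (1 / \<tau>) + \<i> * complex_of_real (wavevec k \<bullet> v)) * complex_of_real t) * (c * complex_of_real (maxwellian v))
     + integral {0..t} (\<lambda>u. exp (- (complex_of_real (1 / \<tau>) + \<i> * complex_of_real (wavevec k \<bullet> v)) * complex_of_real (t - u))
         * (P u / complex_of_real \<tau> * complex_of_real (maxwellian v))))"
      using t by (simp add: P_def mass_density_def)
    also note duhamel_mass(2)[OF P \<tau> t, of "wavevec k" c, folded b_def]
    finally show ?thesis .
  qed
  have part: "L (P t) = L c * r (t / \<tau>)" if L: "bounded_linear L" for L :: "complex \<Rightarrow> real"
  proof -
    interpret L: bounded_linear L by fact
    have cLP: "continuous_on UNIV (\<lambda>s. L (P (\<tau> * s)))"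
      by (intro L.continuous_on continuous_on_compose2[OF P] continuous_intros) auto
    have LP: "L (P (\<tau> * s)) = L c * ?K s + volterra_conv ?K (\<lambda>s. L (P (\<tau> * s))) s" if s: "0 \<le> s" for s
    proof -
      let ?F = "\<lambda>u. complex_of_real (?K ((\<tau> * s - u) / \<tau>)) * (P u / complex_of_real \<tau>)"
      have int: "?F integrable_on {0..\<tau> * s}"
        by (intro integrable_continuous_real continuous_intros continuous_on_subset[OF P]) (use \<tau> in auto)
      have scale: "complex_of_real a * (z / complex_of_real \<tau>) = (a / \<tau>) *\<^sub>R z" for a z
        by (simp add: scaleR_conv_of_real)
      have scale': "z * complex_of_real a = a *\<^sub>R z" for a z
        by (simp add: scaleR_conv_of_real mult.commute)
      have "L (integral {0..\<tau> * s} ?F) = integral {0..\<tau> * s} (\<lambda>u. L (?F u))"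
        using integral_linear[OF int L] by (simp add: o_def)
      also have "\<dots> = integral {0..\<tau> * s} (\<lambda>u. 1 / \<tau> * (?K ((\<tau> * s - u) / \<tau>) * L (P (\<tau> * (u / \<tau>)))))"
        unfolding scale using \<tau> by (simp add: L.scaleR)
      also have "\<dots> = 1 / \<tau> * (\<tau> * volterra_conv ?K (\<lambda>s. L (P (\<tau> * s))) (\<tau> * s / \<tau>))"
        by (simp only: integral_mult_right volterra_rescale[OF \<tau>, of "\<tau> * s" ?K "\<lambda>s. L (P (\<tau> * s))"])
      finally have "L (integral {0..\<tau> * s} ?F) = volterra_conv ?K (\<lambda>s. L (P (\<tau> * s))) s" using \<tau> by simp
      moreover have "0 \<le> \<tau> * s" using \<tau> s by simp
      ultimately show ?thesis using \<tau> by (subst P_eq) (simp_all add: L.add scale' L.scaleR mult.commute)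
    qed
    have "1 * L (P (\<tau> * (t / \<tau>))) + (- L c) * r (t / \<tau>) = 0"
    proof (rule relaxation_homogeneous_zero[where u = "\<lambda>s. 1 * L (P (\<tau> * s)) + (- L c) * r s" and b = b])
      show "continuous_on UNIV (\<lambda>s. 1 * L (P (\<tau> * s)) + (- L c) * r s)" by (intro continuous_intros cLP cr)
      fix s :: real assume s: "0 \<le> s"
      have cK: "continuous_on UNIV ?K" by (intro continuous_intros)
      show "1 * L (P (\<tau> * s)) + (- L c) * r s = volterra_conv ?K (\<lambda>s. 1 * L (P (\<tau> * s)) + (- L c) * r s) s"
        unfolding volterra_conv_linear[OF cK cLP cr] using LP[OF s] r_eq[OF s] by (simp add: algebra_simps)
    qed (use t \<tau> in auto)
    then show ?thesis using \<tau> by simp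
  qed
  have "P t = c * complex_of_real (r (t / \<tau>))"
    using part[OF bounded_linear_Re] part[OF bounded_linear_Im] by (simp add: complex_eq_iff)
  then show ?thesis using t by (simp add: P_def c_def)
qed

lemma dissipation_rate_profile:
  assumes \<rho>: "\<And>t. 0 \<le> t \<Longrightarrow> \<rho> k t = c * complex_of_real (r (t / \<tau>))" and c: "c \<noteq> 0"
    and \<tau>: "0 < \<tau>" and t: "0 < t" and d: "(r has_real_derivative d) (at (t / \<tau>) within {0..})"
  shows "dissipation_rate \<rho> k t = complex_of_real (- (d / r (t / \<tau>)) / \<tau>)"
proof -
  have "0 < t / \<tau>" using t \<tau> by simp
  then have w: "at (t / \<tau>) within {0..} = at (t / \<tau>)"
    by (intro at_within_interior) (simp add: interior_real_atLeast)
  have "((\<lambda>t. r (t / \<tau>)) has_real_derivative d * (1 / \<tau>)) (at t)"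
    by (rule DERIV_chain2[where f = r and g = "\<lambda>t. t / \<tau>", OF d[unfolded w]]) (use \<tau> in \<open>auto intro!: derivative_eq_intros\<close>)
  then have "((\<lambda>t. c * complex_of_real (r (t / \<tau>))) has_vector_derivative c * complex_of_real (d * (1 / \<tau>))) (at t)"
    by (intro has_vector_derivative_mult_right has_vector_derivative_of_real)
       (simp add: has_real_derivative_iff_has_vector_derivative)
  then have "(\<rho> k has_vector_derivative c * complex_of_real (d * (1 / \<tau>))) (at t)"
    by (rule has_vector_derivative_transform_within[where d = t]) (use t \<rho> in \<open>auto simp: dist_real_def\<close>)
  from vector_derivative_at[OF this] show ?thesis
    using \<rho>[of t] t c by (simp add: dissipation_rate_def)
qed

lemma dissipation_rate_expansion:
  assumes \<rho>: "\<And>t. 0 \<le> t \<Longrightarrow> \<rho> k t = c * complex_of_real (r (t / \<tau>))" and c: "c \<noteq> 0"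
    and \<tau>: "0 < \<tau>" and t: "0 < t" and r: "relaxation_profile b r" and b: "0 < b"
  shows "\<exists>e. dissipation_rate \<rho> k t = complex_of_real ((decay_rate b + e) / \<tau>) \<and>
     \<bar>e\<bar> \<le> decay_const b * exp (- (t / \<tau>) / 2)"
proof -
  have "0 \<le> t / \<tau>" using t \<tau> by simp
  from relaxation_profile_rate[OF r b this] obtain d where
    d: "(r has_real_derivative d) (at (t / \<tau>) within {0..})"
    and bd: "\<bar>d / r (t / \<tau>) + decay_rate b\<bar> \<le> decay_const b * exp (- (t / \<tau>) / 2)" by blast
  show ?thesis
  proof (intro exI conjI)
    show "dissipation_rate \<rho> k t = complex_of_real ((decay_rate b + (- (d / r (t / \<tau>) + decay_rate b))) / \<tau>)"
      using dissipation_rate_profile[where \<rho> = \<rho> and k = k and r = r, OF \<rho> c \<tau> t d] by simp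
    show "\<bar>- (d / r (t / \<tau>) + decay_rate b)\<bar> \<le> decay_const b * exp (- (t / \<tau>) / 2)"
      using bd by simp
  qed
qed

lemma decay_const_mono: "0 \<le> b \<Longrightarrow> b \<le> C \<Longrightarrow> decay_const b \<le> decay_const C"
  unfolding decay_const_def
  by (intro mult_mono mult_nonneg_nonneg add_mono) (auto intro: power_mono)

section \<open>The two scaling regimes\<close>

text \<open>At a fixed time \<open>t > 0\<close> the initial layer is exponentially small in \<open>1 / \<tau>\<close>, hence negligible
  against every power of \<open>\<tau>\<close>.\<close>

lemma exp_layer_tendsto_0:
  fixes t c :: real
  assumes "0 < t"
  shows "((\<lambda>\<tau>. c * exp (- (t / \<tau>) / 2)) \<longlongrightarrow> 0) (at_right 0)"
    and "((\<lambda>\<tau>. c * exp (- (t / \<tau>) / 2) / \<tau>\<^sup>2) \<longlongrightarrow> 0) (at_right 0)"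
proof -
  have 1: "((\<lambda>\<tau>::real. exp (- (t / \<tau>) / 2)) \<longlongrightarrow> 0) (at_right 0)" using assms by real_asymp
  show "((\<lambda>\<tau>. c * exp (- (t / \<tau>) / 2)) \<longlongrightarrow> 0) (at_right 0)"
    using tendsto_mult[OF tendsto_const 1, of c] by simp
  have 2: "((\<lambda>\<tau>::real. exp (- (t / \<tau>) / 2) / \<tau>\<^sup>2) \<longlongrightarrow> 0) (at_right 0)" using assms by real_asymp
  show "((\<lambda>\<tau>. c * exp (- (t / \<tau>) / 2) / \<tau>\<^sup>2) \<longlongrightarrow> 0) (at_right 0)"
    using tendsto_mult[OF tendsto_const 2, of c] by simp
qed

text \<open>The complex number \<open>z\<close> is the limiting rate \<open>decay_rate b / \<tau>\<close> up to the contribution \<open>e\<close> of the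
  initial layer, measured in units of \<open>1 / \<tau>\<close>.\<close>

definition has_expansion :: "real \<Rightarrow> real \<Rightarrow> real \<Rightarrow> complex \<Rightarrow> real \<Rightarrow> bool" where
  "has_expansion t \<tau> b z e \<longleftrightarrow> z = complex_of_real ((decay_rate b + e) / \<tau>) \<and>
     \<bar>e\<bar> \<le> decay_const b * exp (- (t / \<tau>) / 2)"

text \<open>The relative error is \<open>(m - 1) + e / b\<^sup>2\<close> with \<open>b = \<tau> \<kappa>\<close>. The first term is of order \<open>b\<^sup>2\<close>, the second
  one an initial layer divided by \<open>\<tau>\<^sup>2 \<kappa>\<^sup>2\<close>.\<close>

lemma hydrodynamic_asymptotics:
  fixes \<kappa> :: real
  assumes "0 < \<kappa>" "0 < t"
    and ev: "\<forall>\<^sub>F \<tau> in at_right 0. \<exists>e. has_expansion t \<tau> (\<tau> * \<kappa>) (\<Delta> \<tau>) e"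
  shows "\<Delta> \<sim>[at_right 0] (\<lambda>\<tau>. complex_of_real (\<tau> * \<kappa>\<^sup>2))"
proof (rule asymp_equivI')
  have pos: "\<forall>\<^sub>F \<tau> in at_right 0. 0 < \<tau> \<and> \<tau> < (1::real)"
    using eventually_at_right_real[of 0 1] by (auto elim: eventually_mono)
  define err where "err \<tau> = 3 * \<kappa>\<^sup>2 * \<tau>\<^sup>2 + decay_const \<kappa> / \<kappa>\<^sup>2 * exp (- (t / \<tau>) / 2) / \<tau>\<^sup>2" for \<tau>
  have "((\<lambda>\<tau>::real. 3 * \<kappa>\<^sup>2 * \<tau>\<^sup>2) \<longlongrightarrow> 3 * \<kappa>\<^sup>2 * 0\<^sup>2) (at_right 0)"
    by (intro tendsto_intros)
  from tendsto_add[OF this exp_layer_tendsto_0(2)[OF \<open>0 < t\<close>, of "decay_const \<kappa> / \<kappa>\<^sup>2"]]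
  have err: "(err \<longlongrightarrow> 0) (at_right 0)" by (simp add: err_def[abs_def])
  have "\<forall>\<^sub>F \<tau> in at_right 0. norm (\<Delta> \<tau> / complex_of_real (\<tau> * \<kappa>\<^sup>2) - 1) \<le> err \<tau>"
    using ev pos
  proof eventually_elim
    case (elim \<tau>)
    then obtain e where e: "\<Delta> \<tau> = complex_of_real ((decay_rate (\<tau> * \<kappa>) + e) / \<tau>)"
      "\<bar>e\<bar> \<le> decay_const (\<tau> * \<kappa>) * exp (- (t / \<tau>) / 2)" by (auto simp: has_expansion_def)
    have b: "0 < \<tau> * \<kappa>" using elim assms by simp
    have "\<tau> * \<kappa> \<le> 1 * \<kappa>" using elim assms by (intro mult_right_mono) auto
    then have "decay_const (\<tau> * \<kappa>) * exp (- (t / \<tau>) / 2) \<le> decay_const \<kappa> * exp (- (t / \<tau>) / 2)"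
      using b by (intro mult_right_mono decay_const_mono) auto
    with e(2) have e': "\<bar>e\<bar> \<le> decay_const \<kappa> * exp (- (t / \<tau>) / 2)" by linarith
    define q where "q = (\<tau> * \<kappa>)\<^sup>2"
    have q: "0 < q" unfolding q_def using b by (rule zero_less_power)
    have q_eq: "q = \<tau>\<^sup>2 * \<kappa>\<^sup>2" by (simp add: q_def power_mult_distrib)
    have "\<Delta> \<tau> / complex_of_real (\<tau> * \<kappa>\<^sup>2) - 1 = complex_of_real ((decay_rate (\<tau> * \<kappa>) + e) / q - 1)"
      using elim unfolding e(1) q_eq by (simp add: power2_eq_square mult.assoc)
    then have "norm (\<Delta> \<tau> / complex_of_real (\<tau> * \<kappa>\<^sup>2) - 1) = \<bar>(decay_rate (\<tau> * \<kappa>) - q) / q + e / q\<bar>"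
      using q by (simp add: norm_of_real add_divide_distrib diff_divide_distrib del: of_real_diff of_real_add of_real_divide)
    also have "\<dots> \<le> \<bar>(decay_rate (\<tau> * \<kappa>) - q) / q\<bar> + \<bar>e / q\<bar>" by (rule abs_triangle_ineq)
    also have "\<bar>(decay_rate (\<tau> * \<kappa>) - q) / q\<bar> \<le> 3 * q"
    proof -
      have "q * (1 - 3 * q) \<le> decay_rate (\<tau> * \<kappa>)" "decay_rate (\<tau> * \<kappa>) \<le> q"
        using decay_rate_bounds[OF b] by (simp_all add: q_def)
      then have "\<bar>decay_rate (\<tau> * \<kappa>) - q\<bar> \<le> 3 * q * q" by (simp add: algebra_simps abs_le_iff)
      then show ?thesis using q by (simp add: abs_divide pos_divide_le_eq)
    qed
    also have "\<bar>e / q\<bar> \<le> decay_const \<kappa> / \<kappa>\<^sup>2 * exp (- (t / \<tau>) / 2) / \<tau>\<^sup>2"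
    proof -
      have "\<bar>e / q\<bar> \<le> decay_const \<kappa> * exp (- (t / \<tau>) / 2) / q"
        using e' q by (simp add: abs_divide divide_right_mono)
      then show ?thesis by (simp add: q_eq mult.commute)
    qed
    finally show ?case by (simp add: err_def q_eq mult_ac)
  qed
  then have "((\<lambda>\<tau>. \<Delta> \<tau> / complex_of_real (\<tau> * \<kappa>\<^sup>2) - 1) \<longlongrightarrow> 0) (at_right 0)"
    by (rule Lim_null_comparison[OF _ err])
  then show "((\<lambda>\<tau>. \<Delta> \<tau> / complex_of_real (\<tau> * \<kappa>\<^sup>2)) \<longlongrightarrow> 1) (at_right 0)"
    by (simp add: LIM_zero_iff)
qed

lemma sqrt_half_pi_pos: "0 < sqrt (pi / 2)"
  by simp

text \<open>For \<open>b \<ge> sqrt (\<pi> / 2)\<close> the rate \<open>decay_rate b\<close> lies between 1 and \<open>b\<^sup>2\<close>, so the relative error is at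
  most the initial layer \<open>e\<close> itself. The upper bound \<open>C\<close> makes the estimate of \<open>e\<close> uniform.\<close>

lemma kinetic_asymptotics:
  fixes F :: "real filter"
  assumes F: "F \<le> at_right 0" and t: "0 < t"
    and ev: "\<forall>\<^sub>F \<tau> in F. sqrt (pi / 2) \<le> \<beta> \<tau> \<and> \<beta> \<tau> \<le> C \<and> (\<exists>e. has_expansion t \<tau> (\<beta> \<tau>) (\<Delta> \<tau>) e)"
  shows "\<Delta> \<sim>[F] (\<lambda>\<tau>. complex_of_real (decay_rate (\<beta> \<tau>) / \<tau>))"
    and "\<forall>\<^sub>F \<tau> in F. 1 / 2 * norm (complex_of_real (1 / \<tau>)) \<le> norm (\<Delta> \<tau>) \<and>
       norm (\<Delta> \<tau>) \<le> (C\<^sup>2 + 1) * norm (complex_of_real (1 / \<tau>))"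
proof -
  have pos: "\<forall>\<^sub>F \<tau> in F. 0 < \<tau>"
    using F eventually_at_right_less[of "0::real"] by (rule filter_leD)
  have lim: "((\<lambda>\<tau>. decay_const C * exp (- (t / \<tau>) / 2)) \<longlongrightarrow> 0) F"
    using exp_layer_tendsto_0(1)[OF t] F by (rule filterlim_mono[OF _ order_refl])
  have small: "\<forall>\<^sub>F \<tau> in F. decay_const C * exp (- (t / \<tau>) / 2) < 1/2"
    using order_tendstoD(2)[OF lim, of "1/2"] by simp
  have key: "\<exists>e. \<Delta> \<tau> = complex_of_real ((decay_rate (\<beta> \<tau>) + e) / \<tau>) \<and> 1 \<le> decay_rate (\<beta> \<tau>)
      \<and> decay_rate (\<beta> \<tau>) \<le> C\<^sup>2 \<and> \<bar>e\<bar> \<le> decay_const C * exp (- (t / \<tau>) / 2)"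
    if "sqrt (pi / 2) \<le> \<beta> \<tau> \<and> \<beta> \<tau> \<le> C \<and> (\<exists>e. has_expansion t \<tau> (\<beta> \<tau>) (\<Delta> \<tau>) e)" for \<tau>
  proof -
    from that obtain e where e: "\<Delta> \<tau> = complex_of_real ((decay_rate (\<beta> \<tau>) + e) / \<tau>)"
      "\<bar>e\<bar> \<le> decay_const (\<beta> \<tau>) * exp (- (t / \<tau>) / 2)" by (auto simp: has_expansion_def)
    have b: "0 < \<beta> \<tau>" using that sqrt_half_pi_pos by linarith
    have "decay_const (\<beta> \<tau>) * exp (- (t / \<tau>) / 2) \<le> decay_const C * exp (- (t / \<tau>) / 2)"
      using b that by (intro mult_right_mono decay_const_mono) auto
    with e(2) have "\<bar>e\<bar> \<le> decay_const C * exp (- (t / \<tau>) / 2)" by linarith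
    moreover have "(\<beta> \<tau>)\<^sup>2 \<le> C\<^sup>2" using b that by (intro power_mono) auto
    ultimately show ?thesis
      using e(1) decay_rate_ge_1[of "\<beta> \<tau>"] decay_rate_bounds(1)[OF b] that by (intro exI[of _ e]) auto
  qed
  show "\<forall>\<^sub>F \<tau> in F. 1 / 2 * norm (complex_of_real (1 / \<tau>)) \<le> norm (\<Delta> \<tau>) \<and>
       norm (\<Delta> \<tau>) \<le> (C\<^sup>2 + 1) * norm (complex_of_real (1 / \<tau>))"
    using ev pos small
  proof eventually_elim
    case (elim \<tau>)
    from key[OF elim(1)] obtain e where e: "\<Delta> \<tau> = complex_of_real ((decay_rate (\<beta> \<tau>) + e) / \<tau>)"
      "1 \<le> decay_rate (\<beta> \<tau>)" "decay_rate (\<beta> \<tau>) \<le> C\<^sup>2" "\<bar>e\<bar> < 1/2" using elim(3) by fastforce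
    have n: "norm (\<Delta> \<tau>) = (decay_rate (\<beta> \<tau>) + e) / \<tau>"
      using e elim(2) unfolding e(1) norm_of_real by simp
    have n1: "norm (complex_of_real (1 / \<tau>)) = 1 / \<tau>" using elim(2) unfolding norm_of_real by simp
    \<comment> \<open>The rate is at least 1 and the error at most 1/2.\<close>
    have "1/2 \<le> decay_rate (\<beta> \<tau>) + e" "decay_rate (\<beta> \<tau>) + e \<le> C\<^sup>2 + 1" using e by linarith+
    then have "(1/2) / \<tau> \<le> (decay_rate (\<beta> \<tau>) + e) / \<tau>" "(decay_rate (\<beta> \<tau>) + e) / \<tau> \<le> (C\<^sup>2 + 1) / \<tau>"
      using elim(2) by (intro divide_right_mono; simp)+
    then show ?case unfolding n n1 by simp
  qed
  show "\<Delta> \<sim>[F] (\<lambda>\<tau>. complex_of_real (decay_rate (\<beta> \<tau>) / \<tau>))"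
  proof (rule asymp_equivI')
    have "\<forall>\<^sub>F \<tau> in F. norm (\<Delta> \<tau> / complex_of_real (decay_rate (\<beta> \<tau>) / \<tau>) - 1)
        \<le> decay_const C * exp (- (t / \<tau>) / 2)"
      using ev pos
    proof eventually_elim
      case (elim \<tau>)
      from key[OF elim(1)] obtain e where e: "\<Delta> \<tau> = complex_of_real ((decay_rate (\<beta> \<tau>) + e) / \<tau>)"
        "1 \<le> decay_rate (\<beta> \<tau>)" "\<bar>e\<bar> \<le> decay_const C * exp (- (t / \<tau>) / 2)" by blast
      have "\<Delta> \<tau> / complex_of_real (decay_rate (\<beta> \<tau>) / \<tau>) - 1
          = complex_of_real ((decay_rate (\<beta> \<tau>) + e) / \<tau> / (decay_rate (\<beta> \<tau>) / \<tau>) - 1)"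
        unfolding e(1) by simp
      also have "(decay_rate (\<beta> \<tau>) + e) / \<tau> / (decay_rate (\<beta> \<tau>) / \<tau>) - 1 = e / decay_rate (\<beta> \<tau>)"
        using elim(2) e(2) by (simp add: field_simps)
      finally have "norm (\<Delta> \<tau> / complex_of_real (decay_rate (\<beta> \<tau>) / \<tau>) - 1) = \<bar>e\<bar> / decay_rate (\<beta> \<tau>)"
        using e(2) by (simp only: norm_of_real) (simp add: abs_divide)
      also have "\<dots> \<le> \<bar>e\<bar> / 1" using e(2) by (intro divide_left_mono) auto
      finally show ?case using e(3) by simp
    qed
    then have "((\<lambda>\<tau>. \<Delta> \<tau> / complex_of_real (decay_rate (\<beta> \<tau>) / \<tau>) - 1) \<longlongrightarrow> 0) F"
      by (rule Lim_null_comparison[OF _ lim])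
    then show "((\<lambda>\<tau>. \<Delta> \<tau> / complex_of_real (decay_rate (\<beta> \<tau>) / \<tau>)) \<longlongrightarrow> 1) F"
      by (simp add: LIM_zero_iff)
  qed
qed

text \<open>The quotient of the two candidate rates is \<open>decay_rate b / b\<^sup>2\<close>, the mean \<open>m\<close>, which stays below
  \<open>1 - 1/192\<close> for supercritical wave numbers.\<close>

lemma kinetic_not_hydrodynamic:
  fixes F :: "real filter" and \<kappa> :: "real \<Rightarrow> real"
  assumes F: "F \<le> at_right 0" "F \<noteq> bot"
    and b: "\<forall>\<^sub>F \<tau> in F. sqrt (pi / 2) \<le> \<tau> * \<kappa> \<tau>"
    and kin: "\<Delta> \<sim>[F] (\<lambda>\<tau>. complex_of_real (decay_rate (\<tau> * \<kappa> \<tau>) / \<tau>))"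
  shows "\<not> \<Delta> \<sim>[F] (\<lambda>\<tau>. complex_of_real (\<tau> * (\<kappa> \<tau>)\<^sup>2))"
proof
  assume "\<Delta> \<sim>[F] (\<lambda>\<tau>. complex_of_real (\<tau> * (\<kappa> \<tau>)\<^sup>2))"
  note asymp_equiv_trans[OF asymp_equiv_sym[THEN iffD1, OF kin] this]
  from tendsto_norm[OF asymp_equivD[OF this]]
  have lim: "((\<lambda>\<tau>. norm (if complex_of_real (decay_rate (\<tau> * \<kappa> \<tau>) / \<tau>) = 0 \<and> complex_of_real (\<tau> * (\<kappa> \<tau>)\<^sup>2) = 0
      then 1 else complex_of_real (decay_rate (\<tau> * \<kappa> \<tau>) / \<tau>) / complex_of_real (\<tau> * (\<kappa> \<tau>)\<^sup>2))) \<longlongrightarrow> 1) F"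
    by simp
  have pos: "\<forall>\<^sub>F \<tau> in F. 0 < \<tau>"
    using F(1) eventually_at_right_less[of "0::real"] by (rule filter_leD)
  have "1 \<le> 1 - 1/(192::real)"
  proof (rule tendsto_upperbound[OF lim _ F(2)])
    show "\<forall>\<^sub>F \<tau> in F. norm (if complex_of_real (decay_rate (\<tau> * \<kappa> \<tau>) / \<tau>) = 0 \<and> complex_of_real (\<tau> * (\<kappa> \<tau>)\<^sup>2) = 0
      then 1 else complex_of_real (decay_rate (\<tau> * \<kappa> \<tau>) / \<tau>) / complex_of_real (\<tau> * (\<kappa> \<tau>)\<^sup>2)) \<le> 1 - 1/192"
      using b pos
    proof eventually_elim
      case (elim \<tau>)
      have b0: "0 < \<tau> * \<kappa> \<tau>" using elim(1) sqrt_half_pi_pos by linarith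
      have "1 \<le> sqrt (pi / 2)" using pi_ge_two by simp
      with elim(1) have b1: "1 \<le> \<tau> * \<kappa> \<tau>" by linarith
      have "1 \<le> (\<tau> * \<kappa> \<tau>)\<^sup>2" using b1 by (rule one_le_power)
      note gap = decay_rate_gap[OF b0 this]
      have d1: "1 \<le> decay_rate (\<tau> * \<kappa> \<tau>)" by (rule decay_rate_ge_1[OF elim(1)])
      have "complex_of_real (decay_rate (\<tau> * \<kappa> \<tau>) / \<tau>) / complex_of_real (\<tau> * (\<kappa> \<tau>)\<^sup>2)
         = complex_of_real (decay_rate (\<tau> * \<kappa> \<tau>) / (\<tau> * \<kappa> \<tau>)\<^sup>2)"
        by (simp add: power2_eq_square mult_ac)
      also have "norm \<dots> = decay_rate (\<tau> * \<kappa> \<tau>) / (\<tau> * \<kappa> \<tau>)\<^sup>2"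
        unfolding norm_of_real using d1 by simp
      also have "\<dots> \<le> 1 - 1/192"
        using gap unfolding pos_divide_le_eq[OF zero_less_power[OF b0]] by (simp only: mult.commute)
      finally show ?case using d1 elim(2) by simp
    qed
  qed
  then show False by simp
qed

lemma tends_to_infinity_of_inverse_bound:
  fixes F :: "real filter" and \<Delta> :: "real \<Rightarrow> complex"
  assumes F: "F \<le> at_right 0" and c: "0 < c"
    and ev: "\<forall>\<^sub>F \<tau> in F. c * norm (complex_of_real (1 / \<tau>)) \<le> norm (\<Delta> \<tau>)"
  shows "filterlim \<Delta> at_infinity F"
proof -
  have "filterlim (\<lambda>\<tau>::real. c * norm (complex_of_real (1 / \<tau>))) at_top (at_right 0)"
    unfolding norm_of_real using c by real_asymp
  then have "filterlim (\<lambda>\<tau>::real. c * norm (complex_of_real (1 / \<tau>))) at_top F"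
    using F by (rule filterlim_mono[OF _ order_refl])
  then have "filterlim (\<lambda>\<tau>. norm (\<Delta> \<tau>)) at_top F" by (rule filterlim_at_top_mono) (rule ev)
  then show ?thesis by (rule filterlim_norm_at_top_imp_at_infinity)
qed

lemma bgk_fourier_solution_expansion:
  fixes k\<^sub>0 :: "int ^ 'd"
  assumes A: "A > 0" and sol: "bgk_fourier_solution \<tau> (cosine_data A k\<^sub>0) fh" and \<tau>: "0 < \<tau>" and t: "0 < t"
    and k: "0 < norm (wavevec k\<^sub>0)"
  shows "\<exists>e. has_expansion t \<tau> (\<tau> * norm (wavevec k\<^sub>0)) (dissipation_rate (\<lambda>k. mass_density (fh k)) k\<^sub>0 t) e"
proof -
  obtain r where r: "relaxation_profile (\<tau> * norm (wavevec k\<^sub>0)) r"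
    using relaxation_solution_exists unfolding relaxation_profile_def by metis
  show ?thesis unfolding has_expansion_def
    by (rule dissipation_rate_expansion[where \<rho> = "\<lambda>k. mass_density (fh k)" and k = "k\<^sub>0",
          OF bgk_fourier_solution_mass[OF sol \<tau> r] cosine_coeff_nonzero[OF A] \<tau> t r])
       (use \<tau> k in auto)
qed

lemma bgk_fourier_solution_constant:
  fixes k\<^sub>0 :: "int ^ 'd"
  assumes A: "A > 0" and sol: "bgk_fourier_solution \<tau> (cosine_data A k\<^sub>0) fh" and \<tau>: "0 < \<tau>" and t: "0 < t"
    and k: "norm (wavevec k\<^sub>0) = 0"
  shows "dissipation_rate (\<lambda>k. mass_density (fh k)) k\<^sub>0 t = 0"
proof -
  have r: "relaxation_profile (\<tau> * norm (wavevec k\<^sub>0)) (\<lambda>_. 1)"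
    using relaxation_profile_0 k by simp
  have "dissipation_rate (\<lambda>k. mass_density (fh k)) k\<^sub>0 t = complex_of_real (- (0 / 1) / \<tau>)"
    by (rule dissipation_rate_profile[where \<rho> = "\<lambda>k. mass_density (fh k)" and k = "k\<^sub>0" and r = "\<lambda>_. 1",
          OF bgk_fourier_solution_mass[OF sol \<tau> r] cosine_coeff_nonzero[OF A] \<tau> t]) auto
  then show ?thesis by simp
qed

lemma critical_wave_number_le_iff:
  "0 < \<tau> \<Longrightarrow> critical_wave_number \<tau> \<le> \<kappa> \<longleftrightarrow> sqrt (pi / 2) \<le> \<tau> * \<kappa>"
  by (simp add: critical_wave_number_def pos_divide_le_eq mult.commute)

lemma hydrodynamic_regime:
  fixes k\<^sub>0 :: "int ^ 'd"
  assumes A: "A > 0" and t: "0 < t"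
    and sol: "\<And>\<tau>. 0 < \<tau> \<Longrightarrow> norm (wavevec k\<^sub>0) < critical_wave_number \<tau> \<Longrightarrow>
       bgk_fourier_solution \<tau> (cosine_data A k\<^sub>0) (fh \<tau>)"
  shows "(\<lambda>\<tau>. dissipation_rate (\<lambda>k. mass_density (fh \<tau> k)) k\<^sub>0 t)
            \<sim>[at_right 0] (\<lambda>\<tau>. complex_of_real (\<tau> * (norm (wavevec k\<^sub>0))\<^sup>2))"
proof (cases "norm (wavevec k\<^sub>0) = 0")
  case True
  have "\<forall>\<^sub>F \<tau> in at_right 0. dissipation_rate (\<lambda>k. mass_density (fh \<tau> k)) k\<^sub>0 t
      = complex_of_real (\<tau> * (norm (wavevec k\<^sub>0))\<^sup>2)"
    using eventually_at_right_less[of "0::real"]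
  proof eventually_elim
    case (elim \<tau>)
    have "norm (wavevec k\<^sub>0) < critical_wave_number \<tau>"
      unfolding True critical_wave_number_def using elim by simp
    from bgk_fourier_solution_constant[OF A sol[OF elim this] elim t True] show ?case by (simp add: True)
  qed
  then show ?thesis by (rule asymp_equiv_refl_ev)
next
  case False
  then have \<kappa>: "0 < norm (wavevec k\<^sub>0)" by simp
  show ?thesis
  proof (rule hydrodynamic_asymptotics[OF \<kappa> t])
    have "0 < sqrt (pi / 2) / norm (wavevec k\<^sub>0)" using \<kappa> by simp
    from eventually_at_right_real[OF this]
    show "\<forall>\<^sub>F \<tau> in at_right 0. \<exists>e. has_expansion t \<tau> (\<tau> * norm (wavevec k\<^sub>0))
        (dissipation_rate (\<lambda>k. mass_density (fh \<tau> k)) k\<^sub>0 t) e"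
    proof eventually_elim
      case (elim \<tau>)
      then have \<tau>: "0 < \<tau>" and "\<tau> * norm (wavevec k\<^sub>0) < sqrt (pi / 2)"
        using \<kappa> by (auto simp: pos_less_divide_eq)
      then have "norm (wavevec k\<^sub>0) < critical_wave_number \<tau>"
        using critical_wave_number_le_iff[OF \<tau>] by (simp add: not_le[symmetric])
      from bgk_fourier_solution_expansion[OF A sol[OF \<tau> this] \<tau> t \<kappa>] show ?case .
    qed
  qed
qed

lemma kinetic_regime:
  fixes k\<^sub>0 :: "real \<Rightarrow> int ^ 'd"
  assumes A: "A > 0" and t: "0 < t" and T: "T \<subseteq> {0<..}" "0 islimpt T"
    and crit: "\<And>\<tau>. \<tau> \<in> T \<Longrightarrow> critical_wave_number \<tau> \<le> norm (wavevec (k\<^sub>0 \<tau>))"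
    and order_one: "(\<lambda>\<tau>. \<tau> * norm (wavevec (k\<^sub>0 \<tau>))) \<in> \<Theta>[at 0 within T](\<lambda>_. 1)"
    and sol: "\<And>\<tau>. \<tau> \<in> T \<Longrightarrow> bgk_fourier_solution \<tau> (cosine_data A (k\<^sub>0 \<tau>)) (fh \<tau>)"
  defines "\<Delta> \<equiv> \<lambda>\<tau>. dissipation_rate (\<lambda>k. mass_density (fh \<tau> k)) (k\<^sub>0 \<tau>) t"
  shows "\<not> \<Delta> \<sim>[at 0 within T] (\<lambda>\<tau>. complex_of_real (\<tau> * (norm (wavevec (k\<^sub>0 \<tau>)))\<^sup>2))"
    and "filterlim \<Delta> at_infinity (at 0 within T)"
    and "\<Delta> \<sim>[at 0 within T]
      (\<lambda>\<tau>. - deriv plasma_Z (zeta_hat (\<tau> * norm (wavevec (k\<^sub>0 \<tau>)))) / complex_of_real \<tau>)"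
proof -
  let ?F = "at 0 within T"
  let ?\<kappa> = "\<lambda>\<tau>. norm (wavevec (k\<^sub>0 \<tau>))"
  have F: "?F \<le> at_right 0" "?F \<noteq> bot"
    using T by (auto intro: at_le simp: trivial_limit_within)
  have inT: "\<forall>\<^sub>F \<tau> in ?F. \<tau> \<in> T" by (simp add: eventually_at_filter)
  have low: "sqrt (pi / 2) \<le> \<tau> * ?\<kappa> \<tau>" if "\<tau> \<in> T" for \<tau>
    using critical_wave_number_le_iff[of \<tau>] crit[OF that] T(1) that by auto
  obtain C where "\<forall>\<^sub>F \<tau> in ?F. norm (\<tau> * ?\<kappa> \<tau>) \<le> C * norm (1::real)"
    using landau_o.bigE[OF bigthetaD1[OF order_one]] by blast
  then have up: "\<forall>\<^sub>F \<tau> in ?F. \<tau> * ?\<kappa> \<tau> \<le> C" by (auto elim!: eventually_mono)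
  have ev: "\<forall>\<^sub>F \<tau> in ?F. sqrt (pi / 2) \<le> \<tau> * ?\<kappa> \<tau> \<and> \<tau> * ?\<kappa> \<tau> \<le> C \<and>
      (\<exists>e. has_expansion t \<tau> (\<tau> * ?\<kappa> \<tau>) (\<Delta> \<tau>) e)"
    using inT up
  proof eventually_elim
    case (elim \<tau>)
    have \<tau>: "0 < \<tau>" using elim(1) T(1) by auto
    have "0 < \<tau> * ?\<kappa> \<tau>" using low[OF elim(1)] sqrt_half_pi_pos by linarith
    then have "0 < ?\<kappa> \<tau>" using \<tau> by (simp only: zero_less_mult_iff) auto
    from bgk_fourier_solution_expansion[OF A sol[OF elim(1)] \<tau> t this] low[OF elim(1)] elim(2)
    show ?case by (simp add: \<Delta>_def)
  qed
  note asym = kinetic_asymptotics[OF F(1) t ev]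
  have lowF: "\<forall>\<^sub>F \<tau> in ?F. sqrt (pi / 2) \<le> \<tau> * ?\<kappa> \<tau>"
    using inT low by (auto elim: eventually_mono)
  show "\<not> \<Delta> \<sim>[?F] (\<lambda>\<tau>. complex_of_real (\<tau> * (?\<kappa> \<tau>)\<^sup>2))"
    by (rule kinetic_not_hydrodynamic[OF F lowF asym(1)])
  show "filterlim \<Delta> at_infinity ?F"
    by (rule tends_to_infinity_of_inverse_bound[OF F(1), of "1/2"]) (use asym(2) in \<open>auto elim!: eventually_mono\<close>)
  have "\<forall>\<^sub>F \<tau> in ?F. complex_of_real (decay_rate (\<tau> * ?\<kappa> \<tau>) / \<tau>)
      = - deriv plasma_Z (zeta_hat (\<tau> * ?\<kappa> \<tau>)) / complex_of_real \<tau>"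
    using lowF
  proof eventually_elim
    case (elim \<tau>)
    then have "0 < \<tau> * ?\<kappa> \<tau>" using sqrt_half_pi_pos by linarith
    then show ?case by (simp only: deriv_plasma_Z_decay_rate of_real_divide)
  qed
  from asymp_equiv_trans[OF asym(1) asymp_equiv_refl_ev[OF this]]
  show "\<Delta> \<sim>[?F] (\<lambda>\<tau>. - deriv plasma_Z (zeta_hat (\<tau> * ?\<kappa> \<tau>)) / complex_of_real \<tau>)" .
qed

section \<open>A plane wave in physical space\<close>

text \<open>The real part of \<open>2 exp (i (k \<bullet> x))\<close> times the kinetic mode with real data \<open>A\<close>.\<close>

definition bgk_wave ::
  "real \<Rightarrow> real \<Rightarrow> int ^ 'd \<Rightarrow> (real \<Rightarrow> real) \<Rightarrow> real ^ 'd \<Rightarrow> real ^ 'd \<Rightarrow> real \<Rightarrow> real" where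
  "bgk_wave A \<tau> k r x v t =
     2 * (cos (wavevec k \<bullet> x) * Re (kinetic_mode \<tau> (wavevec k) (complex_of_real A) r v t)
        - sin (wavevec k \<bullet> x) * Im (kinetic_mode \<tau> (wavevec k) (complex_of_real A) r v t))"

lemma bgk_wave_initial: "bgk_wave A \<tau> k r x v 0 = cosine_data A k x v"
  by (simp add: bgk_wave_def kinetic_mode_0 cosine_data_def)

lemma wavevec_periodic:
  fixes k :: "int ^ 'd"
  shows "cos (wavevec k \<bullet> (x + axis i (2 * pi))) = cos (wavevec k \<bullet> x)"
    and "sin (wavevec k \<bullet> (x + axis i (2 * pi))) = sin (wavevec k \<bullet> x)"
proof -
  have "wavevec k \<bullet> (x + axis i (2 * pi)) = wavevec k \<bullet> x + 2 * pi * real_of_int (k $ i)"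
    by (simp add: inner_add_right inner_axis wavevec_def)
  moreover have "sin (2 * pi * real_of_int n) = 0" "cos (2 * pi * real_of_int n) = 1" for n
    using sin_int_2pin[of n] cos_int_2pin[of n] by simp_all
  ultimately show "cos (wavevec k \<bullet> (x + axis i (2 * pi))) = cos (wavevec k \<bullet> x)"
    and "sin (wavevec k \<bullet> (x + axis i (2 * pi))) = sin (wavevec k \<bullet> x)"
    by (simp_all add: cos_add sin_add)
qed

lemma bgk_wave_mass:
  fixes k :: "int ^ 'd"
  assumes r: "relaxation_profile (\<tau> * norm (wavevec k)) r" and \<tau>: "0 < \<tau>" and t: "0 \<le> t"
  shows "integrable lborel (\<lambda>v. bgk_wave A \<tau> k r x v t)"
    and "mass_density (bgk_wave A \<tau> k r x) t = 2 * A * cos (wavevec k \<bullet> x) * r (t / \<tau>)"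
proof -
  let ?F = "\<lambda>v. kinetic_mode \<tau> (wavevec k) (complex_of_real A) r v t"
  note F = kinetic_mode_mass[OF r \<tau> t, of "complex_of_real A"]
  have R: "integrable lborel (\<lambda>v. Re (?F v))" "integrable lborel (\<lambda>v. Im (?F v))"
    using F(1) by auto
  then show "integrable lborel (\<lambda>v. bgk_wave A \<tau> k r x v t)"
    unfolding bgk_wave_def by (intro integrable_mult_right Bochner_Integration.integrable_diff)
  have "mass_density (bgk_wave A \<tau> k r x) t
      = 2 * (cos (wavevec k \<bullet> x) * (LINT v|lborel. Re (?F v)) - sin (wavevec k \<bullet> x) * (LINT v|lborel. Im (?F v)))"
    unfolding mass_density_def bgk_wave_def using R by simp
  then show "mass_density (bgk_wave A \<tau> k r x) t = 2 * A * cos (wavevec k \<bullet> x) * r (t / \<tau>)"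
    using F by simp
qed

lemma bgk_wave_solution:
  fixes k :: "int ^ 'd"
  assumes r: "relaxation_profile (\<tau> * norm (wavevec k)) r" and \<tau>: "0 < \<tau>"
  shows "bgk_solution \<tau> (bgk_wave A \<tau> k r)"
  unfolding bgk_solution_def
proof (intro conjI allI impI)
  fix x v :: "real ^ 'd" and t :: real and i assume t: "0 \<le> t"
  show "bgk_wave A \<tau> k r (x + axis i (2 * pi)) v t = bgk_wave A \<tau> k r x v t"
    by (simp only: bgk_wave_def wavevec_periodic)
  show "integrable lborel (\<lambda>v. bgk_wave A \<tau> k r x v t)" by (rule bgk_wave_mass(1)[OF r \<tau> t])
  obtain d where d: "((\<lambda>t. r (t / \<tau>)) has_real_derivative d) (at t within {0..})"
    using relaxation_profile_scaled_differentiable[OF r \<tau> t] by blast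
  have "(\<lambda>t. 2 * A * cos (wavevec k \<bullet> x) * r (t / \<tau>)) differentiable (at t within {0..})"
    using DERIV_cmult[OF d] real_differentiable_def by blast
  then show "mass_density (bgk_wave A \<tau> k r x) differentiable (at t within {0..})"
    by (rule differentiable_transform_within[where d = 1]) (use t bgk_wave_mass(2)[OF r \<tau>] in auto)
next
  fix x v :: "real ^ 'd" and t :: real assume t: "0 \<le> t"
  let ?F = "kinetic_mode \<tau> (wavevec k) (complex_of_real A) r v"
  define \<theta> where "\<theta> = wavevec k \<bullet> x"
  define F' where "F' = - \<i> * complex_of_real (wavevec k \<bullet> v) * ?F t
     - 1 / complex_of_real \<tau> * (?F t - complex_of_real A * complex_of_real (r (t / \<tau>)) * complex_of_real (maxwellian v))"
  have F: "(?F has_vector_derivative F') (at t within {0..})"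
    unfolding F'_def by (rule kinetic_mode_has_derivative[OF r \<tau> t])
  have Re: "((\<lambda>t. Re (?F t)) has_real_derivative Re F') (at t within {0..})"
    and Im: "((\<lambda>t. Im (?F t)) has_real_derivative Im F') (at t within {0..})"
    using bounded_linear.has_vector_derivative[OF bounded_linear_Re F]
      bounded_linear.has_vector_derivative[OF bounded_linear_Im F]
    by (simp_all add: has_real_derivative_iff_has_vector_derivative)
  define grad where "grad = (2 * (- sin \<theta> * Re (?F t) - cos \<theta> * Im (?F t))) *\<^sub>R wavevec k"
  have 1: "(bgk_wave A \<tau> k r x v has_real_derivative 2 * (cos \<theta> * Re F' - sin \<theta> * Im F')) (at t within {0..})"
    unfolding bgk_wave_def[abs_def] \<theta>_def by (intro DERIV_cmult DERIV_diff Re Im)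
  have 2: "GDERIV (\<lambda>y. bgk_wave A \<tau> k r y v t) x :> grad"
    unfolding gderiv_def bgk_wave_def grad_def \<theta>_def
    by (auto intro!: derivative_eq_intros simp: algebra_simps inner_commute)
  have 3: "2 * (cos \<theta> * Re F' - sin \<theta> * Im F') + v \<bullet> grad
      = - 1 / \<tau> * (bgk_wave A \<tau> k r x v t - mass_density (bgk_wave A \<tau> k r x) t * maxwellian v)"
  proof -
    have R: "Re F' = (wavevec k \<bullet> v) * Im (?F t) - 1 / \<tau> * (Re (?F t) - A * r (t / \<tau>) * maxwellian v)"
      and I: "Im F' = - (wavevec k \<bullet> v) * Re (?F t) - 1 / \<tau> * Im (?F t)"
      by (simp_all add: F'_def)
    show ?thesis unfolding R I bgk_wave_mass(2)[OF r \<tau> t] grad_def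
      unfolding bgk_wave_def \<theta>_def[symmetric] inner_scaleR_right inner_commute[of v]
      by (simp add: algebra_simps)
  qed
  show "\<exists>ft grad. (bgk_wave A \<tau> k r x v has_real_derivative ft) (at t within {0..}) \<and>
        GDERIV (\<lambda>y. bgk_wave A \<tau> k r y v t) x :> grad \<and>
        ft + v \<bullet> grad = - 1 / \<tau> * (bgk_wave A \<tau> k r x v t - mass_density (bgk_wave A \<tau> k r x) t * maxwellian v)"
    using 1 2 3 by blast
qed

text \<open>The coefficient at \<open>k\<close> of the wave is a linear combination of the real and the imaginary part of
  the kinetic mode. After averaging over velocities only the real part remains, as the density
  of a mode with real data is real.\<close>

lemma bgk_wave_fourier_mass:
  fixes k :: "int ^ 'd"
  assumes r: "relaxation_profile (\<tau> * norm (wavevec k)) r" and \<tau>: "0 < \<tau>" and t: "0 \<le> t"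
  shows "mass_density (\<lambda>v t. fourier_coeff (\<lambda>x. bgk_wave A \<tau> k r x v t) k) t
     = cosine_coeff A k k * complex_of_real (r (t / \<tau>))"
proof -
  let ?F = "\<lambda>v. kinetic_mode \<tau> (wavevec k) (complex_of_real A) r v t"
  let ?B = "cbox 0 (vec (2 * pi)) :: (real ^ 'd) set"
  let ?e = "\<lambda>x::real ^ 'd. exp (- \<i> * complex_of_real (wavevec k \<bullet> x))"
  define a where "a = fourier_coeff (\<lambda>x. 2 * cos (wavevec k \<bullet> x)) k"
  define b where "b = fourier_coeff (\<lambda>x. 2 * sin (wavevec k \<bullet> x)) k"
  have ic: "set_integrable lborel ?B (\<lambda>x. complex_of_real (2 * cos (wavevec k \<bullet> x)) * ?e x)"
    and sn: "set_integrable lborel ?B (\<lambda>x. complex_of_real (2 * sin (wavevec k \<bullet> x)) * ?e x)"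
    by (intro set_integrable_torus continuous_intros)+
  have split: "fourier_coeff (\<lambda>x. 2 * (cos (wavevec k \<bullet> x) * u - sin (wavevec k \<bullet> x) * w)) k
      = a * complex_of_real u - b * complex_of_real w" for u w
  proof -
    have "complex_of_real (2 * (cos (wavevec k \<bullet> x) * u - sin (wavevec k \<bullet> x) * w)) * ?e x
       = complex_of_real (2 * cos (wavevec k \<bullet> x)) * ?e x * complex_of_real u
         - complex_of_real (2 * sin (wavevec k \<bullet> x)) * ?e x * complex_of_real w" for x :: "real ^ 'd"
      by (simp add: algebra_simps)
    then show ?thesis unfolding fourier_coeff_def a_def b_def
      by (simp only: set_integral_diff(2)[OF set_integrable_mult_left[OF ic] set_integrable_mult_left[OF sn]]
          set_integral_mult_left diff_divide_distrib times_divide_eq_left)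
  qed
  note F = kinetic_mode_mass[OF r \<tau> t, of "complex_of_real A"]
  have "integrable lborel (\<lambda>v. complex_of_real (Re (?F v)))" "integrable lborel (\<lambda>v. complex_of_real (Im (?F v)))"
    using F(1) by auto
  then have "mass_density (\<lambda>v t. fourier_coeff (\<lambda>x. bgk_wave A \<tau> k r x v t) k) t
     = a * (LINT v|lborel. complex_of_real (Re (?F v))) - b * (LINT v|lborel. complex_of_real (Im (?F v)))"
    unfolding mass_density_def bgk_wave_def split by simp
  also have "\<dots> = (a * complex_of_real A) * complex_of_real (r (t / \<tau>))" using F by simp
  also have "a * complex_of_real A = cosine_coeff A k k"
  proof -
    have "cosine_coeff A k k = fourier_coeff (\<lambda>x. 2 * (cos (wavevec k \<bullet> x) * A - sin (wavevec k \<bullet> x) * 0)) k"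
      by (simp add: cosine_coeff_def mult_ac)
    then show ?thesis unfolding split by simp
  qed
  finally show ?thesis .
qed

text \<open>Rounding the critical wave number up to the next integer changes \<open>b = \<tau> |k|\<close> by at most
  \<open>\<tau>\<close>, so \<open>b\<close> stays between \<open>sqrt (\<pi> / 2)\<close> and \<open>sqrt (\<pi> / 2) + 1\<close> for \<open>\<tau> \<le> 1\<close>.\<close>

lemma inverse_tau_dissipation_exists:
  assumes A: "A > 0"
  shows "\<exists>(k\<^sub>0 :: real \<Rightarrow> int ^ 'd) (f :: real \<Rightarrow> real ^ 'd \<Rightarrow> real ^ 'd \<Rightarrow> real \<Rightarrow> real).
        (\<forall>\<tau>>0. bgk_solution \<tau> (f \<tau>) \<and> (\<forall>x v. f \<tau> x v 0 = cosine_data A (k\<^sub>0 \<tau>) x v)) \<and>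
        (\<forall>t>0. (\<lambda>\<tau>. dissipation_rate
                       (\<lambda>k. mass_density (\<lambda>v t. fourier_coeff (\<lambda>x. f \<tau> x v t) k)) (k\<^sub>0 \<tau>) t)
            \<in> \<Theta>[at_right 0](\<lambda>\<tau>. complex_of_real (1 / \<tau>)))"
proof -
  obtain R where R: "\<And>b. relaxation_profile b (R b)"
    using relaxation_solution_exists unfolding relaxation_profile_def by metis
  define k\<^sub>0 :: "real \<Rightarrow> int ^ 'd" where "k\<^sub>0 \<tau> = axis undefined \<lceil>critical_wave_number \<tau>\<rceil>" for \<tau>
  define \<beta> where "\<beta> \<tau> = \<tau> * norm (wavevec (k\<^sub>0 \<tau>))" for \<tau>
  define f where "f \<tau> = bgk_wave A \<tau> (k\<^sub>0 \<tau>) (R (\<beta> \<tau>))" for \<tau>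
  have norm_k: "norm (wavevec (k\<^sub>0 \<tau>)) = real_of_int \<lceil>critical_wave_number \<tau>\<rceil>" if "0 < \<tau>" for \<tau>
  proof -
    have "wavevec (k\<^sub>0 \<tau>) = real_of_int \<lceil>critical_wave_number \<tau>\<rceil> *\<^sub>R axis undefined 1"
      by (simp add: wavevec_def k\<^sub>0_def axis_def vec_eq_iff)
    moreover have "0 \<le> real_of_int \<lceil>critical_wave_number \<tau>\<rceil>"
      using that le_of_int_ceiling[of "critical_wave_number \<tau>"]
      by (smt (verit) critical_wave_number_def divide_pos_pos mult_pos_pos sqrt_half_pi_pos)
    ultimately show ?thesis by simp
  qed
  have "(\<lambda>\<tau>. dissipation_rate (\<lambda>k. mass_density (\<lambda>v t. fourier_coeff (\<lambda>x. f \<tau> x v t) k)) (k\<^sub>0 \<tau>) t)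
      \<in> \<Theta>[at_right 0](\<lambda>\<tau>. complex_of_real (1 / \<tau>))" (is "?\<Delta> \<in> _") if t: "0 < t" for t
  proof -
    have pos: "\<forall>\<^sub>F \<tau> in at_right 0. 0 < \<tau> \<and> \<tau> < (1::real)"
      using eventually_at_right_real[of 0 1] by (auto elim: eventually_mono)
    have ev: "\<forall>\<^sub>F \<tau> in at_right 0. sqrt (pi / 2) \<le> \<beta> \<tau> \<and> \<beta> \<tau> \<le> sqrt (pi / 2) + 1 \<and>
        (\<exists>e. has_expansion t \<tau> (\<beta> \<tau>) (?\<Delta> \<tau>) e)"
      using pos
    proof eventually_elim
      case (elim \<tau>)
      then have \<tau>: "0 < \<tau>" by simp
      have low: "sqrt (pi / 2) \<le> \<beta> \<tau>"
        using critical_wave_number_le_iff[OF \<tau>] le_of_int_ceiling unfolding \<beta>_def norm_k[OF \<tau>] by blast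
      have "\<beta> \<tau> \<le> \<tau> * (critical_wave_number \<tau> + 1)"
        unfolding \<beta>_def norm_k[OF \<tau>] using \<tau> by (intro mult_left_mono of_int_ceiling_le_add_one) auto
      also have "\<dots> = sqrt (pi / 2) + \<tau>" using \<tau> by (simp add: critical_wave_number_def field_simps)
      finally have up: "\<beta> \<tau> \<le> sqrt (pi / 2) + 1" using elim by simp
      have b: "0 < \<beta> \<tau>" using low sqrt_half_pi_pos by linarith
      have r: "relaxation_profile (\<tau> * norm (wavevec (k\<^sub>0 \<tau>))) (R (\<beta> \<tau>))" using R by (simp add: \<beta>_def)
      have "\<exists>e. has_expansion t \<tau> (\<beta> \<tau>) (?\<Delta> \<tau>) e"
        unfolding has_expansion_def
        by (rule dissipation_rate_expansion[where \<rho> = "\<lambda>k. mass_density (\<lambda>v t. fourier_coeff (\<lambda>x. f \<tau> x v t) k)"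
              and k = "k\<^sub>0 \<tau>" and r = "R (\<beta> \<tau>)", OF _ cosine_coeff_nonzero[OF A] \<tau> t R b])
           (unfold f_def, rule bgk_wave_fourier_mass[OF r \<tau>])
      with low up show ?case by blast
    qed
    show ?thesis
      by (rule bigthetaI'[OF _ _ kinetic_asymptotics(2)[OF order_refl t ev]]) (auto intro: add_nonneg_pos)
  qed
  moreover have "bgk_solution \<tau> (f \<tau>) \<and> (\<forall>x v. f \<tau> x v 0 = cosine_data A (k\<^sub>0 \<tau>) x v)" if "0 < \<tau>" for \<tau>
  proof -
    have "relaxation_profile (\<tau> * norm (wavevec (k\<^sub>0 \<tau>))) (R (\<beta> \<tau>))" using R by (simp add: \<beta>_def)
    then show ?thesis unfolding f_def by (intro conjI allI bgk_wave_solution that bgk_wave_initial)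
  qed
  ultimately show ?thesis by blast
qed

section \<open>The scaling theorem\<close>

theorem theorem3p2:
  fixes A :: real
  assumes "A > 0"
  shows
    "(\<forall>\<tau>>0. \<forall>k\<^sub>0 :: int ^ 'd. \<exists>fh. bgk_fourier_solution \<tau> (cosine_data A k\<^sub>0) fh)
   \<and>
     (\<forall>(k\<^sub>0 :: int ^ 'd) fh.
        (\<forall>\<tau>>0. norm (wavevec k\<^sub>0) < critical_wave_number \<tau> \<longrightarrow>
           bgk_fourier_solution \<tau> (cosine_data A k\<^sub>0) (fh \<tau>)) \<longrightarrow>
        (\<forall>t>0. (\<lambda>\<tau>. dissipation_rate (\<lambda>k. mass_density (fh \<tau> k)) k\<^sub>0 t)
            \<sim>[at_right 0] (\<lambda>\<tau>. complex_of_real (\<tau> * (norm (wavevec k\<^sub>0))\<^sup>2))))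
   \<and>
     (\<forall>(T :: real set) (k\<^sub>0 :: real \<Rightarrow> int ^ 'd) fh.
        T \<subseteq> {0<..} \<and> 0 islimpt T \<and>
        (\<forall>\<tau>\<in>T. norm (wavevec (k\<^sub>0 \<tau>)) \<ge> critical_wave_number \<tau>) \<and>
        (\<lambda>\<tau>. \<tau> * norm (wavevec (k\<^sub>0 \<tau>))) \<in> \<Theta>[at 0 within T](\<lambda>_. 1) \<and>
        (\<forall>\<tau>\<in>T. bgk_fourier_solution \<tau> (cosine_data A (k\<^sub>0 \<tau>)) (fh \<tau>)) \<longrightarrow>
        (\<forall>t>0.
           \<not> ((\<lambda>\<tau>. dissipation_rate (\<lambda>k. mass_density (fh \<tau> k)) (k\<^sub>0 \<tau>) t)
               \<sim>[at 0 within T] (\<lambda>\<tau>. complex_of_real (\<tau> * (norm (wavevec (k\<^sub>0 \<tau>)))\<^sup>2))) \<and>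
           filterlim (\<lambda>\<tau>. dissipation_rate (\<lambda>k. mass_density (fh \<tau> k)) (k\<^sub>0 \<tau>) t)
             at_infinity (at 0 within T) \<and>
           (\<lambda>\<tau>. dissipation_rate (\<lambda>k. mass_density (fh \<tau> k)) (k\<^sub>0 \<tau>) t)
             \<sim>[at 0 within T]
             (\<lambda>\<tau>. - deriv plasma_Z (zeta_hat (\<tau> * norm (wavevec (k\<^sub>0 \<tau>)))) / complex_of_real \<tau>)))
   \<and>
     (\<exists>(k\<^sub>0 :: real \<Rightarrow> int ^ 'd) (f :: real \<Rightarrow> real ^ 'd \<Rightarrow> real ^ 'd \<Rightarrow> real \<Rightarrow> real).
        (\<forall>\<tau>>0. bgk_solution \<tau> (f \<tau>) \<and> (\<forall>x v. f \<tau> x v 0 = cosine_data A (k\<^sub>0 \<tau>) x v)) \<and>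
        (\<forall>t>0. (\<lambda>\<tau>. dissipation_rate
                       (\<lambda>k. mass_density (\<lambda>v t. fourier_coeff (\<lambda>x. f \<tau> x v t) k)) (k\<^sub>0 \<tau>) t)
            \<in> \<Theta>[at_right 0](\<lambda>\<tau>. complex_of_real (1 / \<tau>))))"
proof (intro conjI allI impI)
  show "\<exists>fh. bgk_fourier_solution \<tau> (cosine_data A k\<^sub>0) fh" if "\<tau> > 0" for \<tau> and k\<^sub>0 :: "int ^ 'd"
    using that by (rule bgk_fourier_solution_exists)
next
  fix k\<^sub>0 :: "int ^ 'd" and fh :: "real \<Rightarrow> int ^ 'd \<Rightarrow> real ^ 'd \<Rightarrow> real \<Rightarrow> complex" and t :: real
  assume "\<forall>\<tau>>0. norm (wavevec k\<^sub>0) < critical_wave_number \<tau> \<longrightarrow>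
      bgk_fourier_solution \<tau> (cosine_data A k\<^sub>0) (fh \<tau>)" and t: "t > 0"
  then show "(\<lambda>\<tau>. dissipation_rate (\<lambda>k. mass_density (fh \<tau> k)) k\<^sub>0 t)
      \<sim>[at_right 0] (\<lambda>\<tau>. complex_of_real (\<tau> * (norm (wavevec k\<^sub>0))\<^sup>2))"
    by (intro hydrodynamic_regime[OF assms t]) auto
next
  fix T :: "real set" and k\<^sub>0 :: "real \<Rightarrow> int ^ 'd" and fh :: "real \<Rightarrow> int ^ 'd \<Rightarrow> real ^ 'd \<Rightarrow> real \<Rightarrow> complex"
    and t :: real
  assume H: "T \<subseteq> {0<..} \<and> 0 islimpt T \<and>
        (\<forall>\<tau>\<in>T. norm (wavevec (k\<^sub>0 \<tau>)) \<ge> critical_wave_number \<tau>) \<and>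
        (\<lambda>\<tau>. \<tau> * norm (wavevec (k\<^sub>0 \<tau>))) \<in> \<Theta>[at 0 within T](\<lambda>_. 1) \<and>
        (\<forall>\<tau>\<in>T. bgk_fourier_solution \<tau> (cosine_data A (k\<^sub>0 \<tau>)) (fh \<tau>))" and t: "t > 0"
  then have T: "T \<subseteq> {0<..}" "0 islimpt T"
    and crit: "\<And>\<tau>. \<tau> \<in> T \<Longrightarrow> critical_wave_number \<tau> \<le> norm (wavevec (k\<^sub>0 \<tau>))"
    and one: "(\<lambda>\<tau>. \<tau> * norm (wavevec (k\<^sub>0 \<tau>))) \<in> \<Theta>[at 0 within T](\<lambda>_. 1)"
    and sol: "\<And>\<tau>. \<tau> \<in> T \<Longrightarrow> bgk_fourier_solution \<tau> (cosine_data A (k\<^sub>0 \<tau>)) (fh \<tau>)"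
    by auto
  note R = kinetic_regime[OF assms t T crit one sol]
  show "\<not> (\<lambda>\<tau>. dissipation_rate (\<lambda>k. mass_density (fh \<tau> k)) (k\<^sub>0 \<tau>) t)
      \<sim>[at 0 within T] (\<lambda>\<tau>. complex_of_real (\<tau> * (norm (wavevec (k\<^sub>0 \<tau>)))\<^sup>2))" by (rule R(1))
  show "filterlim (\<lambda>\<tau>. dissipation_rate (\<lambda>k. mass_density (fh \<tau> k)) (k\<^sub>0 \<tau>) t)
      at_infinity (at 0 within T)" by (rule R(2))
  show "(\<lambda>\<tau>. dissipation_rate (\<lambda>k. mass_density (fh \<tau> k)) (k\<^sub>0 \<tau>) t) \<sim>[at 0 within T]
      (\<lambda>\<tau>. - deriv plasma_Z (zeta_hat (\<tau> * norm (wavevec (k\<^sub>0 \<tau>)))) / complex_of_real \<tau>)" by (rule R(3))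
qed (rule inverse_tau_dissipation_exists[OF assms])

end
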